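(* Let $\mathbf S$ be a super Fermat theory which admits integration. For every differential $\mathbf S$-algebra $A$, the canonical map $$j:A\to A\odot\widehat\Omega_1$$ is a homology isomorphism (in other words, $\mathbf S$ satisfies the homotopy invariance axiom).
   Context: All rings contain $\mathbb Q$; "super" means $\mathbb Z_2$-graded. Super Fermat theories. $\mathbf{SCom}$ is the two-sorted Lawvere theory of supercommutative $\mathbb Q$-superalgebras. A super Fermat theory is a two-sorted Lawvere theory $\mathbf S$ (objects $(m|n)$, products of $m$ copies of the even sort $(1|0)$ and $n$ copies of the odd sort $(0|1)$) with a morphism of theories $\mathbf{SCom}\to\mathbf S$. $\mathbf S$-algebras are finite-product-preserving functors $\mathbf S\to\mathbf{Set}$. The free $\mathbf S$-algebra on $m$ even and $n$ odd generators is $\mathbf S(m|n)=\mathbb K\{x_1,\dots,x_m;\xi_1,\dots,\xi_n\}$, $\mathbb K=\mathbf S(0|0)$. Required: (i) each $f\in\mathbb K\{x,z;\zeta\}$ has a unique $g\in\mathbb K\{x,y,z;\zeta\}$ with $f(x,z;\zeta)-f(y,z;\zeta)=(x-y)g(x,y,z;\zeta)$; (ii) each $f\in\mathbb K\{z;\xi,\zeta\}$ has a unique $h\in\mathbb K\{z;\zeta\}$ with $f(z;\theta,\zeta)-f(z;\eta,\zeta)=(\theta-\eta)h(z;\zeta)$ ($z,\zeta$ finite tuples of even/odd variables). Put $\frac{\partial f}{\partial x}=g(x,x,z;\zeta)$, $\frac{\partial f}{\partial\xi}=h$. $\mathbf S$ admits integration if for all $m,n$ every $f\in\mathbf S(m|n)\{t\}$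 ($t$ an extra even generator) is $\frac{\partial F}{\partial t}$ for some $F\in\mathbf S(m|n)\{t\}$, and any two such $F$ differ by an element of $\mathbf S(m|n)$. A differential $\mathbf S$-algebra is an $\mathbf S$-algebra $A$ with a $\mathbb K$-linear parity-reversing $d:A\to A$, $d^2=0$, that is an odd $\mathbf S$-derivation: $d(A(f)(\mathbf a,\mathbf b))=\sum_id(a^i)A(\frac{\partial f}{\partial x_i})(\mathbf a,\mathbf b)+\sum_jd(b^j)A(\frac{\partial f}{\partial\xi_j})(\mathbf a,\mathbf b)$ for all $f\in\mathbf S(m|n)$, even $a^i$, odd $b^j$. Its homology is $\ker d/\operatorname{im}d$. $\odot$ is the coproduct of (differential) $\mathbf S$-algebras. $\widehat\Omega_1=\mathbb K\{t,dt\}$ is the free $\mathbf S$-algebra on one even generator $t$ and one odd generator $dt$, with $d(t)=dt$, $d(dt)=0$; $A\odot\widehat\Omega_1=A\{t,dt\}$ has differential $d_A+dt\frac{\partial}{\partial t}$. *)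

theory Defs
  imports Complex_Main
begin

section \<open>Two-sorted Lawvere theories and their algebras\<close>

text \<open>
  Parities are Booleans, with \<open>True\<close> standing for odd, added by \<open>psum\<close>.
  Elements of superalgebras are always homogeneous: the even and the odd elements
  of an algebra are its values on the two sorts \<open>(1|0)\<close> and \<open>(0|1)\<close>.
\<close>

definition psum :: "bool \<Rightarrow> bool \<Rightarrow> bool" where
  "psum p q \<longleftrightarrow> p \<noteq> q"

type_synonym obj = "nat \<times> nat"

definition srt :: "bool \<Rightarrow> obj" where
  "srt p = (if p then (0, 1) else (1, 0))"

record 'f lawvere =
  arr :: "'f set"
  src :: "'f \<Rightarrow> obj"
  tgt :: "'f \<Rightarrow> obj"
  idt :: "obj \<Rightarrow> 'f"
  cmp :: "'f \<Rightarrow> 'f \<Rightarrow> 'f"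
  prE :: "obj \<Rightarrow> nat \<Rightarrow> 'f"
  prO :: "obj \<Rightarrow> nat \<Rightarrow> 'f"

definition hom :: "('f, 'z) lawvere_scheme \<Rightarrow> obj \<Rightarrow> obj \<Rightarrow> 'f set" where
  "hom S X Y = {f \<in> arr S. src S f = X \<and> tgt S f = Y}"

text \<open>
  \<open>cmp S g f\<close> is \<open>g\<close> after \<open>f\<close>. The arrows \<open>prE S (m, n) i\<close> for \<open>i < m\<close> and \<open>prO S (m, n) j\<close> for
  \<open>j < n\<close> exhibit \<open>(m|n)\<close> as a product of \<open>m\<close> copies of \<open>(1|0)\<close> and \<open>n\<close> copies of \<open>(0|1)\<close>.
\<close>

locale lawvere_theory =
  fixes S :: "('f, 'z) lawvere_scheme"
  assumes src_tgt: "f \<in> arr S \<Longrightarrow> f \<in> hom S (src S f) (tgt S f)"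
    and idt: "idt S X \<in> hom S X X"
    and cmp: "f \<in> hom S X Y \<Longrightarrow> g \<in> hom S Y Z \<Longrightarrow> cmp S g f \<in> hom S X Z"
    and cmp_idt: "f \<in> hom S X Y \<Longrightarrow> cmp S f (idt S X) = f"
    and idt_cmp: "f \<in> hom S X Y \<Longrightarrow> cmp S (idt S Y) f = f"
    and cmp_assoc: "f \<in> hom S W X \<Longrightarrow> g \<in> hom S X Y \<Longrightarrow> h \<in> hom S Y Z \<Longrightarrow>
      cmp S h (cmp S g f) = cmp S (cmp S h g) f"
    and prE: "i < m \<Longrightarrow> prE S (m, n) i \<in> hom S (m, n) (1, 0)"
    and prO: "j < n \<Longrightarrow> prO S (m, n) j \<in> hom S (m, n) (0, 1)"
    and prE_1: "prE S (1, 0) 0 = idt S (1, 0)"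
    and prO_1: "prO S (0, 1) 0 = idt S (0, 1)"
    and product: "set es \<subseteq> hom S X (1, 0) \<Longrightarrow> set os \<subseteq> hom S X (0, 1) \<Longrightarrow>
      \<exists>!h. h \<in> hom S X (length es, length os) \<and>
        (\<forall>i < length es. cmp S (prE S (length es, length os) i) h = es ! i) \<and>
        (\<forall>j < length os. cmp S (prO S (length es, length os) j) h = os ! j)"

text \<open>Morphisms of theories are the identity on objects.\<close>

locale theory_morphism =
  fixes R :: "('e, 'y) lawvere_scheme" and S :: "('f, 'z) lawvere_scheme" and \<phi> :: "'e \<Rightarrow> 'f"
  assumes map_hom: "f \<in> hom R X Y \<Longrightarrow> \<phi> f \<in> hom S X Y"
    and map_idt: "\<phi> (idt R X) = idt S X"
    and map_cmp: "f \<in> hom R X Y \<Longrightarrow> g \<in> hom R Y Z \<Longrightarrow> \<phi> (cmp R g f) = cmp S (\<phi> g) (\<phi> f)"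
    and map_prE: "i < m \<Longrightarrow> \<phi> (prE R (m, n) i) = prE S (m, n) i"
    and map_prO: "j < n \<Longrightarrow> \<phi> (prO R (m, n) j) = prO S (m, n) j"

text \<open>
  Algebras are functors to sets: \<open>ob A X\<close> is the value at the object \<open>X\<close>, and \<open>act A f\<close> the value
  at the arrow \<open>f\<close>.
\<close>

record ('f, 'a) alg =
  ob :: "obj \<Rightarrow> 'a set"
  act :: "'f \<Rightarrow> 'a \<Rightarrow> 'a"

definition is_tuple ::
  "('f, 'z) lawvere_scheme \<Rightarrow> ('f, 'a) alg \<Rightarrow> 'a list \<Rightarrow> 'a list \<Rightarrow> 'a \<Rightarrow> bool" where
  "is_tuple S A as bs u \<longleftrightarrow> u \<in> ob A (length as, length bs) \<and>
    (\<forall>i < length as. act A (prE S (length as, length bs) i) u = as ! i) \<and>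
    (\<forall>j < length bs. act A (prO S (length as, length bs) j) u = bs ! j)"

locale S_algebra =
  fixes S :: "('f, 'z) lawvere_scheme" and A :: "('f, 'a) alg"
  assumes act: "f \<in> hom S X Y \<Longrightarrow> a \<in> ob A X \<Longrightarrow> act A f a \<in> ob A Y"
    and act_idt: "a \<in> ob A X \<Longrightarrow> act A (idt S X) a = a"
    and act_cmp: "f \<in> hom S X Y \<Longrightarrow> g \<in> hom S Y Z \<Longrightarrow> a \<in> ob A X \<Longrightarrow>
      act A (cmp S g f) a = act A g (act A f a)"
    and preserves_products: "set as \<subseteq> ob A (1, 0) \<Longrightarrow> set bs \<subseteq> ob A (0, 1) \<Longrightarrow>
      \<exists>!u. is_tuple S A as bs u"

text \<open>\<open>eval S A f as bs\<close> is the value \<open>A(f)(a, b)\<close> at even elements \<open>as\<close> and odd elements \<open>bs\<close>.\<close>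

definition eval ::
  "('f, 'z) lawvere_scheme \<Rightarrow> ('f, 'a) alg \<Rightarrow> 'f \<Rightarrow> 'a list \<Rightarrow> 'a list \<Rightarrow> 'a" where
  "eval S A f as bs = act A f (THE u. is_tuple S A as bs u)"

definition alg_hom ::
  "('f, 'z) lawvere_scheme \<Rightarrow> ('f, 'a) alg \<Rightarrow> ('f, 'b) alg \<Rightarrow> (obj \<Rightarrow> 'a \<Rightarrow> 'b) \<Rightarrow> bool" where
  "alg_hom S A B h \<longleftrightarrow>
    (\<forall>X. \<forall>a \<in> ob A X. h X a \<in> ob B X) \<and>
    (\<forall>X Y. \<forall>f \<in> hom S X Y. \<forall>a \<in> ob A X. h Y (act A f a) = act B f (h X a))"

text \<open>
  The free algebra on \<open>m\<close> even and \<open>n\<close> odd generators is represented by \<open>(m|n)\<close>; its generators are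
  the projections. Evaluation in it is substitution.
\<close>

definition Free :: "('f, 'z) lawvere_scheme \<Rightarrow> obj \<Rightarrow> ('f, 'f) alg" where
  "Free S X = \<lparr>ob = hom S X, act = cmp S\<rparr>"

definition evars :: "('f, 'z) lawvere_scheme \<Rightarrow> obj \<Rightarrow> 'f list" where
  "evars S X = map (prE S X) [0..<fst X]"

definition ovars :: "('f, 'z) lawvere_scheme \<Rightarrow> obj \<Rightarrow> 'f list" where
  "ovars S X = map (prO S X) [0..<snd X]"

text \<open>
  The coproduct of \<open>A\<close> and \<open>C\<close> with injections \<open>j\<close> and \<open>i\<close>. Types cannot be quantified over, so the
  algebras \<open>D\<close> against which the universal property is tested live in one fixed type. It is large
  enough for the property to entail the one for algebras in any type. Indeed, the coproduct of \<open>A\<close>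
  and \<open>C\<close> always exists as an algebra of equivalence classes of triples \<open>(f, a, c)\<close>, standing for
  the formal expressions \<open>f(a, c)\<close> with \<open>a\<close> in some \<open>ob A X\<close> and \<open>c\<close> in some \<open>ob C Y\<close>, so it occurs
  in the left summand; \<open>B\<close> itself occurs in the right summand; hence \<open>B\<close> is isomorphic to that
  coproduct.
\<close>

definition is_coproduct ::
  "('f, 'z) lawvere_scheme \<Rightarrow> ('f, 'a) alg \<Rightarrow> ('f, 'c) alg \<Rightarrow> ('f, 'b) alg \<Rightarrow>
    (obj \<Rightarrow> 'a \<Rightarrow> 'b) \<Rightarrow> (obj \<Rightarrow> 'c \<Rightarrow> 'b) \<Rightarrow> bool" where
  "is_coproduct S A C B j i \<longleftrightarrow>
    S_algebra S B \<and> alg_hom S A B j \<and> alg_hom S C B i \<and>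
    (\<forall>(D :: ('f, ('f \<times> 'a \<times> 'c) set + 'b) alg) f g.
      S_algebra S D \<and> alg_hom S A D f \<and> alg_hom S C D g \<longrightarrow>
      (\<exists>h. (alg_hom S B D h \<and>
          (\<forall>X. \<forall>a \<in> ob A X. h X (j X a) = f X a) \<and> (\<forall>X. \<forall>c \<in> ob C X. h X (i X c) = g X c)) \<and>
        (\<forall>h'. alg_hom S B D h' \<and>
          (\<forall>X. \<forall>a \<in> ob A X. h' X (j X a) = f X a) \<and> (\<forall>X. \<forall>c \<in> ob C X. h' X (i X c) = g X c) \<longrightarrow>
          (\<forall>X. \<forall>b \<in> ob B X. h' X b = h X b))))"

section \<open>The theory of supercommutative superalgebras over the rationals\<close>

text \<open>
  Arrows are tuples of terms in even variables \<open>EV i\<close> and odd variables \<open>OV j\<close>, modulo the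
  congruence generated by the axioms of unital associative supercommutative superalgebras.
\<close>

datatype sterm = EV nat | OV nat | Zero bool | One | Add sterm sterm | Neg sterm
  | Scale rat sterm | Mul sterm sterm

inductive wt :: "obj \<Rightarrow> bool \<Rightarrow> sterm \<Rightarrow> bool" for X where
  "i < fst X \<Longrightarrow> wt X False (EV i)"
| "j < snd X \<Longrightarrow> wt X True (OV j)"
| "wt X p (Zero p)"
| "wt X False One"
| "wt X p s \<Longrightarrow> wt X p t \<Longrightarrow> wt X p (Add s t)"
| "wt X p s \<Longrightarrow> wt X p (Neg s)"
| "wt X p s \<Longrightarrow> wt X p (Scale c s)"
| "wt X p s \<Longrightarrow> wt X q t \<Longrightarrow> wt X (psum p q) (Mul s t)"

inductive sceq :: "obj \<Rightarrow> bool \<Rightarrow> sterm \<Rightarrow> sterm \<Rightarrow> bool" for X where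
  sceq_refl: "wt X p s \<Longrightarrow> sceq X p s s"
| sceq_sym: "sceq X p s t \<Longrightarrow> sceq X p t s"
| sceq_trans: "sceq X p s t \<Longrightarrow> sceq X p t u \<Longrightarrow> sceq X p s u"
| cong_Add: "sceq X p s s' \<Longrightarrow> sceq X p t t' \<Longrightarrow> sceq X p (Add s t) (Add s' t')"
| cong_Neg: "sceq X p s s' \<Longrightarrow> sceq X p (Neg s) (Neg s')"
| cong_Scale: "sceq X p s s' \<Longrightarrow> sceq X p (Scale c s) (Scale c s')"
| cong_Mul: "sceq X p s s' \<Longrightarrow> sceq X q t t' \<Longrightarrow> sceq X (psum p q) (Mul s t) (Mul s' t')"
| add_assoc: "wt X p s \<Longrightarrow> wt X p t \<Longrightarrow> wt X p u \<Longrightarrow> sceq X p (Add (Add s t) u) (Add s (Add t u))"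
| add_comm: "wt X p s \<Longrightarrow> wt X p t \<Longrightarrow> sceq X p (Add s t) (Add t s)"
| add_zero: "wt X p s \<Longrightarrow> sceq X p (Add s (Zero p)) s"
| add_neg: "wt X p s \<Longrightarrow> sceq X p (Add s (Neg s)) (Zero p)"
| scale_one: "wt X p s \<Longrightarrow> sceq X p (Scale 1 s) s"
| scale_scale: "wt X p s \<Longrightarrow> sceq X p (Scale c (Scale d s)) (Scale (c * d) s)"
| scale_add_left: "wt X p s \<Longrightarrow> sceq X p (Scale (c + d) s) (Add (Scale c s) (Scale d s))"
| scale_add_right: "wt X p s \<Longrightarrow> wt X p t \<Longrightarrow>
    sceq X p (Scale c (Add s t)) (Add (Scale c s) (Scale c t))"
| mul_one: "wt X p s \<Longrightarrow> sceq X p (Mul One s) s"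
| mul_assoc: "wt X p s \<Longrightarrow> wt X q t \<Longrightarrow> wt X r u \<Longrightarrow>
    sceq X (psum (psum p q) r) (Mul (Mul s t) u) (Mul s (Mul t u))"
| mul_add: "wt X p s \<Longrightarrow> wt X q t \<Longrightarrow> wt X q u \<Longrightarrow>
    sceq X (psum p q) (Mul s (Add t u)) (Add (Mul s t) (Mul s u))"
| add_mul: "wt X p s \<Longrightarrow> wt X p t \<Longrightarrow> wt X q u \<Longrightarrow>
    sceq X (psum p q) (Mul (Add s t) u) (Add (Mul s u) (Mul t u))"
| scale_mul_left: "wt X p s \<Longrightarrow> wt X q t \<Longrightarrow> sceq X (psum p q) (Mul (Scale c s) t) (Scale c (Mul s t))"
| scale_mul_right: "wt X p s \<Longrightarrow> wt X q t \<Longrightarrow> sceq X (psum p q) (Mul s (Scale c t)) (Scale c (Mul s t))"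
| supercomm: "wt X p s \<Longrightarrow> wt X q t \<Longrightarrow>
    sceq X (psum p q) (Mul s t) (if p \<and> q then Neg (Mul t s) else Mul t s)"

primrec subst :: "sterm list \<Rightarrow> sterm list \<Rightarrow> sterm \<Rightarrow> sterm" where
  "subst es os (EV i) = es ! i"
| "subst es os (OV j) = os ! j"
| "subst es os (Zero p) = Zero p"
| "subst es os One = One"
| "subst es os (Add s t) = Add (subst es os s) (subst es os t)"
| "subst es os (Neg s) = Neg (subst es os s)"
| "subst es os (Scale c s) = Scale c (subst es os s)"
| "subst es os (Mul s t) = Mul (subst es os s) (subst es os t)"

definition scls :: "obj \<Rightarrow> bool \<Rightarrow> sterm \<Rightarrow> sterm set" where
  "scls X p s = {t. sceq X p s t}"

definition srep :: "sterm set \<Rightarrow> sterm" where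
  "srep c = (SOME s. s \<in> c)"

datatype sc_arrow = SArr (dom_of: obj) (even_of: "sterm set list") (odd_of: "sterm set list")

definition sc_cmp :: "sc_arrow \<Rightarrow> sc_arrow \<Rightarrow> sc_arrow" where
  "sc_cmp g f =
    (let X = dom_of f; \<sigma> = subst (map srep (even_of f)) (map srep (odd_of f)) in
      SArr X (map (\<lambda>c. scls X False (\<sigma> (srep c))) (even_of g))
             (map (\<lambda>c. scls X True (\<sigma> (srep c))) (odd_of g)))"

definition SCom :: "sc_arrow lawvere" where
  "SCom =
    \<lparr>arr = {SArr X es os | X es os.
       set es \<subseteq> scls X False ` Collect (wt X False) \<and> set os \<subseteq> scls X True ` Collect (wt X True)},
     src = dom_of,
     tgt = (\<lambda>f. (length (even_of f), length (odd_of f))),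
     idt = (\<lambda>X. SArr X (map (\<lambda>i. scls X False (EV i)) [0..<fst X])
                        (map (\<lambda>j. scls X True (OV j)) [0..<snd X])),
     cmp = sc_cmp,
     prE = (\<lambda>X i. SArr X [scls X False (EV i)] []),
     prO = (\<lambda>X j. SArr X [] [scls X True (OV j)])\<rparr>"

definition term_arrow :: "obj \<Rightarrow> bool \<Rightarrow> sterm \<Rightarrow> sc_arrow" where
  "term_arrow X p t = (if p then SArr X [] [scls X True t] else SArr X [scls X False t] [])"

section \<open>Super Fermat theories\<close>

text \<open>A theory \<open>S\<close> together with the morphism \<open>scom S\<close> from \<open>SCom\<close> to it.\<close>

record 'f super_theory = "'f lawvere" +
  scom :: "sc_arrow \<Rightarrow> 'f"

definition szero :: "('f, 'z) super_theory_scheme \<Rightarrow> ('f, 'a) alg \<Rightarrow> bool \<Rightarrow> 'a" where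
  "szero S A p = eval S A (scom S (term_arrow (0, 0) p (Zero p))) [] []"

definition sadd :: "('f, 'z) super_theory_scheme \<Rightarrow> ('f, 'a) alg \<Rightarrow> bool \<Rightarrow> 'a \<Rightarrow> 'a \<Rightarrow> 'a" where
  "sadd S A p a b =
    (if p then eval S A (scom S (term_arrow (0, 2) p (Add (OV 0) (OV 1)))) [] [a, b]
     else eval S A (scom S (term_arrow (2, 0) p (Add (EV 0) (EV 1)))) [a, b] [])"

definition ssub :: "('f, 'z) super_theory_scheme \<Rightarrow> ('f, 'a) alg \<Rightarrow> bool \<Rightarrow> 'a \<Rightarrow> 'a \<Rightarrow> 'a" where
  "ssub S A p a b =
    (if p then eval S A (scom S (term_arrow (0, 2) p (Add (OV 0) (Neg (OV 1))))) [] [a, b]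
     else eval S A (scom S (term_arrow (2, 0) p (Add (EV 0) (Neg (EV 1))))) [a, b] [])"

text \<open>\<open>smul S A p q a b\<close> is the product of \<open>a\<close> of parity \<open>p\<close> and \<open>b\<close> of parity \<open>q\<close>.\<close>

definition smul ::
  "('f, 'z) super_theory_scheme \<Rightarrow> ('f, 'a) alg \<Rightarrow> bool \<Rightarrow> bool \<Rightarrow> 'a \<Rightarrow> 'a \<Rightarrow> 'a" where
  "smul S A p q a b =
    (if p \<and> q then eval S A (scom S (term_arrow (0, 2) False (Mul (OV 0) (OV 1)))) [] [a, b]
     else if p then eval S A (scom S (term_arrow (1, 1) True (Mul (OV 0) (EV 0)))) [b] [a]
     else if q then eval S A (scom S (term_arrow (1, 1) True (Mul (EV 0) (OV 0)))) [a] [b]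
     else eval S A (scom S (term_arrow (2, 0) False (Mul (EV 0) (EV 1)))) [a, b] [])"

definition ssum :: "('f, 'z) super_theory_scheme \<Rightarrow> ('f, 'a) alg \<Rightarrow> bool \<Rightarrow> 'a list \<Rightarrow> 'a" where
  "ssum S A p as = foldr (sadd S A p) as (szero S A p)"

text \<open>
  The Fermat property with respect to an arbitrary one among the even variables, the \<open>i\<close>-th. The
  new variable \<open>y\<close> is placed after \<open>x\<^sub>0, \<dots>, x\<^bsub>m-1\<^esub>\<close>, that is, it is \<open>x\<^sub>m\<close>, and the equation is
  \<open>f(x\<^sub>0, \<dots>, x\<^sub>i, \<dots>, x\<^bsub>m-1\<^esub>) - f(x\<^sub>0, \<dots>, x\<^sub>m, \<dots>, x\<^bsub>m-1\<^esub>) = (x\<^sub>i - x\<^sub>m) g(x\<^sub>0, \<dots>, x\<^sub>m)\<close>.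
\<close>

definition even_quotient ::
  "('f, 'z) super_theory_scheme \<Rightarrow> obj \<Rightarrow> bool \<Rightarrow> nat \<Rightarrow> 'f \<Rightarrow> 'f \<Rightarrow> bool" where
  "even_quotient S X p i f g \<longleftrightarrow>
    (let m = fst X; n = snd X; F = Free S (Suc m, n);
         x = evars S (Suc m, n); \<xi> = ovars S (Suc m, n) in
      g \<in> hom S (Suc m, n) (srt p) \<and>
      ssub S F p (eval S F f (take m x) \<xi>) (eval S F f ((take m x)[i := x ! m]) \<xi>) =
        smul S F False p (ssub S F False (x ! i) (x ! m)) g)"

text \<open>Partial derivatives with respect to even variables, obtained by setting \<open>x\<^sub>m = x\<^sub>i\<close>.\<close>

definition pdE :: "('f, 'z) super_theory_scheme \<Rightarrow> obj \<Rightarrow> bool \<Rightarrow> nat \<Rightarrow> 'f \<Rightarrow> 'f" where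
  "pdE S X p i f =
    eval S (Free S X) (THE g. even_quotient S X p i f g) (evars S X @ [evars S X ! i]) (ovars S X)"

definition drop_nth :: "nat \<Rightarrow> 'a list \<Rightarrow> 'a list" where
  "drop_nth k xs = take k xs @ drop (Suc k) xs"

text \<open>
  Likewise for the \<open>j\<close>-th odd variable: with \<open>\<theta> = \<xi>\<^sub>j\<close> and the new variable \<open>\<eta> = \<xi>\<^sub>n\<close>. Here \<open>h\<close> does
  not involve \<open>\<xi>\<^sub>j\<close>, so it belongs to the free algebra on one odd generator less than \<open>f\<close>.
\<close>

definition odd_quotient ::
  "('f, 'z) super_theory_scheme \<Rightarrow> obj \<Rightarrow> bool \<Rightarrow> nat \<Rightarrow> 'f \<Rightarrow> 'f \<Rightarrow> bool" where
  "odd_quotient S X p j f h \<longleftrightarrow>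
    (let m = fst X; n = snd X; F = Free S (m, Suc n);
         x = evars S (m, Suc n); \<xi> = ovars S (m, Suc n) in
      h \<in> hom S (m, n - 1) (srt (\<not> p)) \<and>
      ssub S F p (eval S F f x (take n \<xi>)) (eval S F f x ((take n \<xi>)[j := \<xi> ! n])) =
        smul S F True (\<not> p) (ssub S F True (\<xi> ! j) (\<xi> ! n))
          (eval S F h x (drop_nth j (take n \<xi>))))"

definition pdO :: "('f, 'z) super_theory_scheme \<Rightarrow> obj \<Rightarrow> bool \<Rightarrow> nat \<Rightarrow> 'f \<Rightarrow> 'f" where
  "pdO S X p j f =
    eval S (Free S X) (THE h. odd_quotient S X p j f h) (evars S X) (drop_nth j (ovars S X))"

locale super_fermat_theory =
  lawvere_theory S + theory_morphism SCom S "scom S"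
  for S :: "('f, 'z) super_theory_scheme" +
  assumes fermat_even: "f \<in> hom S (m, n) (srt p) \<Longrightarrow> i < m \<Longrightarrow> \<exists>!g. even_quotient S (m, n) p i f g"
    and fermat_odd: "f \<in> hom S (m, n) (srt p) \<Longrightarrow> j < n \<Longrightarrow> \<exists>!h. odd_quotient S (m, n) p j f h"

text \<open>The variable \<open>t\<close> is the last even one; \<open>eval S (Free S \<dots>) c \<dots>\<close> below is \<open>c\<close> as a constant in \<open>t\<close>.\<close>

definition admits_integration :: "('f, 'z) super_theory_scheme \<Rightarrow> bool" where
  "admits_integration S \<longleftrightarrow>
    (\<forall>m n p. \<forall>f \<in> hom S (Suc m, n) (srt p).
      (\<exists>F \<in> hom S (Suc m, n) (srt p). pdE S (Suc m, n) p m F = f) \<and>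
      (\<forall>F \<in> hom S (Suc m, n) (srt p). \<forall>G \<in> hom S (Suc m, n) (srt p).
        pdE S (Suc m, n) p m F = f \<and> pdE S (Suc m, n) p m G = f \<longrightarrow>
        (\<exists>c \<in> hom S (m, n) (srt p). ssub S (Free S (Suc m, n)) p F G =
          eval S (Free S (Suc m, n)) c (take m (evars S (Suc m, n))) (ovars S (Suc m, n)))))"

section \<open>Differential algebras\<close>

text \<open>
  \<open>d p\<close> is the component of the differential on elements of parity \<open>p\<close>. Scalars \<open>k\<close> may be odd;
  linearity of the odd map \<open>d\<close> is stated for scalars on the right, where no sign occurs.
\<close>

locale diff_algebra = S_algebra S A
  for S :: "('f, 'z) super_theory_scheme" and A :: "('f, 'a) alg" +
  fixes d :: "bool \<Rightarrow> 'a \<Rightarrow> 'a"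
  assumes d_parity: "a \<in> ob A (srt p) \<Longrightarrow> d p a \<in> ob A (srt (\<not> p))"
    and d_add: "a \<in> ob A (srt p) \<Longrightarrow> b \<in> ob A (srt p) \<Longrightarrow>
      d p (sadd S A p a b) = sadd S A (\<not> p) (d p a) (d p b)"
    and d_scalar: "a \<in> ob A (srt p) \<Longrightarrow> k \<in> hom S (0, 0) (srt q) \<Longrightarrow>
      d (psum p q) (smul S A p q a (eval S A k [] [])) = smul S A (\<not> p) q (d p a) (eval S A k [] [])"
    and d_d: "a \<in> ob A (srt p) \<Longrightarrow> d (\<not> p) (d p a) = szero S A p"
    and d_derivation: "set as \<subseteq> ob A (srt False) \<Longrightarrow> set bs \<subseteq> ob A (srt True) \<Longrightarrow>
      X = (length as, length bs) \<Longrightarrow> f \<in> hom S X (srt p) \<Longrightarrow>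
      d p (eval S A f as bs) =
        sadd S A (\<not> p)
          (ssum S A (\<not> p) (map (\<lambda>i. smul S A True p (d False (as ! i))
            (eval S A (pdE S X p i f) as bs)) [0..<length as]))
          (ssum S A (\<not> p) (map (\<lambda>j. smul S A False (\<not> p) (d True (bs ! j))
            (eval S A (pdO S X p j f) as bs)) [0..<length bs]))"

definition diff_hom ::
  "('f, 'z) super_theory_scheme \<Rightarrow> ('f, 'a) alg \<Rightarrow> (bool \<Rightarrow> 'a \<Rightarrow> 'a) \<Rightarrow>
    ('f, 'b) alg \<Rightarrow> (bool \<Rightarrow> 'b \<Rightarrow> 'b) \<Rightarrow> (obj \<Rightarrow> 'a \<Rightarrow> 'b) \<Rightarrow> bool" where
  "diff_hom S A dA B dB h \<longleftrightarrow> alg_hom S A B h \<and>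
    (\<forall>p. \<forall>a \<in> ob A (srt p). h (srt (\<not> p)) (dA p a) = dB p (h (srt p) a))"

text \<open>
  The coproduct of differential algebras is formed on the underlying algebras; its differential is
  the one, unique by the derivation rule, making the injections compatible with differentials. If
  \<open>C\<close> is free on \<open>t\<close> and \<open>dt\<close> with \<open>d(t) = dt\<close>, it is \<open>d\<^sub>A + dt \<partial>/\<partial>t\<close>.
\<close>

definition is_diff_coproduct ::
  "('f, 'z) super_theory_scheme \<Rightarrow> ('f, 'a) alg \<Rightarrow> (bool \<Rightarrow> 'a \<Rightarrow> 'a) \<Rightarrow>
    ('f, 'c) alg \<Rightarrow> (bool \<Rightarrow> 'c \<Rightarrow> 'c) \<Rightarrow> ('f, 'b) alg \<Rightarrow> (bool \<Rightarrow> 'b \<Rightarrow> 'b) \<Rightarrow>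
    (obj \<Rightarrow> 'a \<Rightarrow> 'b) \<Rightarrow> (obj \<Rightarrow> 'c \<Rightarrow> 'b) \<Rightarrow> bool" where
  "is_diff_coproduct S A dA C dC B dB j i \<longleftrightarrow>
    diff_algebra S B dB \<and> is_coproduct S A C B j i \<and>
    diff_hom S A dA B dB j \<and> diff_hom S C dC B dB i"

text \<open>The differential of \<open>\<Omega>\<^sub>1 = Free S (1, 1)\<close>, whose generators are \<open>t\<close> (even) and \<open>dt\<close> (odd).\<close>

definition is_Omega_diff :: "('f, 'z) super_theory_scheme \<Rightarrow> (bool \<Rightarrow> 'f \<Rightarrow> 'f) \<Rightarrow> bool" where
  "is_Omega_diff S d \<longleftrightarrow> diff_algebra S (Free S (1, 1)) d \<and>
    d False (prE S (1, 1) 0) = prO S (1, 1) 0 \<and>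
    d True (prO S (1, 1) 0) = szero S (Free S (1, 1)) False"

definition cycles ::
  "('f, 'z) super_theory_scheme \<Rightarrow> ('f, 'a) alg \<Rightarrow> (bool \<Rightarrow> 'a \<Rightarrow> 'a) \<Rightarrow> bool \<Rightarrow> 'a set" where
  "cycles S A d p = {z \<in> ob A (srt p). d p z = szero S A (\<not> p)}"

definition hclass ::
  "('f, 'z) super_theory_scheme \<Rightarrow> ('f, 'a) alg \<Rightarrow> (bool \<Rightarrow> 'a \<Rightarrow> 'a) \<Rightarrow> bool \<Rightarrow> 'a \<Rightarrow> 'a set" where
  "hclass S A d p z = (\<lambda>c. sadd S A p z (d (\<not> p) c)) ` ob A (srt (\<not> p))"

definition homology ::
  "('f, 'z) super_theory_scheme \<Rightarrow> ('f, 'a) alg \<Rightarrow> (bool \<Rightarrow> 'a \<Rightarrow> 'a) \<Rightarrow> bool \<Rightarrow> 'a set set" where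
  "homology S A d p = hclass S A d p ` cycles S A d p"

text \<open>The map induced on homology sends the class of \<open>z\<close> to the class of \<open>h(z)\<close>.\<close>

definition homology_map ::
  "('f, 'z) super_theory_scheme \<Rightarrow> ('f, 'b) alg \<Rightarrow> (bool \<Rightarrow> 'b \<Rightarrow> 'b) \<Rightarrow> (obj \<Rightarrow> 'a \<Rightarrow> 'b) \<Rightarrow>
    bool \<Rightarrow> 'a set \<Rightarrow> 'b set" where
  "homology_map S B dB h p K = (\<Union>z \<in> K. hclass S B dB p (h (srt p) z))"

definition homology_isomorphism ::
  "('f, 'z) super_theory_scheme \<Rightarrow> ('f, 'a) alg \<Rightarrow> (bool \<Rightarrow> 'a \<Rightarrow> 'a) \<Rightarrow>
    ('f, 'b) alg \<Rightarrow> (bool \<Rightarrow> 'b \<Rightarrow> 'b) \<Rightarrow> (obj \<Rightarrow> 'a \<Rightarrow> 'b) \<Rightarrow> bool" where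
  "homology_isomorphism S A dA B dB h \<longleftrightarrow> diff_hom S A dA B dB h \<and>
    (\<forall>p. bij_betw (homology_map S B dB h p) (homology S A dA p) (homology S B dB p))"

end

theory Submission
  imports Defs "HOL-Library.Product_Plus"
begin

text \<open>
  Write \<open>\<theta>\<close> for the generator \<open>dt\<close>, and \<open>B\<close> for \<open>A{t, \<theta>}\<close>. Every element of \<open>B\<close> is
  \<open>b\<^sub>0 + \<theta> b\<^sub>1\<close> with \<open>b\<^sub>0\<close> and \<open>b\<^sub>1\<close> in \<open>A{t}\<close> (lemma \<open>\<theta>_decomposition\<close>), and for \<open>u\<close> in \<open>A{t}\<close> the
  derivation rule gives \<open>d u = u' + \<theta> \<partial>u/\<partial>t\<close> with \<open>u'\<close> again in \<open>A{t}\<close> (lemma \<open>d_point\<close>).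

  Let \<open>b = b\<^sub>0 + \<theta> b\<^sub>1\<close> be a cycle. Integration yields \<open>c\<close> in \<open>A{t}\<close> with \<open>\<partial>c/\<partial>t = b\<^sub>1\<close>. Then
  \<open>d c = c' + \<theta> b\<^sub>1\<close>, so \<open>u = b - d c = b\<^sub>0 - c'\<close> lies in \<open>A{t}\<close>, and \<open>d u = 0\<close>. Comparing
  coefficients of \<open>\<theta>\<close> in \<open>0 = u' + \<theta> \<partial>u/\<partial>t\<close> gives \<open>\<partial>u/\<partial>t = 0\<close>; hence \<open>u\<close> comes from \<open>A\<close>, and \<open>b\<close> is
  homologous to the image of an element of \<open>A\<close>, which is a cycle as \<open>j\<close> is injective
  (lemma \<open>cycle_representative\<close>). So \<open>j\<close> is surjective on homology. It is injective on homology
  because evaluation at \<open>t = \<theta> = 0\<close> is a map of differential algebras that is left inverse to \<open>j\<close>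
  (lemma \<open>ev0_ex\<close>).

  Two steps of this argument concern identities that hold only in \<open>B\<close>, where an element has many
  expressions \<open>f(a, t, \<theta>)\<close>: that \<open>\<theta> y = \<theta> y'\<close> implies \<open>y = y'\<close> for \<open>y\<close>, \<open>y'\<close> in \<open>A{t}\<close>, and that
  \<open>\<partial>u/\<partial>t = 0\<close> implies that \<open>u\<close> is constant. For these, \<open>B\<close> is identified with the set of pairs
  \<open>(f, a)\<close> modulo the equivalence relation generated by \<open>(f \<circ> (\<phi> \<times> id), a) \<sim> (f, \<phi>(a))\<close>
  (lemmas \<open>to_coend\<close> and \<open>val_eqD\<close>). An operation on the arrows \<open>f\<close> that is natural with respect to
  substitution for the variables holding \<open>a\<close> therefore induces one on \<open>B\<close>. The odd difference
  quotient is natural because it is unique; it recovers \<open>y\<close> from \<open>\<theta> y\<close> (lemma \<open>\<theta>_cancel\<close>). The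
  integral \<open>F(x, t) - F(x, 0)\<close>, where \<open>\<partial>F/\<partial>t = f\<close>, depends only on \<open>f\<close> and is natural because
  primitives are unique up to constants; it recovers \<open>u - u(0)\<close> from \<open>\<partial>u/\<partial>t\<close>
  (lemma \<open>constant_if_deriv_zero\<close>).
\<close>

section \<open>Objects and tuples\<close>

definition cnt :: "bool \<Rightarrow> obj \<Rightarrow> nat" where
  "cnt p X = (if p then snd X else fst X)"

definition gen :: "('f, 'z) lawvere_scheme \<Rightarrow> bool \<Rightarrow> obj \<Rightarrow> nat \<Rightarrow> 'f" where
  "gen S p X i = (if p then prO S X i else prE S X i)"

lemma cnt_add [simp]: "cnt p (X + Y) = cnt p X + cnt p Y"
  by (simp add: cnt_def)

lemma cnt_0 [simp]: "cnt p 0 = 0"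
  by (simp add: cnt_def)

lemma cnt_srt [simp]: "cnt p (srt q) = (if p = q then 1 else 0)"
  by (simp add: cnt_def srt_def)

text \<open>
  Adding one sort at a time reduces statements about arbitrary finite products to statements about
  binary ones.
\<close>

lemma obj_induct [case_names zero add]:
  assumes "P 0" and "\<And>X p. P X \<Longrightarrow> P (X + srt p)"
  shows "P (X :: obj)"
proof -
  have "P (m, 0)" for m
  proof (induction m)
    case 0
    then show ?case using assms(1) by (simp add: zero_prod_def)
  next
    case (Suc m)
    have "(Suc m, 0) = (m, 0) + srt False"
      by (simp add: srt_def)
    then show ?case using assms(2) Suc by metis
  qed
  moreover have "P (m, Suc n)" if "P (m, n)" for m n
  proof -
    have "(m, Suc n) = (m, n) + srt True"
      by (simp add: srt_def)
    then show ?thesis using assms(2) that by metis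
  qed
  ultimately have "P (m, n)" for m n
    by (induction n) auto
  then show ?thesis
    by (cases X) simp
qed

definition comps ::
  "('f, 'z) lawvere_scheme \<Rightarrow> ('f, 'a) alg \<Rightarrow> bool \<Rightarrow> obj \<Rightarrow> 'a \<Rightarrow> 'a list" where
  "comps S A p X u = map (\<lambda>i. act A (gen S p X i) u) [0..<cnt p X]"

lemma length_comps [simp]: "length (comps S A p X u) = cnt p X"
  by (simp add: comps_def)

lemma nth_comps [simp]: "i < cnt p X \<Longrightarrow> comps S A p X u ! i = act A (gen S p X i) u"
  by (simp add: comps_def)

lemma is_tuple_iff:
  "is_tuple S A as bs u \<longleftrightarrow> (\<exists>X. X = (length as, length bs) \<and> u \<in> ob A X \<and>
     comps S A False X u = as \<and> comps S A True X u = bs)"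
  unfolding is_tuple_def by (auto simp: list_eq_iff_nth_eq comps_def cnt_def gen_def)

context lawvere_theory
begin

lemma arr_cmp [simp]:
  assumes "f \<in> arr S" "h \<in> arr S" "src S h = tgt S f"
  shows "cmp S h f \<in> arr S" "src S (cmp S h f) = src S f" "tgt S (cmp S h f) = tgt S h"
  using cmp[of f "src S f" "tgt S f" h "tgt S h"] assms by (auto simp: hom_def)

lemma arr_idt [simp]: "idt S X \<in> arr S" "src S (idt S X) = X" "tgt S (idt S X) = X"
  using idt[of X] by (auto simp: hom_def)

lemma cmp_idt_right [simp]: "f \<in> arr S \<Longrightarrow> src S f = X \<Longrightarrow> cmp S f (idt S X) = f"
  using cmp_idt[of f X "tgt S f"] by (auto simp: hom_def)

lemma cmp_idt_left [simp]: "f \<in> arr S \<Longrightarrow> tgt S f = X \<Longrightarrow> cmp S (idt S X) f = f"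
  using idt_cmp[of f "src S f" X] by (auto simp: hom_def)

lemma cmp_cmp [simp]:
  "f \<in> arr S \<Longrightarrow> k \<in> arr S \<Longrightarrow> h \<in> arr S \<Longrightarrow> src S k = tgt S f \<Longrightarrow> src S h = tgt S k \<Longrightarrow>
   cmp S (cmp S h k) f = cmp S h (cmp S k f)"
  using cmp_assoc[of f "src S f" "tgt S f" k "tgt S k" h "tgt S h"] by (auto simp: hom_def)

lemma arr_gen [simp]:
  assumes "i < cnt p X"
  shows "gen S p X i \<in> arr S" "src S (gen S p X i) = X" "tgt S (gen S p X i) = srt p"
  using assms prE[of i "fst X" "snd X"] prO[of i "snd X" "fst X"]
  by (auto simp: cnt_def gen_def srt_def hom_def split: if_splits)

lemma gen_srt [simp]: "gen S p (srt p) 0 = idt S (srt p)"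
  using prE_1 prO_1 by (simp add: gen_def srt_def)

lemma S_algebra_Free: "S_algebra S (Free S Q)"
proof
  show "act (Free S Q) f a \<in> ob (Free S Q) Y" if "f \<in> hom S X Y" "a \<in> ob (Free S Q) X" for f X Y a
    using that by (auto simp: Free_def hom_def)
  show "act (Free S Q) (idt S X) a = a" if "a \<in> ob (Free S Q) X" for X a
    using that by (auto simp: Free_def hom_def)
  show "act (Free S Q) (cmp S h f) a = act (Free S Q) h (act (Free S Q) f a)"
    if "f \<in> hom S X Y" "h \<in> hom S Y Z" "a \<in> ob (Free S Q) X" for f X Y h Z a
    using that by (auto simp: Free_def hom_def)
  show "\<exists>!u. is_tuple S (Free S Q) as bs u"
    if "set as \<subseteq> ob (Free S Q) (1, 0)" "set bs \<subseteq> ob (Free S Q) (0, 1)" for as bs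
    using product[of as Q bs] that by (simp add: is_tuple_def Free_def)
qed

end

lemma ob_Free [simp]: "ob (Free S Q) X = hom S Q X" and act_Free [simp]: "act (Free S Q) = cmp S"
  by (simp_all add: Free_def)

locale theory_algebra = lawvere_theory S + S_algebra S A
  for S :: "('f, 'z) lawvere_scheme" and A :: "('f, 'a) alg"
begin

lemma act_in_ob [simp]:
  "f \<in> arr S \<Longrightarrow> a \<in> ob A (src S f) \<Longrightarrow> tgt S f = Y \<Longrightarrow> act A f a \<in> ob A Y"
  using act[of f "src S f" Y a] by (auto simp: hom_def)

lemma act_idt_eq [simp]: "a \<in> ob A X \<Longrightarrow> act A (idt S X) a = a"
  by (rule act_idt)

lemma act_act [simp]:
  "f \<in> arr S \<Longrightarrow> h \<in> arr S \<Longrightarrow> src S h = tgt S f \<Longrightarrow> a \<in> ob A (src S f) \<Longrightarrow>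
   act A (cmp S h f) a = act A h (act A f a)"
  using act_cmp[of f "src S f" "tgt S f" h "tgt S h" a] by (auto simp: hom_def)

lemma comps_in_ob:
  assumes "u \<in> ob A X"
  shows "set (comps S A p X u) \<subseteq> ob A (srt p)"
  using assms by (auto simp: comps_def)

lemma is_tuple_comps: "u \<in> ob A X \<Longrightarrow> is_tuple S A (comps S A False X u) (comps S A True X u) u"
  by (auto simp: is_tuple_iff cnt_def)

lemma eval_comps:
  assumes "u \<in> ob A X"
  shows "eval S A f (comps S A False X u) (comps S A True X u) = act A f u"
proof -
  have "\<exists>!v. is_tuple S A (comps S A False X u) (comps S A True X u) v"
    using preserves_products comps_in_ob[OF assms, of False] comps_in_ob[OF assms, of True]
    by (simp add: srt_def)
  then have "(THE v. is_tuple S A (comps S A False X u) (comps S A True X u) v) = u"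
    using is_tuple_comps[OF assms] by (rule the1_equality)
  then show ?thesis
    by (simp add: eval_def)
qed

lemma tuple_eqI:
  assumes "u \<in> ob A X" "v \<in> ob A X"
    and "\<And>p i. i < cnt p X \<Longrightarrow> act A (gen S p X i) u = act A (gen S p X i) v"
  shows "u = v"
proof -
  have "comps S A p X u = comps S A p X v" for p
    using assms(3) by (simp add: comps_def)
  moreover have "\<exists>!w. is_tuple S A (comps S A False X u) (comps S A True X u) w"
    using preserves_products comps_in_ob[OF assms(1), of False] comps_in_ob[OF assms(1), of True]
    by (simp add: srt_def)
  ultimately show ?thesis
    using is_tuple_comps assms(1,2) by metis
qed

lemma tuple_ex:
  assumes "\<And>p i. i < cnt p X \<Longrightarrow> a p i \<in> ob A (srt p)"
  shows "\<exists>u \<in> ob A X. \<forall>p. \<forall>i < cnt p X. act A (gen S p X i) u = a p i"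
proof -
  let ?l = "\<lambda>p. map (a p) [0..<cnt p X]"
  have "set (?l p) \<subseteq> ob A (srt p)" for p
    using assms by auto
  from this[of False] this[of True] obtain u where "is_tuple S A (?l False) (?l True) u"
    using preserves_products[of "?l False" "?l True"] by (auto simp: srt_def)
  then have "u \<in> ob A X" and *: "comps S A p X u = ?l p" for p
    by (cases p; auto simp: is_tuple_iff cnt_def)+
  moreover have "act A (gen S p X i) u = a p i" if "i < cnt p X" for p i
    using arg_cong[OF *[of p], of "\<lambda>l. l ! i"] that by simp
  ultimately show ?thesis
    by blast
qed

end

section \<open>Binary products\<close>

context lawvere_theory
begin

lemma theory_algebra_Free: "theory_algebra S (Free S Q)"
  by (simp add: theory_algebra_def lawvere_theory_axioms S_algebra_Free)

text \<open>
  The objects \<open>(X + Y) + Z\<close> and \<open>X + (Y + Z)\<close> are equal, and with projections that list the generators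
  in order the two ways of projecting agree strictly.
\<close>

definition pr1 :: "obj \<Rightarrow> obj \<Rightarrow> 'f" where
  "pr1 X Y = (THE h. h \<in> hom S (X + Y) X \<and>
     (\<forall>p. \<forall>i < cnt p X. cmp S (gen S p X i) h = gen S p (X + Y) i))"

definition pr2 :: "obj \<Rightarrow> obj \<Rightarrow> 'f" where
  "pr2 X Y = (THE h. h \<in> hom S (X + Y) Y \<and>
     (\<forall>p. \<forall>i < cnt p Y. cmp S (gen S p Y i) h = gen S p (X + Y) (cnt p X + i)))"

lemma arrow_eqI:
  assumes "f \<in> arr S" "h \<in> arr S" "src S f = src S h" "tgt S f = X" "tgt S h = X"
    and "\<And>p i. i < cnt p X \<Longrightarrow> cmp S (gen S p X i) f = cmp S (gen S p X i) h"
  shows "f = h"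
  using theory_algebra.tuple_eqI[OF theory_algebra_Free, of f "src S f" X h] assms
  by (simp add: hom_def)

lemma pr1: "pr1 X Y \<in> hom S (X + Y) X \<and>
    (\<forall>p. \<forall>i < cnt p X. cmp S (gen S p X i) (pr1 X Y) = gen S p (X + Y) i)"
proof -
  obtain h where h: "h \<in> hom S (X + Y) X \<and>
      (\<forall>p. \<forall>i < cnt p X. cmp S (gen S p X i) h = gen S p (X + Y) i)"
    using theory_algebra.tuple_ex[OF theory_algebra_Free, of X "\<lambda>p i. gen S p (X + Y) i" "X + Y"]
    by (simp add: hom_def) blast
  show ?thesis unfolding pr1_def
    by (rule theI, rule h, rule arrow_eqI[where X = X]) (use h in \<open>auto simp: hom_def\<close>)
qed

lemma pr2: "pr2 X Y \<in> hom S (X + Y) Y \<and>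
    (\<forall>p. \<forall>i < cnt p Y. cmp S (gen S p Y i) (pr2 X Y) = gen S p (X + Y) (cnt p X + i))"
proof -
  obtain h where h: "h \<in> hom S (X + Y) Y \<and>
      (\<forall>p. \<forall>i < cnt p Y. cmp S (gen S p Y i) h = gen S p (X + Y) (cnt p X + i))"
    using theory_algebra.tuple_ex[OF theory_algebra_Free,
        of Y "\<lambda>p i. gen S p (X + Y) (cnt p X + i)" "X + Y"]
    by (simp add: hom_def) blast
  show ?thesis unfolding pr2_def
    by (rule theI, rule h, rule arrow_eqI[where X = Y]) (use h in \<open>auto simp: hom_def\<close>)
qed

lemma arr_pr [simp]:
  "pr1 X Y \<in> arr S" "src S (pr1 X Y) = X + Y" "tgt S (pr1 X Y) = X"
  "pr2 X Y \<in> arr S" "src S (pr2 X Y) = X + Y" "tgt S (pr2 X Y) = Y"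
  using pr1[of X Y] pr2[of X Y] by (auto simp: hom_def)

lemma gen_pr1: "i < cnt p X \<Longrightarrow> cmp S (gen S p X i) (pr1 X Y) = gen S p (X + Y) i"
  and gen_pr2: "i < cnt p Y \<Longrightarrow> cmp S (gen S p Y i) (pr2 X Y) = gen S p (X + Y) (cnt p X + i)"
  using pr1 pr2 by blast+

lemma pr2_srt: "pr2 X (srt p) = gen S p (X + srt p) (cnt p X)"
  using gen_pr2[of 0 p "srt p" X] by simp

lemma pr1_pr1: "cmp S (pr1 X Y) (pr1 (X + Y) Z) = pr1 X (Y + Z)"
  by (rule arrow_eqI[where X = X])
     (auto simp: add.assoc gen_pr1 simp flip: cmp_cmp)

lemma pr2_pr1: "cmp S (pr2 X Y) (pr1 (X + Y) Z) = cmp S (pr1 Y Z) (pr2 X (Y + Z))"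
  by (rule arrow_eqI[where X = Y])
     (auto simp: add.assoc gen_pr1 gen_pr2 simp flip: cmp_cmp)

lemma pr2_pr2: "cmp S (pr2 Y Z) (pr2 X (Y + Z)) = pr2 (X + Y) Z"
  by (rule arrow_eqI[where X = Z])
     (auto simp: add.assoc gen_pr1 gen_pr2 simp flip: cmp_cmp)

definition pair :: "('f, 'a) alg \<Rightarrow> obj \<Rightarrow> obj \<Rightarrow> 'a \<Rightarrow> 'a \<Rightarrow> 'a" where
  "pair A X Y u v =
    (THE w. w \<in> ob A (X + Y) \<and> act A (pr1 X Y) w = u \<and> act A (pr2 X Y) w = v)"

definition fork :: "'f \<Rightarrow> 'f \<Rightarrow> 'f" where
  "fork f h = pair (Free S (src S f)) (tgt S f) (tgt S h) f h"

end

context theory_algebra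
begin

lemma pair_eqI:
  assumes "w \<in> ob A (X + Y)" "w' \<in> ob A (X + Y)"
    "act A (pr1 X Y) w = act A (pr1 X Y) w'" "act A (pr2 X Y) w = act A (pr2 X Y) w'"
  shows "w = w'"
proof (rule tuple_eqI[OF assms(1,2)])
  fix p i assume i: "i < cnt p (X + Y)"
  show "act A (gen S p (X + Y) i) w = act A (gen S p (X + Y) i) w'"
  proof (cases "i < cnt p X")
    case True
    then show ?thesis
      using assms by (simp flip: gen_pr1)
  next
    case False
    then have "gen S p (X + Y) i = cmp S (gen S p Y (i - cnt p X)) (pr2 X Y)"
      using i by (subst gen_pr2) auto
    then show ?thesis
      using assms i False by simp
  qed
qed

lemma pair:
  assumes "u \<in> ob A X" "v \<in> ob A Y"
  shows "pair A X Y u v \<in> ob A (X + Y) \<and> act A (pr1 X Y) (pair A X Y u v) = u \<and>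
    act A (pr2 X Y) (pair A X Y u v) = v"
proof -
  have "\<exists>w \<in> ob A (X + Y). \<forall>p. \<forall>i < cnt p (X + Y). act A (gen S p (X + Y) i) w =
      (if i < cnt p X then act A (gen S p X i) u else act A (gen S p Y (i - cnt p X)) v)"
    by (rule tuple_ex) (use assms in auto)
  then obtain w where w: "w \<in> ob A (X + Y)" "\<And>p i. i < cnt p (X + Y) \<Longrightarrow>
      act A (gen S p (X + Y) i) w =
      (if i < cnt p X then act A (gen S p X i) u else act A (gen S p Y (i - cnt p X)) v)"
    by blast
  have "act A (pr1 X Y) w = u"
    by (rule tuple_eqI[where X = X]) (use w assms in \<open>auto simp: gen_pr1 simp flip: act_act\<close>)
  moreover have "act A (pr2 X Y) w = v"
    by (rule tuple_eqI[where X = Y]) (use w assms in \<open>auto simp: gen_pr2 simp flip: act_act\<close>)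
  ultimately have w': "w \<in> ob A (X + Y) \<and> act A (pr1 X Y) w = u \<and> act A (pr2 X Y) w = v"
    using w(1) by simp
  show ?thesis unfolding pair_def
    by (rule theI, rule w') (use w' pair_eqI[of _ X Y w] in auto)
qed

lemma pair_in_ob [simp]: "u \<in> ob A X \<Longrightarrow> v \<in> ob A Y \<Longrightarrow> Z = X + Y \<Longrightarrow> pair A X Y u v \<in> ob A Z"
  and pr1_pair [simp]: "u \<in> ob A X \<Longrightarrow> v \<in> ob A Y \<Longrightarrow> act A (pr1 X Y) (pair A X Y u v) = u"
  and pr2_pair [simp]: "u \<in> ob A X \<Longrightarrow> v \<in> ob A Y \<Longrightarrow> act A (pr2 X Y) (pair A X Y u v) = v"
  using pair by blast+

lemma pair_pr: "w \<in> ob A (X + Y) \<Longrightarrow> pair A X Y (act A (pr1 X Y) w) (act A (pr2 X Y) w) = w"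
  by (rule pair_eqI[where X = X and Y = Y]) auto

lemma pair_assoc:
  assumes "u \<in> ob A X" "v \<in> ob A Y" "w \<in> ob A Z"
  shows "pair A (X + Y) Z (pair A X Y u v) w = pair A X (Y + Z) u (pair A Y Z v w)" (is "?l = ?r")
proof (rule pair_eqI[where X = X and Y = "Y + Z"])
  have l: "?l \<in> ob A (X + Y + Z)" using assms by simp
  show "?l \<in> ob A (X + (Y + Z))" "?r \<in> ob A (X + (Y + Z))"
    using assms by (auto simp: add.assoc)
  show "act A (pr1 X (Y + Z)) ?l = act A (pr1 X (Y + Z)) ?r"
  proof -
    have "act A (cmp S (pr1 X Y) (pr1 (X + Y) Z)) ?l = u"
      using assms l by simp
    then show ?thesis
      using assms l by (simp add: pr1_pr1 del: act_act)
  qed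
  show "act A (pr2 X (Y + Z)) ?l = act A (pr2 X (Y + Z)) ?r"
  proof (rule pair_eqI[where X = Y and Y = Z])
    have "act A (cmp S (pr1 Y Z) (pr2 X (Y + Z))) ?l = v"
      using assms l by (subst pr2_pr1[symmetric]) simp
    then show "act A (pr1 Y Z) (act A (pr2 X (Y + Z)) ?l) = act A (pr1 Y Z) (act A (pr2 X (Y + Z)) ?r)"
      using assms l by (simp add: add.assoc)
    have "act A (cmp S (pr2 Y Z) (pr2 X (Y + Z))) ?l = w"
      using assms l by (simp add: pr2_pr2 del: act_act)
    then show "act A (pr2 Y Z) (act A (pr2 X (Y + Z)) ?l) = act A (pr2 Y Z) (act A (pr2 X (Y + Z)) ?r)"
      using assms l by (simp add: add.assoc)
  qed (use assms l in \<open>auto simp: add.assoc\<close>)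
qed

end

context lawvere_theory
begin

lemma arr_fork [simp]:
  assumes "f \<in> arr S" "h \<in> arr S" "src S f = src S h"
  shows "fork f h \<in> arr S" "src S (fork f h) = src S f" "tgt S (fork f h) = tgt S f + tgt S h"
  using theory_algebra.pair[OF theory_algebra_Free, of f "src S f" "tgt S f" h "tgt S h"] assms
  by (auto simp: fork_def hom_def)

lemma pr_fork [simp]:
  assumes "f \<in> arr S" "h \<in> arr S" "src S f = src S h" "tgt S f = X" "tgt S h = Y"
  shows "cmp S (pr1 X Y) (fork f h) = f" "cmp S (pr2 X Y) (fork f h) = h"
  using theory_algebra.pair[OF theory_algebra_Free, of f "src S f" "tgt S f" h "tgt S h"] assms
  by (auto simp: fork_def hom_def)

lemma fork_eqI:
  assumes "f \<in> arr S" "h \<in> arr S" "src S f = src S h" "tgt S f = X + Y" "tgt S h = X + Y"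
    "cmp S (pr1 X Y) f = cmp S (pr1 X Y) h" "cmp S (pr2 X Y) f = cmp S (pr2 X Y) h"
  shows "f = h"
  using theory_algebra.pair_eqI[OF theory_algebra_Free, of f "src S f" X Y h] assms
  by (simp add: hom_def)

lemma pair_Free [simp]:
  "f \<in> hom S Q X \<Longrightarrow> h \<in> hom S Q Y \<Longrightarrow> pair (Free S Q) X Y f h = fork f h"
  by (auto simp: fork_def hom_def)

lemma fork_cmp [simp]:
  assumes "f \<in> arr S" "h \<in> arr S" "src S f = src S h" "k \<in> arr S" "tgt S k = src S f"
  shows "cmp S (fork f h) k = fork (cmp S f k) (cmp S h k)"
  by (rule fork_eqI[where X = "tgt S f" and Y = "tgt S h"])
     (use assms in \<open>auto simp flip: cmp_cmp\<close>)

lemma fork_pr [simp]: "fork (pr1 X Y) (pr2 X Y) = idt S (X + Y)"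
  by (rule fork_eqI[where X = X and Y = Y]) auto

end

context theory_algebra
begin

lemma act_fork [simp]:
  assumes "f \<in> arr S" "h \<in> arr S" "src S f = src S h" "u \<in> ob A (src S f)"
  shows "act A (fork f h) u = pair A (tgt S f) (tgt S h) (act A f u) (act A h u)"
  by (rule pair_eqI[where X = "tgt S f" and Y = "tgt S h"])
     (use assms in \<open>auto simp flip: act_act\<close>)

end

section \<open>Maps of algebras and recognition of algebras\<close>

(* Objects are pairs of numbers, but quantifiers over objects must not be split into their parts. *)
declare split_paired_All [simp del] split_paired_Ex [simp del]

lemma alg_homD:
  assumes "alg_hom S A B h"
  shows "a \<in> ob A X \<Longrightarrow> h X a \<in> ob B X"
    and "f \<in> hom S X Y \<Longrightarrow> a \<in> ob A X \<Longrightarrow> h Y (act A f a) = act B f (h X a)"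
  using assms unfolding alg_hom_def by blast+

lemma alg_hom_comp:
  "alg_hom S A B h \<Longrightarrow> alg_hom S B C k \<Longrightarrow> alg_hom S A C (\<lambda>X a. k X (h X a))"
  unfolding alg_hom_def by simp

text \<open>
  A copy of \<open>A\<close> in another type. It brings algebras into the type in which coproducts are tested.
\<close>

definition alg_image :: "('a \<Rightarrow> 'b) \<Rightarrow> ('f, 'a) alg \<Rightarrow> ('f, 'b) alg" where
  "alg_image \<iota> A = \<lparr>ob = \<lambda>X. \<iota> ` ob A X, act = \<lambda>f x. \<iota> (act A f (inv \<iota> x))\<rparr>"

context lawvere_theory
begin

text \<open>
  A functor preserves finite products if it preserves the terminal object and binary products: a
  tuple of type \<open>X + srt p\<close> is a pair of a tuple of type \<open>X\<close> and one more element.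
\<close>

lemma S_algebraI:
  assumes act: "\<And>f x. f \<in> arr S \<Longrightarrow> x \<in> ob D (src S f) \<Longrightarrow> act D f x \<in> ob D (tgt S f)"
    and idt: "\<And>X x. x \<in> ob D X \<Longrightarrow> act D (idt S X) x = x"
    and cmp: "\<And>f h x. f \<in> arr S \<Longrightarrow> h \<in> arr S \<Longrightarrow> src S h = tgt S f \<Longrightarrow> x \<in> ob D (src S f) \<Longrightarrow>
      act D (cmp S h f) x = act D h (act D f x)"
    and zero: "\<exists>!x. x \<in> ob D 0"
    and ex: "\<And>X Y x y. x \<in> ob D X \<Longrightarrow> y \<in> ob D Y \<Longrightarrow>
      \<exists>w \<in> ob D (X + Y). act D (pr1 X Y) w = x \<and> act D (pr2 X Y) w = y"
    and uniq: "\<And>X Y w w'. w \<in> ob D (X + Y) \<Longrightarrow> w' \<in> ob D (X + Y) \<Longrightarrow>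
      act D (pr1 X Y) w = act D (pr1 X Y) w' \<Longrightarrow> act D (pr2 X Y) w = act D (pr2 X Y) w' \<Longrightarrow> w = w'"
  shows "S_algebra S D"
proof
  show "act D f x \<in> ob D Y" if "f \<in> hom S X Y" "x \<in> ob D X" for f X Y x
    using act[of f x] that by (auto simp: hom_def)
  show "act D (idt S X) x = x" if "x \<in> ob D X" for x X
    using idt that .
  show "act D (cmp S h f) x = act D h (act D f x)"
    if "f \<in> hom S X Y" "h \<in> hom S Y Z" "x \<in> ob D X" for f X Y h Z x
    using cmp[of f h x] that by (auto simp: hom_def)
  have gens1: "act D (gen S q (X + Y) i) w = act D (gen S q X i) (act D (pr1 X Y) w)"
    if "w \<in> ob D (X + Y)" "i < cnt q X" for X Y w q i
    using cmp[of "pr1 X Y" "gen S q X i" w] that by (simp add: gen_pr1)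
  have gens2: "act D (gen S p (X + srt p) (cnt p X)) w = act D (pr2 X (srt p)) w" for X p w
    by (simp add: pr2_srt)
  have inj: "u = v" if "u \<in> ob D Z" "v \<in> ob D Z"
    "\<And>p i. i < cnt p Z \<Longrightarrow> act D (gen S p Z i) u = act D (gen S p Z i) v" for Z u v
    using that
  proof (induction Z arbitrary: u v rule: obj_induct)
    case zero
    then show ?case using assms(4) by blast
  next
    case (add X p)
    show ?case
    proof (rule uniq[OF add.prems(1,2)])
      show "act D (pr1 X (srt p)) u = act D (pr1 X (srt p)) v"
      proof (rule add.IH)
        fix q i assume i: "i < cnt q X"
        then show "act D (gen S q X i) (act D (pr1 X (srt p)) u) =
            act D (gen S q X i) (act D (pr1 X (srt p)) v)"
          using add.prems(3)[of i q] gens1[OF add.prems(1) i] gens1[OF add.prems(2) i] by simp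
      qed (use act[of "pr1 X (srt p)"] add.prems in auto)
      show "act D (pr2 X (srt p)) u = act D (pr2 X (srt p)) v"
        using add.prems(3)[of "cnt p X" p] by (simp add: gens2)
    qed
  qed
  have tup: "\<exists>u \<in> ob D Z. \<forall>p. \<forall>i < cnt p Z. act D (gen S p Z i) u = a p i"
    if "\<And>p i. i < cnt p Z \<Longrightarrow> a p i \<in> ob D (srt p)" for Z a
    using that
  proof (induction Z rule: obj_induct)
    case zero
    then show ?case using assms(4) by auto
  next
    case (add X p)
    obtain u where u: "u \<in> ob D X" "\<And>q i. i < cnt q X \<Longrightarrow> act D (gen S q X i) u = a q i"
      using add.IH add.prems by auto
    obtain w where w: "w \<in> ob D (X + srt p)" "act D (pr1 X (srt p)) w = u"
        "act D (pr2 X (srt p)) w = a p (cnt p X)"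
      using ex[OF u(1) add.prems[of "cnt p X" p]] by auto
    have "act D (gen S q (X + srt p) i) w = a q i" if i: "i < cnt q (X + srt p)" for q i
    proof (cases "i < cnt q X")
      case True
      then show ?thesis using gens1[OF w(1) True] w(2) u(2) by simp
    next
      case False
      then have "q = p" "i = cnt p X"
        using i by (auto split: if_splits)
      then show ?thesis using gens2 w(3) by simp
    qed
    then show ?case using w(1) by blast
  qed
  fix as bs
  assume as: "set as \<subseteq> ob D (1, 0)" and bs: "set bs \<subseteq> ob D (0, 1)"
  let ?Z = "(length as, length bs)"
  have "(if p then bs ! i else as ! i) \<in> ob D (srt p)" if "i < cnt p ?Z" for p i
    using that as bs nth_mem by (fastforce simp: cnt_def srt_def split: if_splits)
  from tup[of ?Z "\<lambda>p i. if p then bs ! i else as ! i", OF this]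
  obtain u where u: "u \<in> ob D ?Z"
      "\<forall>p. \<forall>i < cnt p ?Z. act D (gen S p ?Z i) u = (if p then bs ! i else as ! i)"
    by blast
  show "\<exists>!u. is_tuple S D as bs u"
  proof
    show "is_tuple S D as bs u"
      using u(1) u(2)[rule_format, of _ False] u(2)[rule_format, of _ True]
      by (auto simp: is_tuple_def cnt_def gen_def)
    fix v assume v: "is_tuple S D as bs v"
    show "v = u"
    proof (rule inj)
      show "v \<in> ob D ?Z" "u \<in> ob D ?Z"
        using v u(1) by (auto simp: is_tuple_def)
      show "act D (gen S p ?Z i) v = act D (gen S p ?Z i) u" if "i < cnt p ?Z" for p i
        using v u(2)[rule_format, OF that] that
        by (cases p) (auto simp: is_tuple_def gen_def cnt_def)
    qed
  qed
qed

text \<open>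
  The arrow \<open>\<phi> \<times> id\<^sub>W\<close>.
\<close>

definition base_change :: "obj \<Rightarrow> 'f \<Rightarrow> 'f" where
  "base_change W \<phi> = fork (cmp S \<phi> (pr1 (src S \<phi>) W)) (pr2 (src S \<phi>) W)"

lemma arr_base_change [simp]:
  assumes "\<phi> \<in> arr S"
  shows "base_change W \<phi> \<in> arr S" "src S (base_change W \<phi>) = src S \<phi> + W"
    "tgt S (base_change W \<phi>) = tgt S \<phi> + W"
  using assms by (simp_all add: base_change_def)

lemma pr_base_change [simp]:
  assumes "\<phi> \<in> arr S" "tgt S \<phi> = Y"
  shows "cmp S (pr1 Y W) (base_change W \<phi>) = cmp S \<phi> (pr1 (src S \<phi>) W)"
    "cmp S (pr2 Y W) (base_change W \<phi>) = pr2 (src S \<phi>) W"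
  using assms by (simp_all add: base_change_def)

lemma base_change_base_change:
  assumes "\<phi> \<in> arr S" "\<psi> \<in> arr S" "src S \<psi> = tgt S \<phi>"
  shows "cmp S (base_change W \<psi>) (base_change W \<phi>) = base_change W (cmp S \<psi> \<phi>)"
  using assms by (simp add: base_change_def)

lemma base_change_idt [simp]: "base_change W (idt S X) = idt S (X + W)"
  by (simp add: base_change_def)

lemma terminal_ex: "\<exists>t. t \<in> arr S \<and> src S t = X \<and> tgt S t = 0"
  using theory_algebra.tuple_ex[OF theory_algebra_Free, of 0 undefined X]
  by (auto simp: hom_def)

lemma terminal_eq: "f \<in> arr S \<Longrightarrow> h \<in> arr S \<Longrightarrow> src S f = src S h \<Longrightarrow> tgt S f = 0 \<Longrightarrow> tgt S h = 0 \<Longrightarrow> f = h"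
  by (rule arrow_eqI[where X = 0]) auto

end

lemma (in theory_algebra) ob_0: "\<exists>!x. x \<in> ob A 0"
proof -
  obtain x where "x \<in> ob A 0"
    using tuple_ex[of 0 undefined] by auto
  then show ?thesis
    using tuple_eqI[of _ 0] by (metis cnt_0 less_nat_zero_code)
qed

lemma (in theory_algebra) act_base_change [simp]:
  assumes "\<phi> \<in> arr S" "src S \<phi> = X" "a \<in> ob A X" "w \<in> ob A W"
  shows "act A (base_change W \<phi>) (pair A X W a w) = pair A (tgt S \<phi>) W (act A \<phi> a) w"
  using assms by (auto simp: base_change_def)

lemma (in theory_algebra) S_algebra_alg_image:
  assumes "inj \<iota>"
  shows "S_algebra S (alg_image \<iota> A)"
proof (rule S_algebraI)
  show "\<exists>!x. x \<in> ob (alg_image \<iota> A) 0"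
    using ob_0 by (auto simp: alg_image_def)
  show "\<exists>w \<in> ob (alg_image \<iota> A) (X + Y). act (alg_image \<iota> A) (pr1 X Y) w = x \<and>
      act (alg_image \<iota> A) (pr2 X Y) w = y"
    if "x \<in> ob (alg_image \<iota> A) X" "y \<in> ob (alg_image \<iota> A) Y" for X Y x y
  proof -
    obtain u v where "u \<in> ob A X" "v \<in> ob A Y" "x = \<iota> u" "y = \<iota> v"
      using \<open>x \<in> _\<close> \<open>y \<in> _\<close> by (auto simp: alg_image_def)
    then show ?thesis
      using assms by (intro bexI[where x = "\<iota> (pair A X Y u v)"]) (auto simp: alg_image_def)
  qed
  show "w = w'" if "w \<in> ob (alg_image \<iota> A) (X + Y)" "w' \<in> ob (alg_image \<iota> A) (X + Y)"
    "act (alg_image \<iota> A) (pr1 X Y) w = act (alg_image \<iota> A) (pr1 X Y) w'"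
    "act (alg_image \<iota> A) (pr2 X Y) w = act (alg_image \<iota> A) (pr2 X Y) w'" for X Y w w'
  proof -
    obtain u u' where u: "u \<in> ob A (X + Y)" "w = \<iota> u" "u' \<in> ob A (X + Y)" "w' = \<iota> u'"
      using \<open>w \<in> _\<close> \<open>w' \<in> _\<close> unfolding alg_image_def by auto
    then have "u = u'"
      using that(3,4) assms by (intro pair_eqI[of u X Y u']) (simp_all add: alg_image_def inj_eq)
    then show ?thesis using u by simp
  qed
qed (use assms in \<open>auto simp: alg_image_def\<close>)

lemma alg_hom_alg_image: "inj \<iota> \<Longrightarrow> alg_hom S A (alg_image \<iota> A) (\<lambda>X. \<iota>)"
  by (auto simp: alg_hom_def alg_image_def)

section \<open>The coproduct with a free algebra as a coend\<close>

text \<open>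
  The pair of \<open>f\<close> and \<open>a\<close> stands for the formal value \<open>f(a, w)\<close>, where \<open>w\<close> is the tuple of adjoined
  generators, of type \<open>W\<close>. Two pairs are identified if an arrow can be moved from \<open>f\<close> to \<open>a\<close>; this is
  the equivalence relation whose quotient is the coend of \<open>S(X + W, Z) \<times> A(X)\<close> over \<open>X\<close>.
\<close>

inductive (in lawvere_theory) zigzag ::
  "('f, 'a) alg \<Rightarrow> obj \<Rightarrow> obj \<Rightarrow> obj \<Rightarrow> 'f \<Rightarrow> 'a \<Rightarrow> obj \<Rightarrow> 'f \<Rightarrow> 'a \<Rightarrow> bool" for A W Z where
  zigzag_step: "\<phi> \<in> hom S X Y \<Longrightarrow> a \<in> ob A X \<Longrightarrow> f \<in> hom S (Y + W) Z \<Longrightarrow>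
    zigzag A W Z X (cmp S f (base_change W \<phi>)) a Y f (act A \<phi> a)"
| zigzag_refl: "a \<in> ob A X \<Longrightarrow> f \<in> hom S (X + W) Z \<Longrightarrow> zigzag A W Z X f a X f a"
| zigzag_sym: "zigzag A W Z X f a Y h b \<Longrightarrow> zigzag A W Z Y h b X f a"
| zigzag_trans: "zigzag A W Z X f a Y h b \<Longrightarrow> zigzag A W Z Y h b U k c \<Longrightarrow> zigzag A W Z X f a U k c"

context theory_algebra
begin

text \<open>
  Through this principle, operations on arrows that are natural in the argument \<open>a\<close> become
  operations on formal values.
\<close>

lemma zigzag_invariant:
  assumes "zigzag A W Z X f a Y h b"
    and "\<And>\<phi> X Y a f. \<phi> \<in> hom S X Y \<Longrightarrow> a \<in> ob A X \<Longrightarrow> f \<in> hom S (Y + W) Z \<Longrightarrow>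
      \<Psi> X (cmp S f (base_change W \<phi>)) a = \<Psi> Y f (act A \<phi> a)"
  shows "\<Psi> X f a = \<Psi> Y h b"
  using assms(1)
proof induction
  case (zigzag_step \<phi> X Y a f)
  then show ?case by (rule assms(2))
qed simp_all

lemma zigzag_typed:
  assumes "zigzag A W Z X f a Y h b"
  shows "f \<in> hom S (X + W) Z \<and> a \<in> ob A X \<and> h \<in> hom S (Y + W) Z \<and> b \<in> ob A Y"
  using assms by induction (simp_all add: hom_def)

text \<open>
  The last component of a triple is a dummy: with it the classes have the type that serves as left
  summand of the type in which coproducts are tested.
\<close>

definition zclass :: "obj \<Rightarrow> obj \<Rightarrow> obj \<Rightarrow> 'f \<Rightarrow> 'a \<Rightarrow> ('f \<times> 'a \<times> 'f) set" where
  "zclass W Z X f a = {(h, b, c). \<exists>Y. zigzag A W Z X f a Y h b}"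

lemma zclass_eqI:
  assumes "zigzag A W Z X f a Y h b"
  shows "zclass W Z X f a = zclass W Z Y h b"
proof -
  have "zigzag A W Z X f a U k c \<longleftrightarrow> zigzag A W Z Y h b U k c" for U k c
    using zigzag_trans[OF assms] zigzag_trans[OF zigzag_sym[OF assms]] by (rule iffI[rotated])
  then show ?thesis
    unfolding zclass_def by simp
qed

lemma zclass_eqD:
  assumes "zclass W Z X f a = zclass W Z Y h b" "h \<in> hom S (Y + W) Z" "b \<in> ob A Y"
  shows "zigzag A W Z X f a Y h b"
proof -
  have "(h, b, h) \<in> zclass W Z Y h b"
    using zigzag_refl[OF assms(3,2)] unfolding zclass_def by blast
  then have "(h, b, h) \<in> zclass W Z X f a"
    using assms(1) by simp
  then obtain U where U: "zigzag A W Z X f a U h b"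
    unfolding zclass_def by blast
  from zigzag_typed[OF this] have "h \<in> hom S (U + W) Z"
    by simp
  then have "U + W = Y + W"
    using assms(2) by (simp add: hom_def)
  then have "U = Y"
    by (auto intro!: prod_eqI dest: arg_cong[of _ _ fst] arg_cong[of _ _ snd])
  then show ?thesis using U by simp
qed

lemma zclass_step:
  "\<phi> \<in> arr S \<Longrightarrow> f \<in> arr S \<Longrightarrow> a \<in> ob A (src S \<phi>) \<Longrightarrow> src S \<phi> = X \<Longrightarrow> tgt S \<phi> = Y \<Longrightarrow>
   src S f = Y + W \<Longrightarrow> tgt S f = Z \<Longrightarrow>
   zclass W Z X (cmp S f (base_change W \<phi>)) a = zclass W Z Y f (act A \<phi> a)"
  by (rule zclass_eqI, rule zigzag_step) (simp_all add: hom_def)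

text \<open>
  Arrows act on representatives, by composition; lemma \<open>act_coend\<close> below shows that the choice of a
  representative is immaterial.
\<close>

definition coend :: "obj \<Rightarrow> ('f, ('f \<times> 'a \<times> 'f) set) alg" where
  "coend W = \<lparr>ob = \<lambda>Z. {zclass W Z X f a | X f a. f \<in> hom S (X + W) Z \<and> a \<in> ob A X},
     act = \<lambda>k x. SOME y. \<exists>X f a. f \<in> hom S (X + W) (src S k) \<and> a \<in> ob A X \<and>
       x = zclass W (src S k) X f a \<and> y = zclass W (tgt S k) X (cmp S k f) a\<rparr>"

lemma act_coend:
  assumes "k \<in> arr S" "f \<in> hom S (X + W) (src S k)" "a \<in> ob A X"
  shows "act (coend W) k (zclass W (src S k) X f a) = zclass W (tgt S k) X (cmp S k f) a"
proof -
  have "y = zclass W (tgt S k) X (cmp S k f) a"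
    if eq: "zclass W (src S k) X f a = zclass W (src S k) X' f' a'"
      and f': "f' \<in> hom S (X' + W) (src S k)" and a': "a' \<in> ob A X'"
      and y: "y = zclass W (tgt S k) X' (cmp S k f') a'" for y X' f' a'
  proof -
    have "zigzag A W (src S k) X f a X' f' a'"
      using zclass_eqD[OF eq f' a'] .
    then have "zclass W (tgt S k) X (cmp S k f) a = zclass W (tgt S k) X' (cmp S k f') a'"
    proof (rule zigzag_invariant)
      fix \<phi> X Y a f
      assume "\<phi> \<in> hom S X Y" "a \<in> ob A X" "f \<in> hom S (Y + W) (src S k)"
      then show "zclass W (tgt S k) X (cmp S k (cmp S f (base_change W \<phi>))) a =
          zclass W (tgt S k) Y (cmp S k f) (act A \<phi> a)"
        using zclass_step[of \<phi> "cmp S k f" a X Y W "tgt S k"] assms(1) by (simp add: hom_def)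
    qed
    then show ?thesis using y by simp
  qed
  then show ?thesis
    unfolding coend_def alg.simps using assms(2,3) by (intro some_equality) blast+
qed

lemma act_coend_class [simp]:
  assumes "k \<in> arr S" "f \<in> arr S" "src S f = X + W" "tgt S f = Z" "src S k = Z" "a \<in> ob A X"
  shows "act (coend W) k (zclass W Z X f a) = zclass W (tgt S k) X (cmp S k f) a"
  using act_coend[of k f X W a] assms by (simp add: hom_def)

lemma in_coend [simp]:
  "f \<in> arr S \<Longrightarrow> src S f = X + W \<Longrightarrow> tgt S f = Z \<Longrightarrow> a \<in> ob A X \<Longrightarrow> zclass W Z X f a \<in> ob (coend W) Z"
  unfolding coend_def alg.simps hom_def by blast

lemma coendE:
  assumes "x \<in> ob (coend W) Z"
  obtains X f a where "f \<in> arr S" "src S f = X + W" "tgt S f = Z" "a \<in> ob A X" "x = zclass W Z X f a"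
  using assms unfolding coend_def alg.simps hom_def by blast

text \<open>
  The arrow \<open>(f(x, w), h(y, w))\<close> in the variables \<open>x, y, w\<close>: the arguments are separate, the adjoined
  generators are shared.
\<close>

definition comb :: "obj \<Rightarrow> obj \<Rightarrow> 'f \<Rightarrow> obj \<Rightarrow> 'f \<Rightarrow> 'f" where
  "comb W X f Y h =
    fork (cmp S f (base_change W (pr1 X Y))) (cmp S h (base_change W (pr2 X Y)))"

lemma arr_comb [simp]:
  assumes "f \<in> arr S" "src S f = X + W" "h \<in> arr S" "src S h = Y + W"
  shows "comb W X f Y h \<in> arr S" "src S (comb W X f Y h) = X + Y + W"
    "tgt S (comb W X f Y h) = tgt S f + tgt S h"
  using assms by (simp_all add: comb_def)

lemma comb_base_change:
  assumes "f \<in> arr S" "src S f = X' + W" "h \<in> arr S" "src S h = Y' + W"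
    "\<phi> \<in> arr S" "src S \<phi> = X" "tgt S \<phi> = X'" "\<psi> \<in> arr S" "src S \<psi> = Y" "tgt S \<psi> = Y'"
  shows "comb W X (cmp S f (base_change W \<phi>)) Y (cmp S h (base_change W \<psi>)) =
    cmp S (comb W X' f Y' h) (base_change W (fork (cmp S \<phi> (pr1 X Y)) (cmp S \<psi> (pr2 X Y))))"
  using assms by (simp add: comb_def base_change_base_change)

lemma zclass_comb:
  assumes "f \<in> arr S" "src S f = X' + W" "h \<in> arr S" "src S h = Y' + W"
    "\<phi> \<in> arr S" "src S \<phi> = X" "tgt S \<phi> = X'" "\<psi> \<in> arr S" "src S \<psi> = Y" "tgt S \<psi> = Y'"
    "a \<in> ob A X" "b \<in> ob A Y" "Z = tgt S f + tgt S h"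
  shows "zclass W Z (X + Y) (comb W X (cmp S f (base_change W \<phi>)) Y (cmp S h (base_change W \<psi>)))
      (pair A X Y a b) =
    zclass W Z (X' + Y') (comb W X' f Y' h) (pair A X' Y' (act A \<phi> a) (act A \<psi> b))"
  using assms by (simp add: comb_base_change zclass_step)

text \<open>
  Duplicating the argument along the diagonal allows the two components of \<open>f\<close> to be changed
  independently.
\<close>

lemma zclass_diag:
  assumes "f \<in> arr S" "src S f = X + W" "tgt S f = Z + Z'" "a \<in> ob A X"
  shows "zclass W (Z + Z') X f a =
    zclass W (Z + Z') (X + X) (comb W X (cmp S (pr1 Z Z') f) X (cmp S (pr2 Z Z') f)) (pair A X X a a)"
proof -
  have "cmp S (comb W X (cmp S (pr1 Z Z') f) X (cmp S (pr2 Z Z') f))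
      (base_change W (fork (idt S X) (idt S X))) = f"
    by (rule fork_eqI[where X = Z and Y = Z']) (use assms in \<open>auto simp: comb_def base_change_base_change\<close>)
  then show ?thesis
    using zclass_step[of "fork (idt S X) (idt S X)"
        "comb W X (cmp S (pr1 Z Z') f) X (cmp S (pr2 Z Z') f)" a X "X + X" W "Z + Z'"] assms
    by simp
qed

lemma zclass_comb_cong1:
  assumes "zigzag A W Z X f a X' f' a'" "h \<in> arr S" "src S h = Y + W" "b \<in> ob A Y" "tgt S h = Z'"
  shows "zclass W (Z + Z') (X + Y) (comb W X f Y h) (pair A X Y a b) =
    zclass W (Z + Z') (X' + Y) (comb W X' f' Y h) (pair A X' Y a' b)"
  using assms(1)
proof (rule zigzag_invariant)
  fix \<phi> X X' a f
  assume "\<phi> \<in> hom S X X'" "a \<in> ob A X" "f \<in> hom S (X' + W) Z"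
  then show "zclass W (Z + Z') (X + Y) (comb W X (cmp S f (base_change W \<phi>)) Y h) (pair A X Y a b) =
      zclass W (Z + Z') (X' + Y) (comb W X' f Y h) (pair A X' Y (act A \<phi> a) b)"
    using zclass_comb[of f X' W h Y \<phi> X "idt S Y" Y a b "Z + Z'"] assms by (auto simp: hom_def)
qed

lemma zclass_comb_cong2:
  assumes "zigzag A W Z' Y h b Y' h' b'" "f \<in> arr S" "src S f = X + W" "a \<in> ob A X" "tgt S f = Z"
  shows "zclass W (Z + Z') (X + Y) (comb W X f Y h) (pair A X Y a b) =
    zclass W (Z + Z') (X + Y') (comb W X f Y' h') (pair A X Y' a b')"
  using assms(1)
proof (rule zigzag_invariant)
  fix \<phi> Y Y' b h
  assume "\<phi> \<in> hom S Y Y'" "b \<in> ob A Y" "h \<in> hom S (Y' + W) Z'"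
  then show "zclass W (Z + Z') (X + Y) (comb W X f Y (cmp S h (base_change W \<phi>))) (pair A X Y a b) =
      zclass W (Z + Z') (X + Y') (comb W X f Y' h) (pair A X Y' a (act A \<phi> b))"
    using zclass_comb[of f X W h Y' "idt S X" X \<phi> Y a b "Z + Z'"] assms by (auto simp: hom_def)
qed

lemma zclass_terminal:
  assumes "f \<in> arr S" "src S f = X + W" "tgt S f = 0" "h \<in> arr S" "src S h = Y + W" "tgt S h = 0"
    "a \<in> ob A X" "b \<in> ob A Y"
  shows "zclass W 0 X f a = zclass W 0 Y h b"
proof -
  obtain k where k: "k \<in> arr S" "src S k = 0 + W" "tgt S k = 0"
    using terminal_ex by blast
  obtain t where t: "t \<in> arr S" "src S t = X" "tgt S t = 0"
    using terminal_ex by blast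
  obtain s where s: "s \<in> arr S" "src S s = Y" "tgt S s = 0"
    using terminal_ex by blast
  have "f = cmp S k (base_change W t)" "h = cmp S k (base_change W s)"
    by (rule terminal_eq; use k t s assms in auto)+
  moreover have "act A t a = act A s b"
    using ob_0 t s assms by (metis act_in_ob)
  ultimately show ?thesis
    using zclass_step[of t k a X 0 W 0] zclass_step[of s k b Y 0 W 0] k t s assms by simp
qed

text \<open>
  Only the uniqueness of pairs is delicate, since the zigzags that join the first and the second
  components of two classes are unrelated. After duplication of the argument
  (lemma \<open>zclass_diag\<close>), each of them is applied to one component while the other stays fixed.
\<close>

lemma S_algebra_coend: "S_algebra S (coend W)"
proof (rule S_algebraI)
  show "act (coend W) f x \<in> ob (coend W) (tgt S f)" if "f \<in> arr S" "x \<in> ob (coend W) (src S f)" for f x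
    using that(2) by (rule coendE) (use that(1) in auto)
  show "act (coend W) (idt S X) x = x" if "x \<in> ob (coend W) X" for X x
    using that by (rule coendE) auto
  show "act (coend W) (cmp S h f) x = act (coend W) h (act (coend W) f x)"
    if "f \<in> arr S" "h \<in> arr S" "src S h = tgt S f" "x \<in> ob (coend W) (src S f)" for f h x
    using that(4) by (rule coendE) (use that(1-3) in auto)
  show "\<exists>!x. x \<in> ob (coend W) 0"
  proof (rule ex_ex1I)
    obtain k where "k \<in> arr S" "src S k = 0 + W" "tgt S k = 0"
      using terminal_ex by blast
    then show "\<exists>x. x \<in> ob (coend W) 0"
      using ob_0 by (metis in_coend)
    fix x y assume "x \<in> ob (coend W) 0" "y \<in> ob (coend W) 0"
    then show "x = y"
      by (metis coendE zclass_terminal)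
  qed
  show "\<exists>w \<in> ob (coend W) (Z + Z'). act (coend W) (pr1 Z Z') w = x \<and> act (coend W) (pr2 Z Z') w = y"
    if x: "x \<in> ob (coend W) Z" and y: "y \<in> ob (coend W) Z'" for Z Z' x y
  proof -
    obtain X f a where f: "f \<in> arr S" "src S f = X + W" "tgt S f = Z" "a \<in> ob A X" "x = zclass W Z X f a"
      using x by (rule coendE)
    obtain Y h b where h: "h \<in> arr S" "src S h = Y + W" "tgt S h = Z'" "b \<in> ob A Y" "y = zclass W Z' Y h b"
      using y by (rule coendE)
    show ?thesis
      by (rule bexI[where x = "zclass W (Z + Z') (X + Y) (comb W X f Y h) (pair A X Y a b)"])
        (use f h in \<open>auto simp: comb_def zclass_step\<close>)
  qed
  show "x = y"
    if x: "x \<in> ob (coend W) (Z + Z')" and y: "y \<in> ob (coend W) (Z + Z')"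
      and p1: "act (coend W) (pr1 Z Z') x = act (coend W) (pr1 Z Z') y"
      and p2: "act (coend W) (pr2 Z Z') x = act (coend W) (pr2 Z Z') y" for Z Z' x y
  proof -
    obtain X f a where f: "f \<in> arr S" "src S f = X + W" "tgt S f = Z + Z'" "a \<in> ob A X"
        "x = zclass W (Z + Z') X f a"
      using x by (rule coendE)
    obtain Y h b where h: "h \<in> arr S" "src S h = Y + W" "tgt S h = Z + Z'" "b \<in> ob A Y"
        "y = zclass W (Z + Z') Y h b"
      using y by (rule coendE)
    have "zclass W Z X (cmp S (pr1 Z Z') f) a = zclass W Z Y (cmp S (pr1 Z Z') h) b"
      using p1 f h by simp
    then have z1: "zigzag A W Z X (cmp S (pr1 Z Z') f) a Y (cmp S (pr1 Z Z') h) b"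
      by (rule zclass_eqD) (use h in \<open>auto simp: hom_def\<close>)
    have "zclass W Z' X (cmp S (pr2 Z Z') f) a = zclass W Z' Y (cmp S (pr2 Z Z') h) b"
      using p2 f h by simp
    then have z2: "zigzag A W Z' X (cmp S (pr2 Z Z') f) a Y (cmp S (pr2 Z Z') h) b"
      by (rule zclass_eqD) (use h in \<open>auto simp: hom_def\<close>)
    show ?thesis
      using zclass_diag[OF f(1-4)] zclass_diag[OF h(1-4)]
        zclass_comb_cong1[OF z1, of "cmp S (pr2 Z Z') f" X a Z']
        zclass_comb_cong2[OF z2, of "cmp S (pr1 Z Z') h" Y b Z] f h by simp
  qed
qed

end

locale free_extension = theory_algebra S A
  for S :: "('f, 'z) lawvere_scheme" and A :: "('f, 'a) alg" +
  fixes W :: obj and B :: "('f, 'b) alg" and j :: "obj \<Rightarrow> 'a \<Rightarrow> 'b" and i :: "obj \<Rightarrow> 'f \<Rightarrow> 'b"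
  assumes coproduct: "is_coproduct S A (Free S W) B j i"
begin

sublocale B: theory_algebra S B
  using coproduct lawvere_theory_axioms by (simp add: theory_algebra_def is_coproduct_def)

lemma hom_j: "alg_hom S A B j" and hom_i: "alg_hom S (Free S W) B i"
  using coproduct by (simp_all add: is_coproduct_def)

text \<open>
  The tuple of adjoined generators: the identity arrow of \<open>W\<close> is the tuple of the projections.
\<close>

definition w :: 'b where
  "w = i W (idt S W)"

lemma w [simp]: "w \<in> ob B W"
  unfolding w_def using alg_homD(1)[OF hom_i, of "idt S W" W] by (simp add: hom_def)

lemma i_eq: "c \<in> hom S W Z \<Longrightarrow> i Z c = act B c w"
  unfolding w_def using alg_homD(2)[OF hom_i, of c W Z "idt S W"] by (simp add: hom_def)

lemma j_in_ob [simp]: "a \<in> ob A X \<Longrightarrow> j X a \<in> ob B X"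
  by (rule alg_homD[OF hom_j])

lemma j_act [simp]: "f \<in> arr S \<Longrightarrow> a \<in> ob A (src S f) \<Longrightarrow> tgt S f = Y \<Longrightarrow> j Y (act A f a) = act B f (j (src S f) a)"
  by (rule alg_homD(2)[OF hom_j]) (simp_all add: hom_def)

definition val :: "obj \<Rightarrow> 'f \<Rightarrow> 'a \<Rightarrow> 'b" where
  "val X f a = act B f (pair B X W (j X a) w)"

text \<open>
  Elements of the free algebra are values with no argument from \<open>A\<close>, that is, with the argument in
  \<open>ob A 0\<close>.
\<close>

definition pt :: 'a where
  "pt = (THE x. x \<in> ob A 0)"

lemma pt [simp]: "pt \<in> ob A 0"
  unfolding pt_def by (rule theI'[OF ob_0])

lemma val_zigzag:
  assumes "zigzag A W Z X f a Y h b"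
  shows "val X f a = val Y h b"
  using assms
proof (rule zigzag_invariant)
  show "val X (cmp S f (base_change W \<phi>)) a = val Y f (act A \<phi> a)"
    if "\<phi> \<in> hom S X Y" "a \<in> ob A X" "f \<in> hom S (Y + W) Z" for \<phi> X Y a f
    using that by (auto simp: hom_def val_def)
qed

lemma embed_j: "alg_hom S A (coend W) (\<lambda>Z. zclass W Z Z (pr1 Z W))"
proof -
  have "zclass W Y Y (pr1 Y W) (act A f a) = zclass W Y X (cmp S f (pr1 X W)) a"
    if "f \<in> hom S X Y" "a \<in> ob A X" for X Y f a
    using zclass_step[of f "pr1 Y W" a X Y W Y] that by (simp add: hom_def)
  then show ?thesis
    unfolding alg_hom_def by (simp add: hom_def)
qed

lemma embed_i: "alg_hom S (Free S W) (coend W) (\<lambda>Z c. zclass W Z 0 (cmp S c (pr2 0 W)) pt)"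
  unfolding alg_hom_def by (auto simp: hom_def)

lemma pt_eq: "t \<in> arr S \<Longrightarrow> tgt S t = 0 \<Longrightarrow> a \<in> ob A (src S t) \<Longrightarrow> act A t a = pt"
  using ob_0 pt by (metis act_in_ob)

lemma universal:
  fixes D :: "('f, ('f \<times> 'a \<times> 'f) set + 'b) alg"
  assumes "S_algebra S D" "alg_hom S A D f" "alg_hom S (Free S W) D k"
  shows "\<exists>h. (alg_hom S B D h \<and> (\<forall>X. \<forall>a \<in> ob A X. h X (j X a) = f X a) \<and>
      (\<forall>X. \<forall>c \<in> hom S W X. h X (i X c) = k X c)) \<and>
    (\<forall>h'. alg_hom S B D h' \<and> (\<forall>X. \<forall>a \<in> ob A X. h' X (j X a) = f X a) \<and>
      (\<forall>X. \<forall>c \<in> hom S W X. h' X (i X c) = k X c) \<longrightarrow> (\<forall>X. \<forall>b \<in> ob B X. h' X b = h X b))"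
proof -
  have *: "\<forall>(D :: ('f, ('f \<times> 'a \<times> 'f) set + 'b) alg) f g.
      S_algebra S D \<and> alg_hom S A D f \<and> alg_hom S (Free S W) D g \<longrightarrow>
      (\<exists>h. (alg_hom S B D h \<and>
          (\<forall>X. \<forall>a \<in> ob A X. h X (j X a) = f X a) \<and>
          (\<forall>X. \<forall>c \<in> ob (Free S W) X. h X (i X c) = g X c)) \<and>
        (\<forall>h'. alg_hom S B D h' \<and>
          (\<forall>X. \<forall>a \<in> ob A X. h' X (j X a) = f X a) \<and>
          (\<forall>X. \<forall>c \<in> ob (Free S W) X. h' X (i X c) = g X c) \<longrightarrow>
          (\<forall>X. \<forall>b \<in> ob B X. h' X b = h X b)))"
    using coproduct unfolding is_coproduct_def by (elim conjE)
  show ?thesis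
    using mp[OF spec[OF spec[OF spec[OF *]]], OF conjI[OF assms(1) conjI[OF assms(2,3)]]]
    unfolding ob_Free .
qed

lemma hom_eq:
  fixes D :: "('f, ('f \<times> 'a \<times> 'f) set + 'b) alg"
  assumes "S_algebra S D" "alg_hom S B D h" "alg_hom S B D h'"
    and "\<And>X a. a \<in> ob A X \<Longrightarrow> h X (j X a) = h' X (j X a)"
    and "\<And>X c. c \<in> hom S W X \<Longrightarrow> h X (i X c) = h' X (i X c)" and "b \<in> ob B X"
  shows "h X b = h' X b"
proof -
  obtain m where m: "\<forall>k. alg_hom S B D k \<and> (\<forall>X. \<forall>a \<in> ob A X. k X (j X a) = h X (j X a)) \<and>
      (\<forall>X. \<forall>c \<in> hom S W X. k X (i X c) = h X (i X c)) \<longrightarrow> (\<forall>X. \<forall>b \<in> ob B X. k X b = m X b)"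
    using universal[OF assms(1) alg_hom_comp[OF hom_j assms(2)] alg_hom_comp[OF hom_i assms(2)]]
    by (elim exE conjE)
  have "h X b = m X b"
    using m[THEN spec, of h] assms by simp
  moreover have "h' X b = m X b"
    using m[THEN spec, of h'] assms by simp
  ultimately show ?thesis by simp
qed

text \<open>
  The universal property gives a map from \<open>B\<close> to the coend, and evaluation of formal values gives a
  map back. Their composite fixes both injections, so by uniqueness it is the identity of \<open>B\<close>.
  Hence every element of \<open>B\<close> is a value, and equal values have the same class.
\<close>

lemma to_coend:
  obtains h where "alg_hom S B (coend W) h"
    "\<And>Z X f a. f \<in> arr S \<Longrightarrow> src S f = X + W \<Longrightarrow> tgt S f = Z \<Longrightarrow> a \<in> ob A X \<Longrightarrow>
      h Z (val X f a) = zclass W Z X f a"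
    "\<And>Z b. b \<in> ob B Z \<Longrightarrow> \<exists>X f a. f \<in> arr S \<and> src S f = X + W \<and> tgt S f = Z \<and> a \<in> ob A X \<and>
      h Z b = zclass W Z X f a \<and> b = val X f a"
proof -
  let ?D = "alg_image Inl (coend W) :: ('f, ('f \<times> 'a \<times> 'f) set + 'b) alg"
  interpret coend: theory_algebra S "coend W"
    using S_algebra_coend lawvere_theory_axioms by (simp add: theory_algebra_def)
  have D: "S_algebra S ?D" "alg_hom S (coend W) ?D (\<lambda>_. Inl)"
    by (simp_all add: coend.S_algebra_alg_image alg_hom_alg_image)
  obtain h where h: "alg_hom S B ?D h"
      "\<forall>X. \<forall>a \<in> ob A X. h X (j X a) = Inl (zclass W X X (pr1 X W) a)"
      "\<forall>X. \<forall>c \<in> hom S W X. h X (i X c) = Inl (zclass W X 0 (cmp S c (pr2 0 W)) pt)"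
    using universal[OF D(1) alg_hom_comp[OF embed_j D(2)] alg_hom_comp[OF embed_i D(2)]]
    by (elim exE conjE)
  have outD: "alg_hom S ?D (coend W) (\<lambda>_. projl)"
    unfolding alg_hom_def by (auto simp: alg_image_def hom_def coend.act_in_ob)
  define k where "k = (\<lambda>Z b. projl (h Z b))"
  have k: "alg_hom S B (coend W) k"
    unfolding k_def by (rule alg_hom_comp[OF h(1) outD])
  have kj: "k X (j X a) = zclass W X X (pr1 X W) a" if "a \<in> ob A X" for X a
    using h(2) that by (simp add: k_def)
  have kw: "k W w = zclass W W 0 (pr2 0 W) pt"
    using h(3)[rule_format, of "idt S W" W] by (simp add: k_def w_def hom_def)
  have kact: "k Y (act B f b) = act (coend W) f (k (src S f) b)"
    if "f \<in> arr S" "tgt S f = Y" "b \<in> ob B (src S f)" for f b Y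
    using alg_homD(2)[OF k, of f "src S f" Y b] that by (simp add: hom_def)
  have kob: "k X b \<in> ob (coend W) X" if "b \<in> ob B X" for X b
    using alg_homD(1)[OF k that] .
  have kval: "k Z (val X f a) = zclass W Z X f a"
    if f: "f \<in> arr S" "src S f = X + W" "tgt S f = Z" and a: "a \<in> ob A X" for Z X f a
  proof -
    have u: "pair B X W (j X a) w \<in> ob B (X + W)"
      using a by simp
    have "k (X + W) (pair B X W (j X a) w) = zclass W (X + W) X (idt S (X + W)) a"
    proof (rule coend.pair_eqI)
      show "act (coend W) (pr1 X W) (k (X + W) (pair B X W (j X a) w)) =
          act (coend W) (pr1 X W) (zclass W (X + W) X (idt S (X + W)) a)"
        using kact[of "pr1 X W" X "pair B X W (j X a) w"] a u kj by simp
      obtain t where t: "t \<in> arr S" "src S t = X" "tgt S t = 0"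
        using terminal_ex by blast
      have "zclass W W 0 (pr2 0 W) pt = zclass W W X (pr2 X W) a"
        using zclass_step[of t "pr2 0 W" a X 0 W W] t a by (simp add: pt_eq)
      then show "act (coend W) (pr2 X W) (k (X + W) (pair B X W (j X a) w)) =
          act (coend W) (pr2 X W) (zclass W (X + W) X (idt S (X + W)) a)"
        using kact[of "pr2 X W" W "pair B X W (j X a) w"] a u kw by simp
    qed (use u a kob in auto)
    then show ?thesis
      using kact[of f Z "pair B X W (j X a) w"] f a u by (simp add: val_def)
  qed
  define l where "l Z x = (THE b. \<exists>X f a. f \<in> arr S \<and> src S f = X + W \<and> tgt S f = Z \<and> a \<in> ob A X \<and>
      x = zclass W Z X f a \<and> b = val X f a)" for Z x
  have l: "l Z (zclass W Z X f a) = val X f a"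
    if "f \<in> arr S" "src S f = X + W" "tgt S f = Z" "a \<in> ob A X" for Z X f a
    unfolding l_def
  proof (rule the_equality)
    fix b assume "\<exists>X' f' a'. f' \<in> arr S \<and> src S f' = X' + W \<and> tgt S f' = Z \<and> a' \<in> ob A X' \<and>
      zclass W Z X f a = zclass W Z X' f' a' \<and> b = val X' f' a'"
    then obtain X' f' a' where "f' \<in> arr S" "src S f' = X' + W" "tgt S f' = Z" "a' \<in> ob A X'"
      and eq: "zclass W Z X f a = zclass W Z X' f' a'" and b: "b = val X' f' a'"
      by blast
    then have "zigzag A W Z X f a X' f' a'"
      using zclass_eqD[OF eq] by (simp add: hom_def)
    then show "b = val X f a"
      using val_zigzag b by metis
  qed (use that in blast)
  have val_ob: "val X f a \<in> ob B Z"
    if "f \<in> arr S" "src S f = X + W" "tgt S f = Z" "a \<in> ob A X" for Z X f a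
    using that by (simp add: val_def)
  have l_hom: "alg_hom S (coend W) B l"
    unfolding alg_hom_def
  proof (intro conjI allI ballI)
    show "l Z x \<in> ob B Z" if "x \<in> ob (coend W) Z" for Z x
      using that by (rule coendE) (simp add: l val_ob)
    show "l Y (act (coend W) f x) = act B f (l Z x)" if f: "f \<in> hom S Z Y" and x: "x \<in> ob (coend W) Z" for Z Y f x
      using x by (rule coendE) (use f in \<open>simp add: l hom_def val_def\<close>)
  qed
  let ?R = "alg_image Inr B :: ('f, ('f \<times> 'a \<times> 'f) set + 'b) alg"
  have R: "S_algebra S ?R" "alg_hom S B ?R (\<lambda>_. Inr)"
    by (simp_all add: B.S_algebra_alg_image alg_hom_alg_image)
  have li: "l X (k X (i X c)) = i X c" if c: "c \<in> hom S W X" for X c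
  proof -
    have "k X (i X c) = act (coend W) c (k W w)"
      using kact[of c X w] c by (simp add: i_eq hom_def)
    then show ?thesis
      using c by (simp add: kw i_eq) (simp add: hom_def l val_def)
  qed
  have lj: "l X (k X (j X a)) = j X a" if "a \<in> ob A X" for X a
    using that by (simp add: kj l val_def)
  have lk: "l X (k X b) = b" if b: "b \<in> ob B X" for X b
    using hom_eq[OF R(1) alg_hom_comp[OF alg_hom_comp[OF k l_hom] R(2)] R(2)] lj li b by simp
  have "\<exists>X f a. f \<in> arr S \<and> src S f = X + W \<and> tgt S f = Z \<and> a \<in> ob A X \<and>
      k Z b = zclass W Z X f a \<and> b = val X f a" if b: "b \<in> ob B Z" for Z b
    using kob[OF b]
  proof (rule coendE)
    fix X f a
    assume f: "f \<in> arr S" "src S f = X + W" "tgt S f = Z" "a \<in> ob A X" "k Z b = zclass W Z X f a"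
    then show ?thesis
      using lk[OF b] l[OF f(1-4)] by metis
  qed
  then show ?thesis
    using that[OF k kval] by blast
qed

lemma rep:
  assumes "b \<in> ob B Z"
  obtains X f a where "f \<in> arr S" "src S f = X + W" "tgt S f = Z" "a \<in> ob A X" "b = val X f a"
  using assms to_coend by metis

lemma val_eqD:
  assumes "f \<in> arr S" "src S f = X + W" "tgt S f = Z" "a \<in> ob A X"
    and "h \<in> arr S" "src S h = Y + W" "tgt S h = Z" "b \<in> ob A Y"
    and "val X f a = val Y h b"
  shows "zigzag A W Z X f a Y h b"
proof -
  have "zclass W Z X f a = zclass W Z Y h b"
    using to_coend assms by metis
  then show ?thesis
    by (rule zclass_eqD) (use assms in \<open>auto simp: hom_def\<close>)
qed

text \<open>
  The assignment \<open>f(r(a), e)\<close> to the formal value \<open>f(a, w)\<close> is invariant under zigzags because \<open>r\<close> is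
  natural. This gives the maps out of \<open>B\<close> into algebras of an arbitrary type.
\<close>

lemma extension:
  fixes E :: "('f, 'e) alg"
  assumes E: "S_algebra S E" and r: "alg_hom S A E r" and e: "e \<in> ob E W"
  obtains h where "alg_hom S B E h" "\<And>X a. a \<in> ob A X \<Longrightarrow> h X (j X a) = r X a" "h W w = e"
proof -
  interpret E: theory_algebra S E
    using E lawvere_theory_axioms by (simp add: theory_algebra_def)
  have r_ob [simp]: "r X a \<in> ob E X" if "a \<in> ob A X" for X a
    using alg_homD(1)[OF r that] .
  have r_act: "r Y (act A f a) = act E f (r X a)" if "f \<in> hom S X Y" "a \<in> ob A X" for X Y f a
    using alg_homD(2)[OF r that] .
  define u where "u X f a = act E f (pair E X W (r X a) e)" for X f a
  have u_zigzag: "u X f a = u Y h b" if "zigzag A W Z X f a Y h b" for Z X f a Y h b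
    using that
  proof (rule zigzag_invariant)
    show "u X (cmp S f (base_change W \<phi>)) a = u Y f (act A \<phi> a)"
      if "\<phi> \<in> hom S X Y" "a \<in> ob A X" "f \<in> hom S (Y + W) Z" for \<phi> X Y a f
      using that e r_act by (auto simp: hom_def u_def)
  qed
  define h where "h Z b = (THE x. \<exists>X f a. f \<in> arr S \<and> src S f = X + W \<and> tgt S f = Z \<and> a \<in> ob A X \<and>
      b = val X f a \<and> x = u X f a)" for Z b
  have h: "h Z (val X f a) = u X f a"
    if "f \<in> arr S" "src S f = X + W" "tgt S f = Z" "a \<in> ob A X" for Z X f a
    unfolding h_def
  proof (rule the_equality)
    fix x assume "\<exists>X' f' a'. f' \<in> arr S \<and> src S f' = X' + W \<and> tgt S f' = Z \<and> a' \<in> ob A X' \<and>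
      val X f a = val X' f' a' \<and> x = u X' f' a'"
    then show "x = u X f a"
      using val_eqD[OF that] u_zigzag by metis
  qed (use that in blast)
  have "alg_hom S B E h"
    unfolding alg_hom_def
  proof (intro conjI allI ballI)
    show "h Z b \<in> ob E Z" if "b \<in> ob B Z" for Z b
      using that by (rule rep) (simp add: h u_def e)
    show "h Y (act B f b) = act E f (h Z b)" if f: "f \<in> hom S Z Y" and b: "b \<in> ob B Z" for Z Y f b
      using b
    proof (rule rep)
      fix X k a assume k: "k \<in> arr S" "src S k = X + W" "tgt S k = Z" "a \<in> ob A X" "b = val X k a"
      then have "act B f b = val X (cmp S f k) a"
        using f by (simp add: val_def hom_def)
      then show ?thesis
        using f k e by (simp add: h u_def hom_def)
    qed
  qed
  moreover have "h X (j X a) = r X a" if "a \<in> ob A X" for X a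
    using h[of "pr1 X W" X X a] that e by (simp add: val_def u_def)
  moreover have "h W w = e"
    using h[of "pr2 0 W" 0 W pt] e by (simp add: val_def u_def)
  ultimately show ?thesis
    using that by blast
qed

end

section \<open>Superalgebra operations\<close>

lemma psum_simps [simp]: "psum False q = q" "psum q False = q" "psum True q = (\<not> q)" "psum q True = (\<not> q)"
  by (auto simp: psum_def)

lemma psum_commute: "psum p q = psum q p"
  by (auto simp: psum_def)

lemma psum_assoc: "psum (psum p q) r = psum p (psum q r)"
  by (auto simp: psum_def)

lemma sceq_wt: "sceq X p s t \<Longrightarrow> wt X p s \<and> wt X p t"
proof (induction rule: sceq.induct)
  case (mul_assoc p s q t r u)
  then show ?case
    using wt.intros(8)[of X "psum p q" "Mul s t" r u] wt.intros(8)[of X p s "psum q r" "Mul t u"]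
      wt.intros(8)[of X p s q t] wt.intros(8)[of X q t r u] by (simp add: psum_assoc)
next
  case (mul_one p s)
  then show ?case
    using wt.intros(8)[OF wt.intros(4), of X p s] by simp
next
  case (supercomm p s q t)
  then show ?case
    using wt.intros(8)[of X p s q t] wt.intros(8)[of X q t p s]
    by (auto simp: psum_commute intro: wt.intros)
qed (auto intro: wt.intros)

lemma wt_subst:
  assumes "wt Y p s" "Y = (length es, length os)"
    "\<forall>e \<in> set es. wt X False e" "\<forall>e \<in> set os. wt X True e"
  shows "wt X p (subst es os s)"
  using assms by induction (auto intro: wt.intros)

lemma sceq_subst:
  assumes "sceq Y p s t" "Y = (length es, length os)"
    "\<forall>e \<in> set es. wt X False e" "\<forall>e \<in> set os. wt X True e"
  shows "sceq X p (subst es os s) (subst es os t)"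
proof -
  have w: "wt X p (subst es os s)" if "wt Y p s" for p s
    using that assms(2-4) by (rule wt_subst)
  show ?thesis
    using assms(1)
  proof induction
    case (sceq_sym p s t)
    show ?case by (rule sceq.sceq_sym) fact
  next
    case (sceq_trans p s t u)
    show ?case by (rule sceq.sceq_trans) fact+
  next
    case (supercomm p s q t)
    then show ?case
      using sceq.supercomm[OF w w, of p s q t] by (cases "p \<and> q") auto
  qed (auto intro: w sceq.intros(1,4-))
qed

lemma sceq_subst_cong:
  assumes "wt Y p s" "Y = (length es, length os)"
    "list_all2 (sceq X False) es es'" "list_all2 (sceq X True) os os'"
  shows "sceq X p (subst es os s) (subst es' os' s)"
  using assms
  by induction (auto intro: wt.intros sceq_refl cong_Add cong_Neg cong_Scale cong_Mul
      simp: list_all2_conv_all_nth)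

lemma scls_eqI:
  assumes "sceq X p s t"
  shows "scls X p s = scls X p t"
  unfolding scls_def using assms by (auto intro: sceq_trans sceq_sym)

lemma sceq_srep: "wt X p s \<Longrightarrow> sceq X p s (srep (scls X p s))"
  unfolding srep_def scls_def mem_Collect_eq by (rule someI) (rule sceq_refl)

definition terms_arrow :: "obj \<Rightarrow> sterm list \<Rightarrow> sterm list \<Rightarrow> sc_arrow" where
  "terms_arrow X es os = SArr X (map (scls X False) es) (map (scls X True) os)"

lemma terms_arrow_hom:
  assumes "\<forall>e \<in> set es. wt X False e" "\<forall>e \<in> set os. wt X True e" "Y = (length es, length os)"
  shows "terms_arrow X es os \<in> hom SCom X Y"
  using assms by (auto simp: hom_def SCom_def terms_arrow_def)

lemma term_arrow_hom: "wt X p s \<Longrightarrow> term_arrow X p s \<in> hom SCom X (srt p)"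
  using terms_arrow_hom[of "[]" X "[s]"] terms_arrow_hom[of "[s]" X "[]"]
  by (auto simp: term_arrow_def terms_arrow_def srt_def)

text \<open>
  Composition in \<open>SCom\<close> substitutes arbitrarily chosen representatives; since the congruence is
  compatible with substitution, the composite is the class of the given terms substituted.
\<close>

lemma cmp_term_arrow:
  assumes "wt Y p s" "Y = (length es, length os)"
    "\<forall>e \<in> set es. wt X False e" "\<forall>e \<in> set os. wt X True e"
  shows "cmp SCom (term_arrow Y p s) (terms_arrow X es os) = term_arrow X p (subst es os s)"
proof -
  let ?es = "map (\<lambda>e. srep (scls X False e)) es" and ?os = "map (\<lambda>e. srep (scls X True e)) os"
  have 1: "list_all2 (sceq X False) es ?es" "list_all2 (sceq X True) os ?os"
    using assms by (auto simp: list_all2_conv_all_nth sceq_srep)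
  then have 2: "\<forall>e \<in> set ?es. wt X False e" "\<forall>e \<in> set ?os. wt X True e"
    using assms by (auto dest: sceq_srep sceq_wt)
  have "sceq X p (subst ?es ?os s) (subst ?es ?os (srep (scls Y p s)))"
    by (rule sceq_subst[OF sceq_srep[OF assms(1)] _ 2]) (use assms in simp)
  then have "scls X p (subst es os s) = scls X p (subst ?es ?os (srep (scls Y p s)))"
    using scls_eqI sceq_subst_cong[OF assms(1,2) 1] by metis
  then show ?thesis
    by (cases p) (simp_all add: SCom_def sc_cmp_def terms_arrow_def term_arrow_def o_def Let_def)
qed

definition var :: "bool \<Rightarrow> nat \<Rightarrow> sterm" where
  "var p i = (if p then OV i else EV i)"

lemma wt_var [simp]: "i < cnt p X \<Longrightarrow> wt X p (var p i)"
  by (auto simp: var_def cnt_def intro: wt.intros split: if_splits)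

locale scom_theory = lawvere_theory S + theory_morphism SCom S "scom S"
  for S :: "('f, 'z) super_theory_scheme"
begin

lemma scom_var: "i < cnt p X \<Longrightarrow> scom S (term_arrow X p (var p i)) = gen S p X i"
  using map_prE[of i "fst X" "snd X"] map_prO[of i "snd X" "fst X"]
  by (auto simp: term_arrow_def var_def gen_def SCom_def cnt_def split: if_splits)

lemma arr_scom [simp]:
  assumes "wt X p s"
  shows "scom S (term_arrow X p s) \<in> arr S" "src S (scom S (term_arrow X p s)) = X"
    "tgt S (scom S (term_arrow X p s)) = srt p"
  using map_hom[OF term_arrow_hom[OF assms]] by (auto simp: hom_def)

end

lemma wt_Mul_var: "i < cnt p X \<Longrightarrow> k < cnt q X \<Longrightarrow> wt X (psum p q) (Mul (var p i) (var q k))"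
  by (intro wt.intros wt_var)

locale scom_algebra = scom_theory S + theory_algebra S A
  for S :: "('f, 'z) super_theory_scheme" and A :: "('f, 'a) alg"
begin

text \<open>
  The value of a term at a tuple. It turns the congruence of terms into identities in \<open>A\<close>.
\<close>

definition tval :: "obj \<Rightarrow> bool \<Rightarrow> sterm \<Rightarrow> 'a \<Rightarrow> 'a" where
  "tval X p s u = act A (scom S (term_arrow X p s)) u"

lemma tval_in_ob [simp]: "wt X p s \<Longrightarrow> u \<in> ob A X \<Longrightarrow> tval X p s u \<in> ob A (srt p)"
  by (simp add: tval_def)

lemma tval_sceq: "sceq X p s t \<Longrightarrow> tval X p s u = tval X p t u"
  using scls_eqI[of X p s t] by (cases p) (simp_all add: tval_def term_arrow_def)

lemma tval_var: "i < cnt p X \<Longrightarrow> tval X p (var p i) u = act A (gen S p X i) u"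
  by (simp add: tval_def scom_var)

text \<open>
  A term evaluated at values of terms is the value of the term obtained by substitution, since the
  map from \<open>SCom\<close> preserves composition and projections. All compatibilities of the operations with
  the term constructors are instances.
\<close>

lemma eval_scom:
  assumes "u \<in> ob A X" "wt Y p s" "Y = (length es, length os)"
    "\<forall>e \<in> set es. wt X False e" "\<forall>e \<in> set os. wt X True e"
  shows "eval S A (scom S (term_arrow Y p s)) (map (\<lambda>e. tval X False e u) es)
    (map (\<lambda>e. tval X True e u) os) = tval X p (subst es os s) u"
proof -
  let ?\<sigma> = "terms_arrow X es os"
  have \<sigma>: "?\<sigma> \<in> hom SCom X Y" and \<sigma>': "scom S ?\<sigma> \<in> hom S X Y"
    using terms_arrow_hom assms map_hom by blast+
  let ?v = "act A (scom S ?\<sigma>) u"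
  have v: "?v \<in> ob A Y"
    using \<sigma>' assms(1) by (auto simp: hom_def)
  have *: "act A (scom S (term_arrow Y q t)) ?v = tval X q (subst es os t) u" if t: "wt Y q t" for q t
  proof -
    have "act A (scom S (term_arrow Y q t)) ?v =
        act A (cmp S (scom S (term_arrow Y q t)) (scom S ?\<sigma>)) u"
      using t \<sigma>' assms(1) by (simp add: hom_def)
    also have "cmp S (scom S (term_arrow Y q t)) (scom S ?\<sigma>) =
        scom S (term_arrow X q (subst es os t))"
      using map_cmp[OF \<sigma> term_arrow_hom[OF t]] cmp_term_arrow[OF t assms(3-5)] by simp
    finally show ?thesis by (simp add: tval_def)
  qed
  have gens: "act A (gen S q Y i) ?v = tval X q (subst es os (var q i)) u" if "i < cnt q Y" for q i
    using *[of q "var q i"] that by (simp add: scom_var)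
  have "comps S A False Y ?v = map (\<lambda>e. tval X False e u) es"
    using gens[of _ False] assms(3) by (auto simp: list_eq_iff_nth_eq cnt_def var_def)
  moreover have "comps S A True Y ?v = map (\<lambda>e. tval X True e u) os"
    using gens[of _ True] assms(3) by (auto simp: list_eq_iff_nth_eq cnt_def var_def)
  ultimately show ?thesis
    using eval_comps[OF v, of "scom S (term_arrow Y p s)"] *[OF assms(2)] by simp
qed

lemma tval_Zero:
  assumes "u \<in> ob A X"
  shows "szero S A p = tval X p (Zero p) u"
proof -
  have "wt (0, 0) p (Zero p)"
    by (rule wt.intros)
  from eval_scom[OF assms this, of "[]" "[]"] show ?thesis
    by (simp add: szero_def)
qed

lemma tval_Add:
  assumes "u \<in> ob A X" "wt X p s" "wt X p t"
  shows "sadd S A p (tval X p s u) (tval X p t u) = tval X p (Add s t) u"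
proof -
  have "wt (0, 2) True (Add (OV 0) (OV 1))" "wt (2, 0) False (Add (EV 0) (EV 1))"
    by (simp_all add: wt.intros(1-7))
  from eval_scom[OF assms(1) this(1), of "[]" "[s, t]"] eval_scom[OF assms(1) this(2), of "[s, t]" "[]"]
  show ?thesis
    using assms by (cases p) (simp_all add: sadd_def)
qed

lemma tval_Sub:
  assumes "u \<in> ob A X" "wt X p s" "wt X p t"
  shows "ssub S A p (tval X p s u) (tval X p t u) = tval X p (Add s (Neg t)) u"
proof -
  have "wt (0, 2) True (Add (OV 0) (Neg (OV 1)))" "wt (2, 0) False (Add (EV 0) (Neg (EV 1)))"
    by (simp_all add: wt.intros(1-7))
  from eval_scom[OF assms(1) this(1), of "[]" "[s, t]"] eval_scom[OF assms(1) this(2), of "[s, t]" "[]"]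
  show ?thesis
    using assms by (cases p) (simp_all add: ssub_def)
qed

lemma tval_Mul:
  assumes "u \<in> ob A X" "wt X p s" "wt X q t"
  shows "smul S A p q (tval X p s u) (tval X q t u) = tval X (psum p q) (Mul s t) u"
proof -
  have w: "wt (0, 2) False (Mul (OV 0) (OV 1))" "wt (1, 1) True (Mul (OV 0) (EV 0))"
    "wt (1, 1) True (Mul (EV 0) (OV 0))" "wt (2, 0) False (Mul (EV 0) (EV 1))"
    using wt.intros(8)[of "(0, 2)" True "OV 0" True "OV 1"] wt.intros(8)[of "(1, 1)" True "OV 0" False "EV 0"]
      wt.intros(8)[of "(1, 1)" False "EV 0" True "OV 0"] wt.intros(8)[of "(2, 0)" False "EV 0" False "EV 1"]
    by (simp_all add: wt.intros(1-7))
  show ?thesis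
    using eval_scom[OF assms(1) w(1), of "[]" "[s, t]"] eval_scom[OF assms(1) w(2), of "[t]" "[s]"]
      eval_scom[OF assms(1) w(3), of "[s]" "[t]"] eval_scom[OF assms(1) w(4), of "[s, t]" "[]"] assms
    by (cases p; cases q) (simp_all add: smul_def)
qed

lemma szero_in_ob [simp]: "szero S A p \<in> ob A (srt p)"
proof -
  obtain u where "u \<in> ob A 0"
    using ob_0 by blast
  then show ?thesis
    by (simp add: tval_Zero[of u 0] wt.intros(3))
qed

lemma cnt_3 [simp]: "cnt p (3, 3) = 3"
  by (simp add: cnt_def)

text \<open>
  Laws in up to three elements of arbitrary parities are instances of the congruence over the single
  object \<open>(3|3)\<close>: the element number \<open>i\<close> is the variable number \<open>i\<close> of its parity, and the variables
  left over are set to zero.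
\<close>

lemma triple_ex:
  assumes "a \<in> ob A (srt p)" "b \<in> ob A (srt q)" "c \<in> ob A (srt r)"
  obtains u where "u \<in> ob A (3, 3)" "a = tval (3, 3) p (var p 0) u" "b = tval (3, 3) q (var q 1) u"
    "c = tval (3, 3) r (var r 2) u"
proof -
  let ?a = "\<lambda>s i. if i = 0 \<and> s = p then a else if i = 1 \<and> s = q then b
    else if i = 2 \<and> s = r then c else szero S A s"
  have "\<exists>u \<in> ob A (3, 3). \<forall>s. \<forall>i < cnt s (3, 3). act A (gen S s (3, 3) i) u = ?a s i"
  proof (rule tuple_ex)
    show "?a s i \<in> ob A (srt s)" for s i
      using assms by simp
  qed
  then obtain u where u: "u \<in> ob A (3, 3)"
      "\<forall>s. \<forall>i < cnt s (3, 3). act A (gen S s (3, 3) i) u = ?a s i"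
    by blast
  show ?thesis
  proof (rule that[OF u(1)])
    show "a = tval (3, 3) p (var p 0) u"
      using u(2)[THEN spec[of _ p], THEN spec[of _ 0]] by (simp add: tval_var)
    show "b = tval (3, 3) q (var q 1) u"
      using u(2)[THEN spec[of _ q], THEN spec[of _ 1]] by (simp add: tval_var)
    show "c = tval (3, 3) r (var r 2) u"
      using u(2)[THEN spec[of _ r], THEN spec[of _ 2]] by (simp add: tval_var)
  qed
qed

lemma pair_ex:
  assumes "a \<in> ob A (srt p)" "b \<in> ob A (srt q)"
  obtains u where "u \<in> ob A (3, 3)" "a = tval (3, 3) p (var p 0) u" "b = tval (3, 3) q (var q 1) u"
  by (rule triple_ex[OF assms assms(2)]) (rule that)

lemma sadd_in_ob [simp]:
  assumes "a \<in> ob A (srt p)" "b \<in> ob A (srt p)"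
  shows "sadd S A p a b \<in> ob A (srt p)"
  by (rule pair_ex[OF assms]) (simp add: tval_Add wt.intros(1-7))

lemma ssub_in_ob [simp]:
  assumes "a \<in> ob A (srt p)" "b \<in> ob A (srt p)"
  shows "ssub S A p a b \<in> ob A (srt p)"
  by (rule pair_ex[OF assms]) (simp add: tval_Sub wt.intros(1-7))

lemma smul_in_ob [simp]:
  assumes "a \<in> ob A (srt p)" "b \<in> ob A (srt q)" "r = psum p q"
  shows "smul S A p q a b \<in> ob A (srt r)"
  by (rule pair_ex[OF assms(1,2)]) (simp add: assms(3) tval_Mul wt_Mul_var)

lemma sadd_assoc:
  assumes "a \<in> ob A (srt p)" "b \<in> ob A (srt p)" "c \<in> ob A (srt p)"
  shows "sadd S A p (sadd S A p a b) c = sadd S A p a (sadd S A p b c)"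
  by (rule triple_ex[OF assms])
    (simp add: tval_Add wt.intros(1-7) tval_sceq[OF sceq.add_assoc[OF wt_var wt_var wt_var]])

lemma sadd_commute:
  assumes "a \<in> ob A (srt p)" "b \<in> ob A (srt p)"
  shows "sadd S A p a b = sadd S A p b a"
  by (rule pair_ex[OF assms])
    (simp add: tval_Add, rule tval_sceq, rule add_comm, simp_all)

lemma sadd_zero [simp]:
  assumes "a \<in> ob A (srt p)"
  shows "sadd S A p a (szero S A p) = a"
proof -
  obtain u where u: "u \<in> ob A (3, 3)" "a = tval (3, 3) p (var p 0) u"
    by (rule pair_ex[OF assms assms])
  have "sadd S A p a (szero S A p) = tval (3, 3) p (Add (var p 0) (Zero p)) u"
    using u tval_Zero[OF u(1), of p] by (simp add: tval_Add wt.intros(1-7))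
  also have "\<dots> = a"
    unfolding u(2) by (rule tval_sceq, rule add_zero) simp
  finally show ?thesis .
qed

lemma zero_sadd [simp]: "a \<in> ob A (srt p) \<Longrightarrow> sadd S A p (szero S A p) a = a"
  using sadd_commute[of a p "szero S A p"] by simp

lemma ssub_sadd [simp]:
  assumes "a \<in> ob A (srt p)" "b \<in> ob A (srt p)"
  shows "sadd S A p (ssub S A p a b) b = a"
proof -
  obtain u where u: "u \<in> ob A (3, 3)" "a = tval (3, 3) p (var p 0) u" "b = tval (3, 3) p (var p 1) u"
    by (rule pair_ex[OF assms])
  let ?s = "var p 0" and ?t = "var p 1" and ?X = "(3, 3)"
  have w [simp]: "wt ?X p ?s" "wt ?X p ?t"
    by simp_all
  have w' [simp]: "wt ?X p (Neg ?t)" "wt ?X p (Add ?s (Neg ?t))"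
    by (intro wt.intros w)+
  have "sceq ?X p (Add (Neg ?t) ?t) (Zero p)"
    by (rule sceq_trans[OF add_comm add_neg]) (rule w w')+
  then have "sceq ?X p (Add ?s (Add (Neg ?t) ?t)) ?s"
    by (rule sceq_trans[OF cong_Add[OF sceq_refl[OF w(1)]] add_zero[OF w(1)]])
  then have "sceq ?X p (Add (Add ?s (Neg ?t)) ?t) ?s"
    by (rule sceq_trans[OF sceq.add_assoc[OF w(1) w'(1) w(2)]])
  then show ?thesis
    using u by (simp add: tval_Sub tval_Add wt.intros(1-7) tval_sceq)
qed

lemma smul_sadd:
  assumes "a \<in> ob A (srt p)" "b \<in> ob A (srt q)" "c \<in> ob A (srt q)"
  shows "smul S A p q a (sadd S A q b c) =
    sadd S A (psum p q) (smul S A p q a b) (smul S A p q a c)"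
  by (rule triple_ex[OF assms])
    (simp add: tval_Add tval_Mul wt.intros(1-7) wt_Mul_var tval_sceq[OF mul_add[OF wt_var wt_var wt_var]])

lemma sadd_smul:
  assumes "a \<in> ob A (srt p)" "b \<in> ob A (srt p)" "c \<in> ob A (srt q)"
  shows "smul S A p q (sadd S A p a b) c =
    sadd S A (psum p q) (smul S A p q a c) (smul S A p q b c)"
  by (rule triple_ex[OF assms])
    (simp add: tval_Add tval_Mul wt.intros(1-7) wt_Mul_var tval_sceq[OF add_mul[OF wt_var wt_var wt_var]])

lemma sadd_cancel:
  assumes "a \<in> ob A (srt p)" "b \<in> ob A (srt p)" "c \<in> ob A (srt p)"
    and "sadd S A p a c = sadd S A p b c"
  shows "a = b"
proof -
  define n where "n = ssub S A p (szero S A p) c"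
  have n: "n \<in> ob A (srt p)" "sadd S A p c n = szero S A p"
    using assms(3) sadd_commute[of c p n] by (simp_all add: n_def)
  have "x = sadd S A p (sadd S A p x c) n" if "x \<in> ob A (srt p)" for x
    using that assms(3) n by (simp add: sadd_assoc)
  then show ?thesis
    using assms by metis
qed

lemma ssub_eqI: "c \<in> ob A (srt p) \<Longrightarrow> b \<in> ob A (srt p) \<Longrightarrow> a = sadd S A p c b \<Longrightarrow> ssub S A p a b = c"
  using sadd_cancel[of "ssub S A p a b" p c b] by simp

lemma ssub_self [simp]: "a \<in> ob A (srt p) \<Longrightarrow> ssub S A p a a = szero S A p"
  by (rule ssub_eqI) simp_all

lemma ssub_zero [simp]: "a \<in> ob A (srt p) \<Longrightarrow> ssub S A p a (szero S A p) = a"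
  by (rule ssub_eqI) simp_all

lemma sadd_self_zero:
  assumes "a \<in> ob A (srt p)" "sadd S A p a a = a"
  shows "a = szero S A p"
  using sadd_cancel[of a p "szero S A p" a] assms by simp

lemma smul_zero [simp]:
  assumes "a \<in> ob A (srt p)" "r = psum p q"
  shows "smul S A p q a (szero S A q) = szero S A r"
  using smul_sadd[OF assms(1), of "szero S A q" q "szero S A q"] assms by (intro sadd_self_zero) auto

lemma zero_smul [simp]:
  assumes "a \<in> ob A (srt q)" "r = psum p q"
  shows "smul S A p q (szero S A p) a = szero S A r"
  using sadd_smul[of "szero S A p" p "szero S A p" a q] assms by (intro sadd_self_zero) auto

lemma ssub_smul:
  assumes "a \<in> ob A (srt p)" "b \<in> ob A (srt p)" "c \<in> ob A (srt q)"
  shows "smul S A p q (ssub S A p a b) c =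
    ssub S A (psum p q) (smul S A p q a c) (smul S A p q b c)"
  by (rule ssub_eqI[symmetric])
     (use assms sadd_smul[of "ssub S A p a b" p b c q] in simp_all)

end

lemma (in theory_algebra) tuple_of_lists:
  assumes "set as \<subseteq> ob A (srt False)" "set bs \<subseteq> ob A (srt True)" "X = (length as, length bs)"
  obtains u where "u \<in> ob A X" "comps S A False X u = as" "comps S A True X u = bs"
  using preserves_products[of as bs] assms by (auto simp: srt_def is_tuple_iff)

context scom_theory
begin

lemma hom_eval:
  assumes "S_algebra S A" "S_algebra S B" "alg_hom S A B h"
    and "set as \<subseteq> ob A (srt False)" "set bs \<subseteq> ob A (srt True)" "f \<in> hom S (length as, length bs) Y"
  shows "h Y (eval S A f as bs) = eval S B f (map (h (srt False)) as) (map (h (srt True)) bs)"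
proof -
  interpret A: theory_algebra S A
    using assms lawvere_theory_axioms by (simp add: theory_algebra_def)
  interpret B: theory_algebra S B
    using assms lawvere_theory_axioms by (simp add: theory_algebra_def)
  let ?X = "(length as, length bs)"
  obtain u where u: "u \<in> ob A ?X" "comps S A False ?X u = as" "comps S A True ?X u = bs"
    using A.tuple_of_lists[OF assms(4,5)] by blast
  have h: "h ?X u \<in> ob B ?X"
    using alg_homD(1)[OF assms(3) u(1)] .
  have "comps S B p ?X (h ?X u) = map (h (srt p)) (comps S A p ?X u)" for p
    using alg_homD(2)[OF assms(3) _ u(1), of _ "srt p"] by (simp add: comps_def hom_def)
  then have "eval S B f (map (h (srt False)) as) (map (h (srt True)) bs) = act B f (h ?X u)"
    using B.eval_comps[OF h] u by metis
  moreover have "eval S A f as bs = act A f u"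
    using A.eval_comps[OF u(1)] u by simp
  ultimately show ?thesis
    using alg_homD(2)[OF assms(3,6) u(1)] by simp
qed

lemma hom_scom_eval:
  assumes "S_algebra S A" "S_algebra S B" "alg_hom S A B h" "wt (length as, length bs) p s"
    and "set as \<subseteq> ob A (srt False)" "set bs \<subseteq> ob A (srt True)"
  shows "h (srt p) (eval S A (scom S (term_arrow (length as, length bs) p s)) as bs) =
    eval S B (scom S (term_arrow (length as, length bs) p s)) (map (h (srt False)) as) (map (h (srt True)) bs)"
  by (rule hom_eval) (use assms in \<open>simp_all add: hom_def\<close>)

lemma
  assumes "S_algebra S A" "S_algebra S B" "alg_hom S A B h"
  shows hom_szero: "h (srt p) (szero S A p) = szero S B p"
    and hom_sadd: "a \<in> ob A (srt p) \<Longrightarrow> b \<in> ob A (srt p) \<Longrightarrow>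
      h (srt p) (sadd S A p a b) = sadd S B p (h (srt p) a) (h (srt p) b)"
    and hom_ssub: "a \<in> ob A (srt p) \<Longrightarrow> b \<in> ob A (srt p) \<Longrightarrow>
      h (srt p) (ssub S A p a b) = ssub S B p (h (srt p) a) (h (srt p) b)"
    and hom_smul: "a \<in> ob A (srt p) \<Longrightarrow> c \<in> ob A (srt q) \<Longrightarrow> r = psum p q \<Longrightarrow>
      h (srt r) (smul S A p q a c) = smul S B p q (h (srt p) a) (h (srt q) c)"
proof -
  note e = hom_scom_eval[OF assms]
  have w: "wt (0, Suc (Suc 0)) False (Mul (OV 0) (OV (Suc 0)))" "wt (Suc 0, Suc 0) True (Mul (OV 0) (EV 0))"
    "wt (Suc 0, Suc 0) True (Mul (EV 0) (OV 0))" "wt (Suc (Suc 0), 0) False (Mul (EV 0) (EV (Suc 0)))"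
    using wt.intros(8)[of "(0, 2)" True "OV 0" True "OV 1"] wt.intros(8)[of "(1, 1)" True "OV 0" False "EV 0"]
      wt.intros(8)[of "(1, 1)" False "EV 0" True "OV 0"] wt.intros(8)[of "(2, 0)" False "EV 0" False "EV 1"]
    by (simp_all add: wt.intros(1-7) numeral_2_eq_2)
  show "h (srt p) (szero S A p) = szero S B p"
    using e[of "[]" "[]" p "Zero p"] by (simp add: szero_def wt.intros(1-7))
  show "h (srt p) (sadd S A p a b) = sadd S B p (h (srt p) a) (h (srt p) b)"
    if "a \<in> ob A (srt p)" "b \<in> ob A (srt p)"
    using e[of "[]" "[a, b]" True "Add (OV 0) (OV 1)"] e[of "[a, b]" "[]" False "Add (EV 0) (EV 1)"] that
    by (cases p) (simp_all add: sadd_def wt.intros(1-7) numeral_2_eq_2)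
  show "h (srt p) (ssub S A p a b) = ssub S B p (h (srt p) a) (h (srt p) b)"
    if "a \<in> ob A (srt p)" "b \<in> ob A (srt p)"
    using e[of "[]" "[a, b]" True "Add (OV 0) (Neg (OV 1))"]
      e[of "[a, b]" "[]" False "Add (EV 0) (Neg (EV 1))"] that
    by (cases p) (simp_all add: ssub_def wt.intros(1-7) numeral_2_eq_2)
  show "h (srt r) (smul S A p q a c) = smul S B p q (h (srt p) a) (h (srt q) c)"
    if "a \<in> ob A (srt p)" "c \<in> ob A (srt q)" "r = psum p q"
    using w e[of "[]" "[a, c]" False "Mul (OV 0) (OV 1)"] e[of "[c]" "[a]" True "Mul (OV 0) (EV 0)"]
      e[of "[a]" "[c]" True "Mul (EV 0) (OV 0)"] e[of "[a, c]" "[]" False "Mul (EV 0) (EV 1)"] that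
    by (cases p; cases q) (simp_all add: smul_def numeral_2_eq_2)
qed

end

section \<open>Difference quotients and derivatives\<close>

lemma (in theory_algebra) alg_hom_act: "u \<in> ob A Q' \<Longrightarrow> alg_hom S (Free S Q') A (\<lambda>X f. act A f u)"
  unfolding alg_hom_def by (simp add: hom_def)

lemma evars_eq: "evars S X = map (gen S False X) [0..<cnt False X]"
  and ovars_eq: "ovars S X = map (gen S True X) [0..<cnt True X]"
  by (simp_all add: evars_def ovars_def gen_def cnt_def)

context lawvere_theory
begin

lemma fork_pr_cmp [simp]:
  "k \<in> arr S \<Longrightarrow> tgt S k = X + Y \<Longrightarrow> fork (cmp S (pr1 X Y) k) (cmp S (pr2 X Y) k) = k"
  by (rule fork_eqI[where X = X and Y = Y]) auto

lemma eval_Free: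
  assumes "u \<in> arr S" "src S u = R" "tgt S u = X" "xs = comps S (Free S R) False X u"
    "ys = comps S (Free S R) True X u"
  shows "eval S (Free S R) f xs ys = cmp S f u"
  using theory_algebra.eval_comps[OF theory_algebra_Free, of u R X f] assms by (simp add: hom_def)

text \<open>
  A function \<open>f(z, x)\<close> whose last variable \<open>x\<close> has parity \<open>p\<close> becomes \<open>f(z, y)\<close> by composition with
  \<open>replace\<close>, where \<open>y\<close> is a new variable added after \<open>x\<close>, and \<open>f(z, x)\<close> by composition with a projection.
\<close>

definition replace :: "obj \<Rightarrow> bool \<Rightarrow> 'f" where
  "replace X p = fork (cmp S (pr1 X (srt p)) (pr1 (X + srt p) (srt p))) (pr2 (X + srt p) (srt p))"

lemma arr_replace [simp]:
  "replace X p \<in> arr S" "src S (replace X p) = X + srt p + srt p" "tgt S (replace X p) = X + srt p"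
  by (simp_all add: replace_def)

lemma comps_pr1:
  "Z = X + Y \<Longrightarrow> comps S (Free S Z) q X (pr1 X Y) = map (gen S q Z) [0..<cnt q X]"
  by (simp add: comps_def gen_pr1)

lemma gen_replace:
  assumes "i < cnt q (X + srt p)"
  shows "cmp S (gen S q (X + srt p) i) (replace X p) =
    gen S q (X + srt p + srt p) (if q = p \<and> i = cnt p X then cnt p X + 1 else i)"
proof (cases "i < cnt q X")
  case True
  then have "cmp S (gen S q (X + srt p) i) (replace X p) =
      cmp S (cmp S (gen S q X i) (pr1 X (srt p))) (replace X p)"
    by (simp add: gen_pr1 del: cmp_cmp)
  also have "\<dots> = cmp S (cmp S (gen S q X i) (pr1 X (srt p))) (pr1 (X + srt p) (srt p))"
    using True by (simp add: replace_def)
  also have "\<dots> = gen S q (X + srt p + srt p) i"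
    using True assms by (simp add: gen_pr1 del: cmp_cmp)
  finally show ?thesis
    using True by auto
next
  case False
  then have i: "q = p" "i = cnt p X"
    using assms by (auto split: if_splits)
  have "cmp S (gen S p (X + srt p) (cnt p X)) (replace X p) = pr2 (X + srt p) (srt p)"
    by (simp add: replace_def flip: pr2_srt)
  then show ?thesis
    using i by (simp add: pr2_srt)
qed

lemma comps_replace:
  "comps S (Free S (X + srt p + srt p)) q (X + srt p) (replace X p) =
    (let l = map (gen S q (X + srt p + srt p)) [0..<cnt q (X + srt p)] in
      if q = p then l[cnt p X := gen S p (X + srt p + srt p) (cnt p X + 1)] else l)"
  by (rule nth_equalityI) (auto simp: Let_def gen_replace nth_list_update simp del: upt_Suc)

end

sublocale super_fermat_theory \<subseteq> scom_theory S
  by (simp add: scom_theory_def lawvere_theory_axioms theory_morphism_axioms)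

context scom_theory
begin

lemma scom_algebra_Free: "scom_algebra S (Free S R)"
  by (simp add: scom_algebra_def scom_theory_axioms theory_algebra_Free)

abbreviation zero :: "obj \<Rightarrow> bool \<Rightarrow> 'f" where
  "zero X p \<equiv> szero S (Free S X) p"

lemma arr_zero [simp]: "zero X p \<in> arr S" "src S (zero X p) = X" "tgt S (zero X p) = srt p"
  using scom_algebra.szero_in_ob[OF scom_algebra_Free, of X p] by (simp_all add: hom_def)

lemma (in scom_algebra) act_zero [simp]: "u \<in> ob A X \<Longrightarrow> act A (zero X p) u = szero S A p"
  using hom_szero[OF S_algebra_Free S_algebra_axioms alg_hom_act] .

lemma zero_cmp [simp]: "k \<in> arr S \<Longrightarrow> tgt S k = X \<Longrightarrow> cmp S (zero X p) k = zero (src S k) p"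
  using scom_algebra.act_zero[OF scom_algebra_Free, of k "src S k" X p] by (simp add: hom_def)

text \<open>
  The equation \<open>f(z, x) - f(z, y) = (x - y) h(z, x, y)\<close> in terms of projections, for the last even
  variable.
\<close>

definition is_even_quotient :: "obj \<Rightarrow> bool \<Rightarrow> 'f \<Rightarrow> 'f \<Rightarrow> bool" where
  "is_even_quotient X p f h \<longleftrightarrow> h \<in> arr S \<and> src S h = X + srt False + srt False \<and> tgt S h = srt p \<and>
    (let F = Free S (X + srt False + srt False) in
      ssub S F p (cmp S f (pr1 (X + srt False) (srt False))) (cmp S f (replace X False)) =
      smul S F False p (ssub S F False (cmp S (pr2 X (srt False)) (pr1 (X + srt False) (srt False)))
        (pr2 (X + srt False) (srt False))) h)"

lemma even_quotient_iff:
  "even_quotient S (X + srt False) p (fst X) f h \<longleftrightarrow> is_even_quotient X p f h"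
proof -
  let ?Y = "X + srt False" let ?Z = "?Y + srt False"
  have Z: "(Suc (fst ?Y), snd ?Y) = ?Z" and c: "fst ?Y = Suc (fst X)" "cnt False X = fst X"
    by (simp_all add: srt_def cnt_def prod_eq_iff)
  have c': "fst ?Y = cnt False ?Y" "cnt False ?Y \<le> cnt False ?Z"
    by (simp_all add: cnt_def)
  have x: "take (fst ?Y) (evars S ?Z) = comps S (Free S ?Z) False ?Y (pr1 ?Y (srt False))"
    by (simp add: evars_eq comps_pr1 take_map take_upt c' del: upt_Suc cnt_add fst_add snd_add)
  have \<xi>: "ovars S ?Z = comps S (Free S ?Z) True ?Y (pr1 ?Y (srt False))"
    by (simp add: ovars_eq comps_pr1)
  have nt: "evars S ?Z ! fst ?Y = gen S False ?Z (cnt False X + 1)"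
    unfolding c' by (simp add: evars_eq del: upt_Suc)
  have y: "(take (fst ?Y) (evars S ?Z))[fst X := evars S ?Z ! fst ?Y] =
      comps S (Free S ?Z) False ?Y (replace X False)"
    unfolding x nt comps_replace comps_pr1[OF refl] Let_def by (simp add: c)
  have \<xi>': "ovars S ?Z = comps S (Free S ?Z) True ?Y (replace X False)"
    by (simp add: ovars_eq comps_replace Let_def)
  have v: "evars S ?Z ! fst X = cmp S (pr2 X (srt False)) (pr1 ?Y (srt False))"
    "evars S ?Z ! fst ?Y = pr2 ?Y (srt False)"
    using nt by (simp_all add: evars_eq c pr2_srt gen_pr1 nth_append del: fst_add)
  have e: "eval S (Free S ?Z) f (take (fst ?Y) (evars S ?Z)) (ovars S ?Z) = cmp S f (pr1 ?Y (srt False))"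
    "eval S (Free S ?Z) f ((take (fst ?Y) (evars S ?Z))[fst X := evars S ?Z ! fst ?Y]) (ovars S ?Z) =
      cmp S f (replace X False)"
    by (rule eval_Free[OF _ _ _ x \<xi>] eval_Free[OF _ _ _ y \<xi>']; simp)+
  show ?thesis
    unfolding even_quotient_def is_even_quotient_def Let_def Z e unfolding v by (simp add: hom_def)
qed

text \<open>
  Likewise \<open>f(z, x) - f(z, y) = (x - y) h(z)\<close> for the last odd variable.
\<close>

definition is_odd_quotient :: "obj \<Rightarrow> bool \<Rightarrow> 'f \<Rightarrow> 'f \<Rightarrow> bool" where
  "is_odd_quotient X p f h \<longleftrightarrow> h \<in> arr S \<and> src S h = X \<and> tgt S h = srt (\<not> p) \<and>
    (let F = Free S (X + srt True + srt True) in
      ssub S F p (cmp S f (pr1 (X + srt True) (srt True))) (cmp S f (replace X True)) =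
      smul S F True (\<not> p) (ssub S F True (cmp S (pr2 X (srt True)) (pr1 (X + srt True) (srt True)))
        (pr2 (X + srt True) (srt True)))
        (cmp S h (cmp S (pr1 X (srt True)) (pr1 (X + srt True) (srt True)))))"

lemma odd_quotient_iff:
  "odd_quotient S (X + srt True) p (snd X) f h \<longleftrightarrow> is_odd_quotient X p f h"
proof -
  let ?Y = "X + srt True" let ?Z = "?Y + srt True"
  have Z: "(fst ?Y, Suc (snd ?Y)) = ?Z" "(fst ?Y, snd ?Y - 1) = X"
    and c: "snd ?Y = Suc (snd X)" "cnt True X = snd X"
    by (simp_all add: srt_def cnt_def prod_eq_iff)
  have c': "snd ?Y = cnt True ?Y" "cnt True ?Y \<le> cnt True ?Z"
    by (simp_all add: cnt_def)
  have x: "evars S ?Z = comps S (Free S ?Z) False ?Y (pr1 ?Y (srt True))"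
    by (simp add: evars_eq comps_pr1)
  have \<xi>: "take (snd ?Y) (ovars S ?Z) = comps S (Free S ?Z) True ?Y (pr1 ?Y (srt True))"
    by (simp add: ovars_eq comps_pr1 take_map take_upt c' del: upt_Suc cnt_add fst_add snd_add)
  have nt: "ovars S ?Z ! snd ?Y = gen S True ?Z (cnt True X + 1)"
    unfolding c' by (simp add: ovars_eq del: upt_Suc)
  have y: "(take (snd ?Y) (ovars S ?Z))[snd X := ovars S ?Z ! snd ?Y] =
      comps S (Free S ?Z) True ?Y (replace X True)"
    unfolding \<xi> nt comps_replace comps_pr1[OF refl] Let_def by (simp add: c)
  have x': "evars S ?Z = comps S (Free S ?Z) False ?Y (replace X True)"
    by (simp add: evars_eq comps_replace Let_def)
  have v: "ovars S ?Z ! snd X = cmp S (pr2 X (srt True)) (pr1 ?Y (srt True))"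
    "ovars S ?Z ! snd ?Y = pr2 ?Y (srt True)"
    using nt by (simp_all add: ovars_eq c pr2_srt gen_pr1 nth_append del: snd_add)
  let ?u = "cmp S (pr1 X (srt True)) (pr1 ?Y (srt True))"
  have u: "?u = pr1 X (srt True + srt True)"
    by (rule pr1_pr1)
  have d: "evars S ?Z = comps S (Free S ?Z) False X ?u"
    by (simp add: u evars_eq comps_pr1 add.assoc)
  have d': "drop_nth (snd X) (take (snd ?Y) (ovars S ?Z)) = comps S (Free S ?Z) True X ?u"
    unfolding \<xi> comps_pr1[OF HOL.refl] drop_nth_def
    by (simp add: c(2) u comps_pr1 add.assoc take_map drop_map)
  have e: "eval S (Free S ?Z) f (evars S ?Z) (take (snd ?Y) (ovars S ?Z)) = cmp S f (pr1 ?Y (srt True))"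
    "eval S (Free S ?Z) f (evars S ?Z) ((take (snd ?Y) (ovars S ?Z))[snd X := ovars S ?Z ! snd ?Y]) =
      cmp S f (replace X True)"
    "eval S (Free S ?Z) h (evars S ?Z) (drop_nth (snd X) (take (snd ?Y) (ovars S ?Z))) = cmp S h ?u"
    by (rule eval_Free[OF _ _ _ x \<xi>] eval_Free[OF _ _ _ x' y] eval_Free[OF _ _ _ d d']; simp)+
  show ?thesis
    unfolding odd_quotient_def is_odd_quotient_def Let_def Z e unfolding v by (simp add: hom_def)
qed

lemma is_even_quotientI:
  assumes "f \<in> arr S" "src S f = X + srt False" "tgt S f = srt p"
    and "h \<in> arr S" "src S h = X + srt False + srt False" "tgt S h = srt p"
    and "\<And>R v s t. v \<in> arr S \<Longrightarrow> s \<in> arr S \<Longrightarrow> t \<in> arr S \<Longrightarrow> src S v = R \<Longrightarrow> src S s = R \<Longrightarrow> src S t = R \<Longrightarrow>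
      tgt S v = X \<Longrightarrow> tgt S s = srt False \<Longrightarrow> tgt S t = srt False \<Longrightarrow>
      ssub S (Free S R) p (cmp S f (fork v s)) (cmp S f (fork v t)) =
      smul S (Free S R) False p (ssub S (Free S R) False s t) (cmp S h (fork (fork v s) t))"
  shows "is_even_quotient X p f h"
  using assms(7)[of "cmp S (pr1 X (srt False)) (pr1 (X + srt False) (srt False))"
      "cmp S (pr2 X (srt False)) (pr1 (X + srt False) (srt False))"
      "pr2 (X + srt False) (srt False)"] assms(1-6)
  by (simp add: is_even_quotient_def replace_def)

lemma is_odd_quotientI:
  assumes "f \<in> arr S" "src S f = X + srt True" "tgt S f = srt p"
    and "h \<in> arr S" "src S h = X" "tgt S h = srt (\<not> p)"
    and "\<And>R v s t. v \<in> arr S \<Longrightarrow> s \<in> arr S \<Longrightarrow> t \<in> arr S \<Longrightarrow> src S v = R \<Longrightarrow> src S s = R \<Longrightarrow> src S t = R \<Longrightarrow>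
      tgt S v = X \<Longrightarrow> tgt S s = srt True \<Longrightarrow> tgt S t = srt True \<Longrightarrow>
      ssub S (Free S R) p (cmp S f (fork v s)) (cmp S f (fork v t)) =
      smul S (Free S R) True (\<not> p) (ssub S (Free S R) True s t) (cmp S h v)"
  shows "is_odd_quotient X p f h"
  using assms(7)[of "cmp S (pr1 X (srt True)) (pr1 (X + srt True) (srt True))"
      "cmp S (pr2 X (srt True)) (pr1 (X + srt True) (srt True))"
      "pr2 (X + srt True) (srt True)"] assms(1-6)
  by (simp add: is_odd_quotient_def replace_def)

end

context scom_algebra
begin

text \<open>
  Evaluation at a tuple is a map of algebras from a free algebra, so the equation holds at all
  elements of an algebra.
\<close>

lemma even_quotient_value:
  assumes "is_even_quotient X p f h" "f \<in> arr S" "src S f = X + srt False" "tgt S f = srt p"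
    and "v \<in> ob A X" "s \<in> ob A (srt False)" "t \<in> ob A (srt False)"
  shows "ssub S A p (act A f (pair A X (srt False) v s)) (act A f (pair A X (srt False) v t)) =
    smul S A False p (ssub S A False s t)
      (act A h (pair A (X + srt False) (srt False) (pair A X (srt False) v s) t))"
proof -
  let ?Z = "X + srt False + srt False"
  let ?u = "pair A (X + srt False) (srt False) (pair A X (srt False) v s) t"
  have u: "?u \<in> ob A ?Z" using assms by simp
  interpret F: scom_algebra S "Free S ?Z" by (rule scom_algebra_Free)
  note hom = S_algebra_Free S_algebra_axioms alg_hom_act[OF u]
  have h: "h \<in> arr S" "src S h = ?Z" "tgt S h = srt p"
    using assms(1) by (simp_all add: is_even_quotient_def)
  let ?a = "cmp S f (pr1 (X + srt False) (srt False))" and ?b = "cmp S f (replace X False)"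
    and ?c = "cmp S (pr2 X (srt False)) (pr1 (X + srt False) (srt False))"
    and ?d = "pr2 (X + srt False) (srt False)"
  have in_F: "?a \<in> ob (Free S ?Z) (srt p)" "?b \<in> ob (Free S ?Z) (srt p)"
    "?c \<in> ob (Free S ?Z) (srt False)" "?d \<in> ob (Free S ?Z) (srt False)" "h \<in> ob (Free S ?Z) (srt p)"
    using assms h by (simp_all add: hom_def)
  have "ssub S A p (act A ?a ?u) (act A ?b ?u) =
      smul S A False p (ssub S A False (act A ?c ?u) (act A ?d ?u)) (act A h ?u)"
    using hom_ssub[OF hom in_F(1,2)] hom_ssub[OF hom in_F(3,4)]
      hom_smul[OF hom F.ssub_in_ob[OF in_F(3,4)] in_F(5), of p] assms(1)
    unfolding is_even_quotient_def Let_def by simp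
  then show ?thesis
    using assms u by (simp add: replace_def)
qed

lemma odd_quotient_value:
  assumes "is_odd_quotient X p f h" "f \<in> arr S" "src S f = X + srt True" "tgt S f = srt p"
    and "v \<in> ob A X" "s \<in> ob A (srt True)" "t \<in> ob A (srt True)"
  shows "ssub S A p (act A f (pair A X (srt True) v s)) (act A f (pair A X (srt True) v t)) =
    smul S A True (\<not> p) (ssub S A True s t) (act A h v)"
proof -
  let ?Z = "X + srt True + srt True"
  let ?u = "pair A (X + srt True) (srt True) (pair A X (srt True) v s) t"
  have u: "?u \<in> ob A ?Z" using assms by simp
  interpret F: scom_algebra S "Free S ?Z" by (rule scom_algebra_Free)
  note hom = S_algebra_Free S_algebra_axioms alg_hom_act[OF u]
  have h: "h \<in> arr S" "src S h = X" "tgt S h = srt (\<not> p)"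
    using assms(1) by (simp_all add: is_odd_quotient_def)
  let ?a = "cmp S f (pr1 (X + srt True) (srt True))" and ?b = "cmp S f (replace X True)"
    and ?c = "cmp S (pr2 X (srt True)) (pr1 (X + srt True) (srt True))"
    and ?d = "pr2 (X + srt True) (srt True)"
    and ?e = "cmp S h (cmp S (pr1 X (srt True)) (pr1 (X + srt True) (srt True)))"
  have in_F: "?a \<in> ob (Free S ?Z) (srt p)" "?b \<in> ob (Free S ?Z) (srt p)"
    "?c \<in> ob (Free S ?Z) (srt True)" "?d \<in> ob (Free S ?Z) (srt True)" "?e \<in> ob (Free S ?Z) (srt (\<not> p))"
    using assms h by (simp_all add: hom_def)
  have "ssub S A p (act A ?a ?u) (act A ?b ?u) =
      smul S A True (\<not> p) (ssub S A True (act A ?c ?u) (act A ?d ?u)) (act A ?e ?u)"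
    using hom_ssub[OF hom in_F(1,2)] hom_ssub[OF hom in_F(3,4)]
      hom_smul[OF hom F.ssub_in_ob[OF in_F(3,4)] in_F(5), of p] assms(1)
    unfolding is_odd_quotient_def Let_def by simp
  then show ?thesis
    using assms u h by (simp add: replace_def)
qed

end

context scom_theory
begin

text \<open>
  A substitution for the remaining variables \<open>z\<close> commutes with the formation of difference quotients,
  and by their uniqueness also with the derivatives.
\<close>

lemma even_quotient_natural:
  assumes "is_even_quotient Y p f h" "f \<in> arr S" "src S f = Y + srt False" "tgt S f = srt p"
    and "\<phi> \<in> arr S" "src S \<phi> = X" "tgt S \<phi> = Y"
  shows "is_even_quotient X p (cmp S f (base_change (srt False) \<phi>))
    (cmp S h (base_change (srt False) (base_change (srt False) \<phi>)))"
proof (rule is_even_quotientI)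
  have h: "h \<in> arr S" "src S h = Y + srt False + srt False" "tgt S h = srt p"
    using assms(1) by (simp_all add: is_even_quotient_def)
  fix R v s t
  assume v: "v \<in> arr S" "s \<in> arr S" "t \<in> arr S" "src S v = R" "src S s = R" "src S t = R"
    "tgt S v = X" "tgt S s = srt False" "tgt S t = srt False"
  show "ssub S (Free S R) p (cmp S (cmp S f (base_change (srt False) \<phi>)) (fork v s))
      (cmp S (cmp S f (base_change (srt False) \<phi>)) (fork v t)) =
    smul S (Free S R) False p (ssub S (Free S R) False s t)
      (cmp S (cmp S h (base_change (srt False) (base_change (srt False) \<phi>))) (fork (fork v s) t))"
    using scom_algebra.even_quotient_value[OF scom_algebra_Free assms(1-4), of "cmp S \<phi> v" R s t]
      v h assms by (simp add: hom_def base_change_def)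
qed (use assms in \<open>auto simp: is_even_quotient_def\<close>)

lemma odd_quotient_natural:
  assumes "is_odd_quotient Y p f h" "f \<in> arr S" "src S f = Y + srt True" "tgt S f = srt p"
    and "\<phi> \<in> arr S" "src S \<phi> = X" "tgt S \<phi> = Y"
  shows "is_odd_quotient X p (cmp S f (base_change (srt True) \<phi>)) (cmp S h \<phi>)"
proof (rule is_odd_quotientI)
  have h: "h \<in> arr S" "src S h = Y" "tgt S h = srt (\<not> p)"
    using assms(1) by (simp_all add: is_odd_quotient_def)
  fix R v s t
  assume v: "v \<in> arr S" "s \<in> arr S" "t \<in> arr S" "src S v = R" "src S s = R" "src S t = R"
    "tgt S v = X" "tgt S s = srt True" "tgt S t = srt True"
  show "ssub S (Free S R) p (cmp S (cmp S f (base_change (srt True) \<phi>)) (fork v s))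
      (cmp S (cmp S f (base_change (srt True) \<phi>)) (fork v t)) =
    smul S (Free S R) True (\<not> p) (ssub S (Free S R) True s t) (cmp S (cmp S h \<phi>) v)"
    using scom_algebra.odd_quotient_value[OF scom_algebra_Free assms(1-4), of "cmp S \<phi> v" R s t]
      v h assms by (simp add: hom_def base_change_def)
qed (use assms in \<open>auto simp: is_odd_quotient_def\<close>)

text \<open>
  The product \<open>\<theta> f(z)\<close>, where \<open>\<theta>\<close> is a new odd variable. Its difference quotient is \<open>f\<close>, because
  \<open>\<theta> f(z) - \<eta> f(z) = (\<theta> - \<eta>) f(z)\<close>.
\<close>

definition theta_times :: "obj \<Rightarrow> bool \<Rightarrow> 'f \<Rightarrow> 'f" where
  "theta_times X q f = smul S (Free S (X + srt True)) True q (pr2 X (srt True)) (cmp S f (pr1 X (srt True)))"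

lemma arr_theta_times [simp]:
  assumes "f \<in> arr S" "src S f = X" "tgt S f = srt q"
  shows "theta_times X q f \<in> arr S" "src S (theta_times X q f) = X + srt True"
    "tgt S (theta_times X q f) = srt (\<not> q)"
proof -
  have "theta_times X q f \<in> ob (Free S (X + srt True)) (srt (\<not> q))"
    unfolding theta_times_def
    by (rule scom_algebra.smul_in_ob[OF scom_algebra_Free]) (use assms in \<open>auto simp: hom_def\<close>)
  then show "theta_times X q f \<in> arr S" "src S (theta_times X q f) = X + srt True"
    "tgt S (theta_times X q f) = srt (\<not> q)"
    by (auto simp: hom_def)
qed

end

lemma (in scom_algebra) act_theta_times:
  assumes "f \<in> arr S" "src S f = X" "tgt S f = srt q" "v \<in> ob A X" "s \<in> ob A (srt True)"
  shows "act A (theta_times X q f) (pair A X (srt True) v s) = smul S A True q s (act A f v)"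
proof -
  have u: "pair A X (srt True) v s \<in> ob A (X + srt True)"
    using assms by simp
  show ?thesis
    unfolding theta_times_def
    using hom_smul[OF S_algebra_Free S_algebra_axioms alg_hom_act[OF u],
        of "pr2 X (srt True)" True "cmp S f (pr1 X (srt True))" q "\<not> q"] assms
    by (simp add: hom_def)
qed

context scom_theory
begin

lemma odd_quotient_theta_times:
  assumes "f \<in> arr S" "src S f = X" "tgt S f = srt q"
  shows "is_odd_quotient X (\<not> q) (theta_times X q f) f"
proof (rule is_odd_quotientI)
  fix R v s t
  assume v: "v \<in> arr S" "s \<in> arr S" "t \<in> arr S" "src S v = R" "src S s = R" "src S t = R"
    "tgt S v = X" "tgt S s = srt True" "tgt S t = srt True"
  interpret F: scom_algebra S "Free S R" by (rule scom_algebra_Free)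
  show "ssub S (Free S R) (\<not> q) (cmp S (theta_times X q f) (fork v s)) (cmp S (theta_times X q f) (fork v t)) =
      smul S (Free S R) True (\<not> \<not> q) (ssub S (Free S R) True s t) (cmp S f v)"
    using F.act_theta_times[OF assms, of v s] F.act_theta_times[OF assms, of v t]
      F.ssub_smul[of s True t "cmp S f v" q] v assms by (simp add: hom_def)
qed (use assms in auto)

end

context super_fermat_theory
begin

lemma ex1_even_quotient:
  assumes "f \<in> arr S" "src S f = X + srt False" "tgt S f = srt p"
  shows "\<exists>!h. is_even_quotient X p f h"
proof -
  have "fst X < fst (X + srt False)"
    by (simp add: srt_def)
  moreover have "f \<in> hom S (X + srt False) (srt p)"
    using assms by (simp add: hom_def)
  ultimately show ?thesis
    using fermat_even[of f "fst (X + srt False)" "snd (X + srt False)" p "fst X"]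
    unfolding prod.collapse even_quotient_iff by blast
qed

lemma ex1_odd_quotient:
  assumes "f \<in> arr S" "src S f = X + srt True" "tgt S f = srt p"
  shows "\<exists>!h. is_odd_quotient X p f h"
proof -
  have "snd X < snd (X + srt True)"
    by (simp add: srt_def)
  moreover have "f \<in> hom S (X + srt True) (srt p)"
    using assms by (simp add: hom_def)
  ultimately show ?thesis
    using fermat_odd[of f "fst (X + srt True)" "snd (X + srt True)" p "snd X"]
    unfolding prod.collapse odd_quotient_iff by blast
qed

text \<open>
  The derivatives with respect to the last variable of either parity. The odd one is taken as an
  arrow in the remaining variables only.
\<close>

definition even_deriv :: "obj \<Rightarrow> bool \<Rightarrow> 'f \<Rightarrow> 'f" where
  "even_deriv X p f = pdE S (X + srt False) p (fst X) f"

definition odd_deriv :: "obj \<Rightarrow> bool \<Rightarrow> 'f \<Rightarrow> 'f" where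
  "odd_deriv X p f = (THE h. is_odd_quotient X p f h)"

lemma odd_deriv_eq:
  assumes "f \<in> arr S" "src S f = X + srt True" "tgt S f = srt p" "is_odd_quotient X p f h"
  shows "odd_deriv X p f = h"
  unfolding odd_deriv_def using ex1_odd_quotient[OF assms(1-3)] assms(4) by (rule the1_equality)

lemma odd_deriv_quotient:
  assumes "f \<in> arr S" "src S f = X + srt True" "tgt S f = srt p"
  shows "is_odd_quotient X p f (odd_deriv X p f)"
  unfolding odd_deriv_def using ex1_odd_quotient[OF assms] by (rule theI')

lemma arr_odd_deriv [simp]:
  assumes "f \<in> arr S" "src S f = X + srt True" "tgt S f = srt p"
  shows "odd_deriv X p f \<in> arr S" "src S (odd_deriv X p f) = X" "tgt S (odd_deriv X p f) = srt (\<not> p)"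
  using odd_deriv_quotient[OF assms] by (simp_all add: is_odd_quotient_def)

lemma odd_deriv_natural:
  assumes "f \<in> arr S" "src S f = Y + srt True" "tgt S f = srt p"
    and "\<phi> \<in> arr S" "src S \<phi> = X" "tgt S \<phi> = Y"
  shows "odd_deriv X p (cmp S f (base_change (srt True) \<phi>)) = cmp S (odd_deriv Y p f) \<phi>"
  by (rule odd_deriv_eq) (use odd_quotient_natural[OF odd_deriv_quotient[OF assms(1-3)] assms] assms in auto)

lemma odd_deriv_theta_times:
  assumes "f \<in> arr S" "src S f = X" "tgt S f = srt q"
  shows "odd_deriv X (\<not> q) (theta_times X q f) = f"
  by (rule odd_deriv_eq) (use odd_quotient_theta_times[OF assms] assms in auto)

lemma even_deriv_eq:
  assumes "f \<in> arr S" "src S f = X + srt False" "tgt S f = srt p" "is_even_quotient X p f h"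
  shows "even_deriv X p f = cmp S h (fork (idt S (X + srt False)) (pr2 X (srt False)))"
proof -
  let ?Y = "X + srt False"
  let ?u = "fork (idt S ?Y) (pr2 X (srt False))"
  have "(THE h. is_even_quotient X p f h) = h"
    using ex1_even_quotient[OF assms(1-3)] assms(4) by (rule the1_equality)
  moreover have "cmp S (gen S q (?Y + srt False) i) ?u = gen S q ?Y (if i < cnt q ?Y then i else cnt q X)"
    if i: "i < cnt q (?Y + srt False)" for q i
  proof (cases "i < cnt q ?Y")
    case True
    then have "gen S q (?Y + srt False) i = cmp S (gen S q ?Y i) (pr1 ?Y (srt False))"
      by (simp only: gen_pr1)
    then show ?thesis
      using True by simp
  next
    case False
    then have q: "q = False" "i = cnt q ?Y"
      using i by (auto split: if_splits)
    then have "gen S q (?Y + srt False) i = pr2 ?Y (srt False)"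
      using pr2_srt[of ?Y False] by simp
    then have "cmp S (gen S q (?Y + srt False) i) ?u = pr2 X (srt False)"
      by simp
    also have "\<dots> = gen S q ?Y (cnt q X)"
      using q by (simp add: pr2_srt)
    finally show ?thesis
      using False by simp
  qed
  then have "evars S ?Y @ [evars S ?Y ! fst X] = comps S (Free S ?Y) False (?Y + srt False) ?u"
    "ovars S ?Y = comps S (Free S ?Y) True (?Y + srt False) ?u"
    by (auto simp: evars_eq ovars_eq list_eq_iff_nth_eq nth_append cnt_def srt_def less_Suc_eq)
  from eval_Free[OF _ _ _ this, of h] have
    "eval S (Free S ?Y) h (evars S ?Y @ [evars S ?Y ! fst X]) (ovars S ?Y) = cmp S h ?u"
    by simp
  ultimately show ?thesis
    by (simp add: even_deriv_def pdE_def even_quotient_iff)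
qed

lemma arr_even_deriv [simp]:
  assumes "f \<in> arr S" "src S f = X + srt False" "tgt S f = srt p"
  shows "even_deriv X p f \<in> arr S" "src S (even_deriv X p f) = X + srt False" "tgt S (even_deriv X p f) = srt p"
proof -
  obtain h where h: "is_even_quotient X p f h"
    using ex1_even_quotient[OF assms] by blast
  then have "h \<in> arr S" "src S h = X + srt False + srt False" "tgt S h = srt p"
    by (simp_all add: is_even_quotient_def)
  then show "even_deriv X p f \<in> arr S" "src S (even_deriv X p f) = X + srt False" "tgt S (even_deriv X p f) = srt p"
    by (simp_all add: even_deriv_eq[OF assms h])
qed

lemma even_deriv_natural:
  assumes "f \<in> arr S" "src S f = Y + srt False" "tgt S f = srt p"
    and "\<phi> \<in> arr S" "src S \<phi> = X" "tgt S \<phi> = Y"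
  shows "even_deriv X p (cmp S f (base_change (srt False) \<phi>)) = cmp S (even_deriv Y p f) (base_change (srt False) \<phi>)"
proof -
  obtain h where h: "is_even_quotient Y p f h"
    using ex1_even_quotient[OF assms(1-3)] by blast
  then have "h \<in> arr S" "src S h = Y + srt False + srt False" "tgt S h = srt p"
    by (simp_all add: is_even_quotient_def)
  then show ?thesis
    using even_deriv_eq[OF _ _ _ even_quotient_natural[OF h assms]] even_deriv_eq[OF assms(1-3) h] assms
    by (simp add: base_change_def)
qed

lemma even_deriv_zero: "even_deriv X p (zero (X + srt False) p) = zero (X + srt False) p"
proof -
  have "is_even_quotient X p (zero (X + srt False) p) (zero (X + srt False + srt False) p)"
  proof (rule is_even_quotientI)
    fix R v s t
    assume v: "v \<in> arr S" "s \<in> arr S" "t \<in> arr S" "src S v = R" "src S s = R" "src S t = R"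
      "tgt S v = X" "tgt S s = srt False" "tgt S t = srt False"
    interpret F: scom_algebra S "Free S R" by (rule scom_algebra_Free)
    show "ssub S (Free S R) p (cmp S (zero (X + srt False) p) (fork v s))
        (cmp S (zero (X + srt False) p) (fork v t)) =
      smul S (Free S R) False p (ssub S (Free S R) False s t)
        (cmp S (zero (X + srt False + srt False) p) (fork (fork v s) t))"
      using v F.ssub_self[OF F.szero_in_ob, of p] F.smul_zero[OF F.ssub_in_ob[of s False t], of p p]
      by (simp add: hom_def)
  qed simp_all
  then show ?thesis
    by (simp add: even_deriv_eq)
qed

lemma integral_ex:
  assumes "admits_integration S" "f \<in> arr S" "src S f = X + srt False" "tgt S f = srt p"
  shows "\<exists>F. F \<in> arr S \<and> src S F = X + srt False \<and> tgt S F = srt p \<and> even_deriv X p F = f"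
proof -
  have X: "(Suc (fst X), snd X) = X + srt False"
    by (simp add: srt_def prod_eq_iff)
  have "f \<in> hom S (X + srt False) (srt p)"
    using assms by (simp add: hom_def)
  then have "\<exists>F \<in> hom S (X + srt False) (srt p). pdE S (X + srt False) p (fst X) F = f"
    using assms(1)[unfolded admits_integration_def, THEN spec[of _ "fst X"], THEN spec[of _ "snd X"],
        THEN spec[of _ p], unfolded X] by blast
  then show ?thesis
    by (auto simp: even_deriv_def hom_def)
qed

lemma integral_unique:
  assumes "admits_integration S" "F \<in> arr S" "src S F = X + srt False" "tgt S F = srt p"
    "G \<in> arr S" "src S G = X + srt False" "tgt S G = srt p" "even_deriv X p F = even_deriv X p G"
  shows "\<exists>c. c \<in> arr S \<and> src S c = X \<and> tgt S c = srt p \<and>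
    ssub S (Free S (X + srt False)) p F G = cmp S c (pr1 X (srt False))"
proof -
  let ?Y = "X + srt False"
  have X: "(Suc (fst X), snd X) = ?Y"
    by (simp add: srt_def prod_eq_iff)
  have "even_deriv X p F \<in> hom S ?Y (srt p)" and FG: "F \<in> hom S ?Y (srt p)" "G \<in> hom S ?Y (srt p)"
    "pdE S ?Y p (fst X) F = even_deriv X p F" "pdE S ?Y p (fst X) G = even_deriv X p F"
    using assms by (auto simp: hom_def simp flip: even_deriv_def)
  note * = assms(1)[unfolded admits_integration_def, THEN spec[of _ "fst X"], THEN spec[of _ "snd X"],
        THEN spec[of _ p], unfolded X, THEN bspec, OF this(1), THEN conjunct2, THEN bspec, OF FG(1),
        THEN bspec, OF FG(2), THEN mp, OF conjI[OF FG(3,4)]]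
  have "take (fst X) (evars S ?Y) = comps S (Free S ?Y) False X (pr1 X (srt False))"
    "ovars S ?Y = comps S (Free S ?Y) True X (pr1 X (srt False))"
    by (simp_all add: evars_eq ovars_eq comps_pr1 take_map) (simp add: cnt_def)
  from eval_Free[OF _ _ _ this] * show ?thesis
    by (auto simp: hom_def)
qed

end

section \<open>Differential algebras\<close>

lemma Omega_obj: "(1, 1) = srt False + srt True"
  by (simp add: srt_def)

text \<open>
  Adjoining \<open>t\<close> and \<open>\<theta>\<close> at once or one after the other leads to the same substitutions.
\<close>

lemma (in lawvere_theory) base_change_add:
  assumes "\<phi> \<in> arr S"
  shows "base_change (V + W) \<phi> = base_change W (base_change V \<phi>)"
proof -
  let ?X = "src S \<phi>" let ?Y = "tgt S \<phi>"
  have 1: "cmp S (pr1 ?Y V) (pr1 (?Y + V) W) = pr1 ?Y (V + W)"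
    "cmp S (pr2 ?Y V) (pr1 (?Y + V) W) = cmp S (pr1 V W) (pr2 ?Y (V + W))"
    "cmp S (pr1 ?X V) (pr1 (?X + V) W) = pr1 ?X (V + W)"
    "cmp S (pr2 ?X V) (pr1 (?X + V) W) = cmp S (pr1 V W) (pr2 ?X (V + W))"
    "pr2 (?Y + V) W = cmp S (pr2 V W) (pr2 ?Y (V + W))"
    "pr2 (?X + V) W = cmp S (pr2 V W) (pr2 ?X (V + W))"
    by (simp_all add: pr1_pr1 pr2_pr1 pr2_pr2)
  show ?thesis
  proof (rule fork_eqI[where X = ?Y and Y = "V + W"])
    let ?l = "base_change (V + W) \<phi>" and ?r = "base_change W (base_change V \<phi>)"
    have r: "cmp S (pr1 (?Y + V) W) ?r = cmp S (base_change V \<phi>) (pr1 (?X + V) W)"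
      "cmp S (pr2 (?Y + V) W) ?r = pr2 (?X + V) W"
      using assms by simp_all
    have "cmp S (pr1 ?Y (V + W)) ?r = cmp S (cmp S (pr1 ?Y V) (pr1 (?Y + V) W)) ?r"
      by (simp add: pr1_pr1)
    also have "\<dots> = cmp S (pr1 ?Y V) (cmp S (base_change V \<phi>) (pr1 (?X + V) W))"
      using assms r by simp
    also have "\<dots> = cmp S \<phi> (pr1 ?X (V + W))"
      using assms 1 by (simp add: base_change_def)
    finally show "cmp S (pr1 ?Y (V + W)) ?l = cmp S (pr1 ?Y (V + W)) ?r"
      using assms by simp
    have 2: "cmp S (pr2 ?Y (V + W)) ?l = pr2 ?X (V + W)"
      using assms by simp
    have "cmp S (pr2 ?Y (V + W)) ?r = pr2 ?X (V + W)"
    proof (rule fork_eqI[where X = V and Y = W])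
      have "cmp S (pr1 V W) (cmp S (pr2 ?Y (V + W)) ?r) = cmp S (cmp S (pr1 V W) (pr2 ?Y (V + W))) ?r"
        using assms by (simp add: add.assoc)
      also have "\<dots> = cmp S (cmp S (pr2 ?Y V) (pr1 (?Y + V) W)) ?r"
        by (simp add: pr2_pr1)
      also have "\<dots> = cmp S (pr2 ?Y V) (cmp S (base_change V \<phi>) (pr1 (?X + V) W))"
        using assms r by simp
      also have "\<dots> = cmp S (pr1 V W) (pr2 ?X (V + W))"
        using assms 1 by (simp add: base_change_def)
      finally show "cmp S (pr1 V W) (cmp S (pr2 ?Y (V + W)) ?r) = cmp S (pr1 V W) (pr2 ?X (V + W))" .
      have "cmp S (pr2 V W) (cmp S (pr2 ?Y (V + W)) ?r) = cmp S (cmp S (pr2 V W) (pr2 ?Y (V + W))) ?r"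
        using assms by (simp add: add.assoc)
      also have "\<dots> = cmp S (pr2 (?Y + V) W) ?r"
        by (simp add: pr2_pr2)
      finally show "cmp S (pr2 V W) (cmp S (pr2 ?Y (V + W)) ?r) = cmp S (pr2 V W) (pr2 ?X (V + W))"
        using r by (simp add: pr2_pr2)
    qed (use assms in \<open>auto simp: add.assoc\<close>)
    then show "cmp S (pr2 ?Y (V + W)) ?l = cmp S (pr2 ?Y (V + W)) ?r"
      using 2 by simp
  qed (use assms in \<open>auto simp: add.assoc\<close>)
qed

lemma (in scom_theory) hom_ssum:
  assumes "S_algebra S A" "S_algebra S B" "alg_hom S A B h" "set xs \<subseteq> ob A (srt p)"
  shows "h (srt p) (ssum S A p xs) = ssum S B p (map (h (srt p)) xs)"
proof -
  interpret A: scom_algebra S A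
    using assms(1) by (simp add: scom_algebra_def scom_theory_axioms theory_algebra_def lawvere_theory_axioms)
  have "foldr (sadd S A p) xs (szero S A p) \<in> ob A (srt p) \<and>
      h (srt p) (foldr (sadd S A p) xs (szero S A p)) =
      foldr (sadd S B p) (map (h (srt p)) xs) (szero S B p)"
    using assms(4)
    by (induction xs) (auto simp: hom_szero[OF assms(1-3)] hom_sadd[OF assms(1-3)])
  then show ?thesis
    by (simp add: ssum_def)
qed

context scom_algebra
begin

lemma ssum_in_ob [simp]: "set xs \<subseteq> ob A (srt p) \<Longrightarrow> ssum S A p xs \<in> ob A (srt p)"
  unfolding ssum_def by (induction xs) auto

lemma ssum_snoc:
  assumes "set xs \<subseteq> ob A (srt p)" "y \<in> ob A (srt p)"
  shows "ssum S A p (xs @ [y]) = sadd S A p (ssum S A p xs) y"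
  using assms(1)
proof (induction xs)
  case Nil
  then show ?case using assms(2) by (simp add: ssum_def)
next
  case (Cons x xs)
  then have "ssum S A p (xs @ [y]) = sadd S A p (ssum S A p xs) y" "ssum S A p xs \<in> ob A (srt p)"
    by auto
  then show ?case
    using Cons.prems assms(2) sadd_assoc[of x p "ssum S A p xs" y] by (simp add: ssum_def)
qed

end

locale super_diff_algebra = super_fermat_theory S + diff_algebra S A d
  for S :: "('f, 'z) super_theory_scheme" and A :: "('f, 'a) alg" and d
begin

sublocale scom_algebra S A
  by (simp add: scom_algebra_def scom_theory_axioms theory_algebra_def lawvere_theory_axioms S_algebra_axioms)

lemma d_in_ob [simp]: "a \<in> ob A (srt p) \<Longrightarrow> q = (\<not> p) \<Longrightarrow> d p a \<in> ob A (srt q)"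
  using d_parity by simp

lemma d_zero [simp]: "d p (szero S A p) = szero S A (\<not> p)"
  using d_add[of "szero S A p" p "szero S A p"] by (intro sadd_self_zero) simp_all

end

lemma (in super_fermat_theory) d_formula:
  assumes "super_diff_algebra S A d" "u \<in> ob A X" "f \<in> arr S" "src S f = X" "tgt S f = srt p"
  shows "d p (act A f u) = sadd S A (\<not> p)
      (ssum S A (\<not> p) (map (\<lambda>i. smul S A True p (d False (act A (gen S False X i) u))
        (act A (pdE S X p i f) u)) [0..<cnt False X]))
      (ssum S A (\<not> p) (map (\<lambda>i. smul S A False (\<not> p) (d True (act A (gen S True X i) u))
        (act A (pdO S X p i f) u)) [0..<cnt True X]))"
proof -
  interpret super_diff_algebra S A d by fact
  have "d p (act A f u) = sadd S A (\<not> p)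
      (ssum S A (\<not> p) (map (\<lambda>i. smul S A True p (d False (comps S A False X u ! i))
        (act A (pdE S X p i f) u)) [0..<cnt False X]))
      (ssum S A (\<not> p) (map (\<lambda>i. smul S A False (\<not> p) (d True (comps S A True X u ! i))
        (act A (pdO S X p i f) u)) [0..<cnt True X]))"
    using d_derivation[of "comps S A False X u" "comps S A True X u" X f p] assms(3-5)
      comps_in_ob[OF assms(2)] eval_comps[OF assms(2)]
    by (simp add: hom_def cnt_def)
  moreover have "map (\<lambda>i. smul S A q r (d s (comps S A s X u ! i)) (act A (k i) u)) [0..<cnt s X] =
      map (\<lambda>i. smul S A q r (d s (act A (gen S s X i) u)) (act A (k i) u)) [0..<cnt s X]" for q r s k
    by (rule map_cong) simp_all
  ultimately show ?thesis by simp
qed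

lemma (in theory_algebra) eval_in_ob:
  assumes "set as \<subseteq> ob A (srt False)" "set bs \<subseteq> ob A (srt True)" "f \<in> hom S (length as, length bs) Y"
  shows "eval S A f as bs \<in> ob A Y"
proof -
  obtain u where u: "u \<in> ob A (length as, length bs)" "comps S A False (length as, length bs) u = as"
      "comps S A True (length as, length bs) u = bs"
    by (rule tuple_of_lists[OF assms(1,2) HOL.refl]) (rule that)
  then have "eval S A f as bs = act A f u"
    using eval_comps[OF u(1), of f] by simp
  then show ?thesis
    using act[OF assms(3) u(1)] by simp
qed

context super_fermat_theory
begin

lemma pdE_typed:
  assumes "f \<in> arr S" "src S f = X" "tgt S f = srt p" "i < cnt False X"
  shows "pdE S X p i f \<in> hom S X (srt p)"
proof -
  have "\<exists>!g. even_quotient S X p i f g"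
    using fermat_even[of f "fst X" "snd X" p i] assms by (simp add: hom_def cnt_def)
  then have "even_quotient S X p i f (THE g. even_quotient S X p i f g)"
    by (rule theI')
  then have g: "(THE g. even_quotient S X p i f g) \<in> hom S (Suc (cnt False X), cnt True X) (srt p)"
    by (simp add: even_quotient_def Let_def cnt_def)
  have "set (evars S X @ [evars S X ! i]) \<subseteq> hom S X (srt False)" "set (ovars S X) \<subseteq> hom S X (srt True)"
    using assms(4) by (auto simp: evars_eq ovars_eq hom_def)
  then show ?thesis
    using theory_algebra.eval_in_ob[OF theory_algebra_Free, of "evars S X @ [evars S X ! i]" X "ovars S X"] g
    by (simp add: pdE_def evars_eq ovars_eq)
qed

lemma pdO_typed:
  assumes "f \<in> arr S" "src S f = X" "tgt S f = srt p" "i < cnt True X"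
  shows "pdO S X p i f \<in> hom S X (srt (\<not> p))"
proof -
  have "\<exists>!h. odd_quotient S X p i f h"
    using fermat_odd[of f "fst X" "snd X" p i] assms by (simp add: hom_def cnt_def)
  then have "odd_quotient S X p i f (THE h. odd_quotient S X p i f h)"
    by (rule theI')
  then have h: "(THE h. odd_quotient S X p i f h) \<in> hom S (cnt False X, cnt True X - 1) (srt (\<not> p))"
    by (simp add: odd_quotient_def Let_def cnt_def)
  have e: "set (evars S X) \<subseteq> hom S X (srt False)" and o: "set (ovars S X) \<subseteq> hom S X (srt True)"
    by (auto simp: evars_eq ovars_eq hom_def)
  have "set (drop_nth i (ovars S X)) \<subseteq> set (ovars S X)"
    unfolding drop_nth_def using set_take_subset set_drop_subset by fastforce
  with o have o': "set (drop_nth i (ovars S X)) \<subseteq> hom S X (srt True)"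
    by blast
  have l: "length (evars S X) = cnt False X" "length (drop_nth i (ovars S X)) = cnt True X - 1"
    using assms(4) by (simp_all add: evars_eq ovars_eq drop_nth_def)
  show ?thesis
    using theory_algebra.eval_in_ob[OF theory_algebra_Free, of "evars S X" X "drop_nth i (ovars S X)"
        "THE h. odd_quotient S X p i f h" "srt (\<not> p)"] e o' h
    unfolding l ob_Free pdO_def by blast
qed

text \<open>
  By the derivation rule, a map of algebras commutes with the differentials at \<open>f(u)\<close> if it does so
  at the components of \<open>u\<close>.
\<close>

lemma hom_d:
  assumes A: "super_diff_algebra S A dA" and B: "super_diff_algebra S B dB" and h: "alg_hom S A B h"
    and u: "u \<in> ob A X" and f: "f \<in> arr S" "src S f = X" "tgt S f = srt p"
    and gens: "\<And>s i. i < cnt s X \<Longrightarrow> h (srt (\<not> s)) (dA s (act A (gen S s X i) u)) =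
      dB s (h (srt s) (act A (gen S s X i) u))"
  shows "h (srt (\<not> p)) (dA p (act A f u)) = dB p (h (srt p) (act A f u))"
proof -
  interpret A: super_diff_algebra S A dA by fact
  interpret B: super_diff_algebra S B dB by fact
  note homs = A.S_algebra_axioms B.S_algebra_axioms h
  have hu: "h X u \<in> ob B X"
    using alg_homD(1)[OF h u] .
  have hact: "h Y (act A k u) = act B k (h X u)" if "k \<in> arr S" "src S k = X" "tgt S k = Y" for k Y
    using alg_homD(2)[OF h _ u, of k Y] that by (simp add: hom_def)
  have e: "h (srt (\<not> p)) (smul S A True p (dA False (act A (gen S False X i) u)) (act A (pdE S X p i f) u)) =
      smul S B True p (dB False (act B (gen S False X i) (h X u))) (act B (pdE S X p i f) (h X u))"
    if i: "i < cnt False X" for i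
  proof -
    have "pdE S X p i f \<in> hom S X (srt p)"
      using pdE_typed[OF f i] .
    then show ?thesis
      using hom_smul[OF homs, of "dA False (act A (gen S False X i) u)" True "act A (pdE S X p i f) u" p "\<not> p"]
        gens[OF i] u i by (simp add: hact hom_def)
  qed
  have eo: "smul S A True p (dA False (act A (gen S False X i) u)) (act A (pdE S X p i f) u) \<in> ob A (srt (\<not> p))"
    if i: "i < cnt False X" for i
    using pdE_typed[OF f i] u i by (simp add: hom_def)
  have o: "h (srt (\<not> p)) (smul S A False (\<not> p) (dA True (act A (gen S True X i) u)) (act A (pdO S X p i f) u)) =
      smul S B False (\<not> p) (dB True (act B (gen S True X i) (h X u))) (act B (pdO S X p i f) (h X u))"
    if i: "i < cnt True X" for i
  proof -
    have "pdO S X p i f \<in> hom S X (srt (\<not> p))"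
      using pdO_typed[OF f i] .
    then show ?thesis
      using hom_smul[OF homs, of "dA True (act A (gen S True X i) u)" False "act A (pdO S X p i f) u" "\<not> p" "\<not> p"]
        gens[OF i] u i by (simp add: hact hom_def)
  qed
  have oo: "smul S A False (\<not> p) (dA True (act A (gen S True X i) u)) (act A (pdO S X p i f) u) \<in> ob A (srt (\<not> p))"
    if i: "i < cnt True X" for i
    using pdO_typed[OF f i] u i by (simp add: hom_def)
  have le: "set (map (\<lambda>i. smul S A True p (dA False (act A (gen S False X i) u)) (act A (pdE S X p i f) u))
      [0..<cnt False X]) \<subseteq> ob A (srt (\<not> p))"
    using eo by auto
  have lo: "set (map (\<lambda>i. smul S A False (\<not> p) (dA True (act A (gen S True X i) u)) (act A (pdO S X p i f) u))
      [0..<cnt True X]) \<subseteq> ob A (srt (\<not> p))"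
    using oo by auto
  have me: "map (h (srt (\<not> p))) (map (\<lambda>i. smul S A True p (dA False (act A (gen S False X i) u))
      (act A (pdE S X p i f) u)) [0..<cnt False X]) =
    map (\<lambda>i. smul S B True p (dB False (act B (gen S False X i) (h X u)))
      (act B (pdE S X p i f) (h X u))) [0..<cnt False X]"
    unfolding map_map o_def by (rule map_cong[OF HOL.refl]) (rule e, simp)
  have mo: "map (h (srt (\<not> p))) (map (\<lambda>i. smul S A False (\<not> p) (dA True (act A (gen S True X i) u))
      (act A (pdO S X p i f) u)) [0..<cnt True X]) =
    map (\<lambda>i. smul S B False (\<not> p) (dB True (act B (gen S True X i) (h X u)))
      (act B (pdO S X p i f) (h X u))) [0..<cnt True X]"
    unfolding map_map o_def by (rule map_cong[OF HOL.refl]) (rule o, simp)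
  have "h (srt (\<not> p)) (dA p (act A f u)) = dB p (act B f (h X u))"
    unfolding d_formula[OF A u f] d_formula[OF B hu f]
      hom_sadd[OF homs A.ssum_in_ob[OF le] A.ssum_in_ob[OF lo]] hom_ssum[OF homs le] hom_ssum[OF homs lo]
      me mo ..
  then show ?thesis
    using hact f by simp
qed

end

lemma (in lawvere_theory) hom_pair:
  assumes "S_algebra S A" "S_algebra S B" "alg_hom S A B h" "u \<in> ob A X" "v \<in> ob A Y"
  shows "h (X + Y) (pair A X Y u v) = pair B X Y (h X u) (h Y v)"
proof -
  interpret A: theory_algebra S A
    using assms lawvere_theory_axioms by (simp add: theory_algebra_def)
  interpret B: theory_algebra S B
    using assms lawvere_theory_axioms by (simp add: theory_algebra_def)
  have w: "pair A X Y u v \<in> ob A (X + Y)"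
    using assms by simp
  show ?thesis
    by (rule B.pair_eqI[where X = X and Y = Y])
      (use alg_homD[OF assms(3)] alg_homD(2)[OF assms(3) _ w, of "pr1 X Y" X]
        alg_homD(2)[OF assms(3) _ w, of "pr2 X Y" Y] assms w in \<open>simp_all add: hom_def\<close>)
qed

context super_diff_algebra
begin

lemma hclass_self: "z \<in> ob A (srt p) \<Longrightarrow> z \<in> hclass S A d p z"
  unfolding hclass_def using image_eqI[of z "\<lambda>c. sadd S A p z (d (\<not> p) c)" "szero S A (\<not> p)"] by simp

text \<open>
  Homologous elements have the same class: \<open>z + d c + d e = z + d (c + e)\<close>, and \<open>e\<close> may be replaced by
  \<open>e - c\<close>.
\<close>

lemma hclass_eq:
  assumes z: "z \<in> ob A (srt p)" and c: "c \<in> ob A (srt (\<not> p))"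
  shows "hclass S A d p (sadd S A p z (d (\<not> p) c)) = hclass S A d p z"
proof -
  have *: "sadd S A p (sadd S A p z (d (\<not> p) c)) (d (\<not> p) e) =
      sadd S A p z (d (\<not> p) (sadd S A (\<not> p) c e))" if "e \<in> ob A (srt (\<not> p))" for e
    using that z c by (simp add: sadd_assoc d_add)
  show ?thesis
  proof (intro equalityI subsetI)
    fix y assume "y \<in> hclass S A d p (sadd S A p z (d (\<not> p) c))"
    then obtain e where e: "e \<in> ob A (srt (\<not> p))"
        "y = sadd S A p (sadd S A p z (d (\<not> p) c)) (d (\<not> p) e)"
      unfolding hclass_def by blast
    show "y \<in> hclass S A d p z"
      unfolding hclass_def e(2) *[OF e(1)] using c e(1) by (intro imageI) simp
  next
    fix y assume "y \<in> hclass S A d p z"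
    then obtain e where e: "e \<in> ob A (srt (\<not> p))" "y = sadd S A p z (d (\<not> p) e)"
      unfolding hclass_def by blast
    let ?e = "ssub S A (\<not> p) e c"
    have e': "?e \<in> ob A (srt (\<not> p))" "sadd S A (\<not> p) c ?e = e"
      using c e(1) sadd_commute[of c "\<not> p" ?e] by simp_all
    have "y = sadd S A p (sadd S A p z (d (\<not> p) c)) (d (\<not> p) ?e)"
      unfolding *[OF e'(1)] e'(2) by (rule e(2))
    then show "y \<in> hclass S A d p (sadd S A p z (d (\<not> p) c))"
      unfolding hclass_def using e'(1) by blast
  qed
qed

end

section \<open>The cylinder\<close>

locale cylinder = super_diff_algebra S A dA + D: super_diff_algebra S B dB +
    free_extension S A "srt False + srt True" B j i
  for S :: "('f, 'z) super_theory_scheme" and A :: "('f, 'a) alg" and dA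
    and B :: "('f, 'b) alg" and dB j i +
  fixes dW :: "bool \<Rightarrow> 'f \<Rightarrow> 'f"
  assumes integration: "admits_integration S"
    and Omega: "is_Omega_diff S dW"
    and diff_j: "diff_hom S A dA B dB j"
    and diff_i: "diff_hom S (Free S (srt False + srt True)) dW B dB i"
begin

abbreviation "Ev \<equiv> srt False"
abbreviation "Od \<equiv> srt True"

definition t :: 'b where "t = act B (pr1 Ev Od) w"
definition \<theta> :: 'b where "\<theta> = act B (pr2 Ev Od) w"

lemma t_in_ob [simp]: "t \<in> ob B Ev" and \<theta>_in_ob [simp]: "\<theta> \<in> ob B Od"
  by (simp_all add: t_def \<theta>_def)

lemma w_eq: "w = pair B Ev Od t \<theta>"
  unfolding t_def \<theta>_def by (rule D.pair_pr[symmetric]) simp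

lemma pr_Omega: "pr1 Ev Od = prE S (1, 1) 0" "pr2 Ev Od = prO S (1, 1) 0"
  using gen_pr1[of 0 False Ev Od] gen_pr2[of 0 True Od Ev]
  unfolding Omega_obj by (simp_all add: gen_def[of S _ "Ev + Od"])

lemma dj: "a \<in> ob A (srt p) \<Longrightarrow> q = (\<not> p) \<Longrightarrow> dB p (j (srt p) a) = j (srt q) (dA p a)"
  using diff_j unfolding diff_hom_def by simp

lemma d_t: "dB False t = \<theta>" and d_\<theta>: "dB True \<theta> = szero S B False"
proof -
  have t: "t = i Ev (pr1 Ev Od)" and \<theta>: "\<theta> = i Od (pr2 Ev Od)"
    unfolding t_def \<theta>_def by (simp_all add: i_eq hom_def)
  have di: "dB p (i (srt p) c) = i (srt (\<not> p)) (dW p c)" if "c \<in> hom S (Ev + Od) (srt p)" for p c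
    using diff_i that unfolding diff_hom_def by simp
  have W: "dW False (pr1 Ev Od) = pr2 Ev Od" "dW True (pr2 Ev Od) = szero S (Free S (Ev + Od)) False"
    using Omega unfolding is_Omega_diff_def pr_Omega Omega_obj by simp_all
  show "dB False t = \<theta>"
    using di[of "pr1 Ev Od" False] W by (simp add: t \<theta> hom_def)
  show "dB True \<theta> = szero S B False"
    using di[of "pr2 Ev Od" True] W hom_szero[OF S_algebra_Free D.S_algebra_axioms hom_i, of False]
    by (simp add: \<theta> hom_def)
qed

text \<open>
  The tuple \<open>(a, t)\<close>. The values of arrows at such tuples form the subalgebra \<open>A{t}\<close> of \<open>B\<close>.
\<close>

definition point :: "obj \<Rightarrow> 'a \<Rightarrow> 'b" where "point X a = pair B X Ev (j X a) t"

lemma point_in_ob [simp]: "a \<in> ob A X \<Longrightarrow> Y = X + Ev \<Longrightarrow> point X a \<in> ob B Y"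
  by (simp add: point_def)

lemma point_base_change [simp]:
  assumes "\<phi> \<in> arr S" "src S \<phi> = X" "tgt S \<phi> = Y" "a \<in> ob A X"
  shows "act B (base_change Ev \<phi>) (point X a) = point Y (act A \<phi> a)"
  using assms by (simp add: point_def)

lemma val_eq: "a \<in> ob A X \<Longrightarrow> val X f a = act B f (pair B (X + Ev) Od (point X a) \<theta>)"
  by (simp add: val_def w_eq point_def D.pair_assoc)

lemma in_ob_obtain:
  assumes "b \<in> ob B Z"
  obtains X f a where "f \<in> arr S" "src S f = X + Ev + Od" "tgt S f = Z" "a \<in> ob A X"
    "b = act B f (pair B (X + Ev) Od (point X a) \<theta>)"
  using assms by (rule rep) (use that val_eq add.assoc in metis)

text \<open>
  The principle of lemma \<open>zigzag_invariant\<close> for equal elements of \<open>B\<close>.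
\<close>

lemma invariant:
  assumes "f \<in> arr S" "src S f = X + Ev + Od" "tgt S f = Z" "a \<in> ob A X"
    and "h \<in> arr S" "src S h = Y + Ev + Od" "tgt S h = Z" "b \<in> ob A Y"
    and "act B f (pair B (X + Ev) Od (point X a) \<theta>) = act B h (pair B (Y + Ev) Od (point Y b) \<theta>)"
    and "\<And>\<phi> X Y a f. \<phi> \<in> arr S \<Longrightarrow> src S \<phi> = X \<Longrightarrow> tgt S \<phi> = Y \<Longrightarrow> a \<in> ob A X \<Longrightarrow> f \<in> arr S \<Longrightarrow>
      src S f = Y + Ev + Od \<Longrightarrow> tgt S f = Z \<Longrightarrow>
      \<Psi> X (cmp S f (base_change Od (base_change Ev \<phi>))) a = \<Psi> Y f (act A \<phi> a)"
  shows "\<Psi> X f a = \<Psi> Y h b"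
proof -
  have "zigzag A (Ev + Od) Z X f a Y h b"
    by (rule val_eqD) (use assms in \<open>simp_all add: val_eq add.assoc\<close>)
  then show ?thesis
  proof (rule zigzag_invariant)
    show "\<Psi> X (cmp S f (base_change (Ev + Od) \<phi>)) a = \<Psi> Y f (act A \<phi> a)"
      if "\<phi> \<in> hom S X Y" "a \<in> ob A X" "f \<in> hom S (Y + (Ev + Od)) Z" for \<phi> X Y a f
      using assms(10)[of \<phi> X Y a f] that by (simp add: base_change_add hom_def add.assoc)
  qed
qed

text \<open>
  The odd derivative is natural, so it is determined by the element \<open>\<theta> f(a, t)\<close> of \<open>B\<close>; its value
  is \<open>f(a, t)\<close>.
\<close>

lemma \<theta>_cancel:
  assumes "f \<in> arr S" "src S f = X + Ev" "tgt S f = srt q" "a \<in> ob A X"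
    and "h \<in> arr S" "src S h = Y + Ev" "tgt S h = srt q" "b \<in> ob A Y"
    and "smul S B True q \<theta> (act B f (point X a)) = smul S B True q \<theta> (act B h (point Y b))"
  shows "act B f (point X a) = act B h (point Y b)"
proof -
  have "act B (odd_deriv (X + Ev) (\<not> q) (theta_times (X + Ev) q f)) (point X a) =
      act B (odd_deriv (Y + Ev) (\<not> q) (theta_times (Y + Ev) q h)) (point Y b)"
  proof (rule invariant[where \<Psi> = "\<lambda>X f a. act B (odd_deriv (X + Ev) (\<not> q) f) (point X a)"])
    show "act B (theta_times (X + Ev) q f) (pair B (X + Ev) Od (point X a) \<theta>) =
        act B (theta_times (Y + Ev) q h) (pair B (Y + Ev) Od (point Y b) \<theta>)"
      using assms by (simp add: D.act_theta_times)
    show "act B (odd_deriv (X + Ev) (\<not> q) (cmp S f (base_change Od (base_change Ev \<phi>)))) (point X a) =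
        act B (odd_deriv (Y + Ev) (\<not> q) f) (point Y (act A \<phi> a))"
      if "\<phi> \<in> arr S" "src S \<phi> = X" "tgt S \<phi> = Y" "a \<in> ob A X" "f \<in> arr S"
        "src S f = Y + Ev + Od" "tgt S f = srt (\<not> q)" for \<phi> X Y a f
      using that by (simp add: odd_deriv_natural[where Y = "Y + Ev"])
  qed (use assms in simp_all)
  then show ?thesis
    using assms by (simp add: odd_deriv_theta_times)
qed

definition origin :: "obj \<Rightarrow> 'a \<Rightarrow> 'b" where "origin X a = pair B X Ev (j X a) (szero S B False)"

lemma origin_in_ob [simp]: "a \<in> ob A X \<Longrightarrow> Y = X + Ev \<Longrightarrow> origin X a \<in> ob B Y"
  by (simp add: origin_def)

text \<open>
  The difference \<open>F(a, t) - F(a, 0)\<close>, which is the integral from \<open>0\<close> to \<open>t\<close> of \<open>\<partial>F/\<partial>t\<close>.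
\<close>

definition increment :: "obj \<Rightarrow> bool \<Rightarrow> 'f \<Rightarrow> 'a \<Rightarrow> 'b" where
  "increment X p F a = ssub S B p (act B F (point X a)) (act B F (origin X a))"

text \<open>
  Two primitives differ by an arrow \<open>c\<close> that is constant in \<open>t\<close>, so \<open>c(a)\<close> cancels in the difference
  of the values at \<open>t\<close> and at \<open>0\<close>.
\<close>

lemma increment_unique:
  assumes F: "F \<in> arr S" "src S F = X + Ev" "tgt S F = srt p"
    and G: "G \<in> arr S" "src S G = X + Ev" "tgt S G = srt p"
    and "even_deriv X p F = even_deriv X p G" and a: "a \<in> ob A X"
  shows "increment X p F a = increment X p G a"
proof -
  obtain c where c: "c \<in> arr S" "src S c = X" "tgt S c = srt p"
      "ssub S (Free S (X + Ev)) p F G = cmp S c (pr1 X Ev)"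
    using integral_unique[OF integration F G assms(7)] by blast
  let ?c = "act B c (j X a)"
  have *: "act B F (pair B X Ev (j X a) s) = sadd S B p ?c (act B G (pair B X Ev (j X a) s))"
    if s: "s \<in> ob B Ev" for s
  proof -
    have u: "pair B X Ev (j X a) s \<in> ob B (X + Ev)"
      using a s by simp
    have "act B (ssub S (Free S (X + Ev)) p F G) (pair B X Ev (j X a) s) = ?c"
      using a s c u by simp
    then have "?c = ssub S B p (act B F (pair B X Ev (j X a) s)) (act B G (pair B X Ev (j X a) s))"
      using hom_ssub[OF S_algebra_Free D.S_algebra_axioms D.alg_hom_act[OF u], of F p G] F G
      by (simp add: hom_def)
    then show ?thesis
      using F G u by simp
  qed
  have o: "?c \<in> ob B (srt p)" "act B G (point X a) \<in> ob B (srt p)" "act B G (origin X a) \<in> ob B (srt p)"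
    using a c G by simp_all
  have "act B F (point X a) = sadd S B p ?c (sadd S B p (increment X p G a) (act B G (origin X a)))"
    unfolding increment_def using *[of t] o by (simp add: point_def)
  also have "\<dots> = sadd S B p (increment X p G a) (sadd S B p ?c (act B G (origin X a)))"
    unfolding increment_def using o
    by (simp add: D.sadd_assoc[symmetric] D.sadd_commute[of ?c])
  also have "sadd S B p ?c (act B G (origin X a)) = act B F (origin X a)"
    using *[of "szero S B False"] by (simp add: origin_def)
  finally show ?thesis
    unfolding increment_def[of X p F a] using o a F
    by (intro D.ssub_eqI) (simp_all add: increment_def)
qed

text \<open>
  The substitution of \<open>0\<close> for \<open>\<theta>\<close>. It lets arrows in the variables \<open>x, t, \<theta>\<close>, to which lemma
  \<open>invariant\<close> applies, be integrated with respect to \<open>t\<close>.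
\<close>

definition at_\<theta>_zero :: "obj \<Rightarrow> 'f" where
  "at_\<theta>_zero X = fork (idt S (X + Ev)) (zero (X + Ev) True)"

lemma arr_at_\<theta>_zero [simp]: "at_\<theta>_zero X \<in> arr S" "src S (at_\<theta>_zero X) = X + Ev"
    "tgt S (at_\<theta>_zero X) = X + Ev + Od"
  by (simp_all add: at_\<theta>_zero_def)

lemma at_\<theta>_zero_natural:
  assumes "\<phi> \<in> arr S" "src S \<phi> = X" "tgt S \<phi> = Y"
  shows "cmp S (base_change Od (base_change Ev \<phi>)) (at_\<theta>_zero X) = cmp S (at_\<theta>_zero Y) (base_change Ev \<phi>)"
  using assms by (simp add: at_\<theta>_zero_def base_change_def)

definition primitive :: "obj \<Rightarrow> bool \<Rightarrow> 'f \<Rightarrow> 'f" where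
  "primitive X p f = (SOME F. F \<in> arr S \<and> src S F = X + Ev \<and> tgt S F = srt p \<and> even_deriv X p F = f)"

lemma primitive:
  assumes "f \<in> arr S" "src S f = X + Ev" "tgt S f = srt p"
  shows "primitive X p f \<in> arr S" "src S (primitive X p f) = X + Ev"
    "tgt S (primitive X p f) = srt p" "even_deriv X p (primitive X p f) = f"
  using someI_ex[OF integral_ex[OF integration assms]] unfolding primitive_def by simp_all

text \<open>
  The integral of an arrow \<open>f(x, t)\<close> is natural in \<open>x\<close> by uniqueness of primitives, so it depends only
  on the element \<open>f(a, t)\<close> of \<open>B\<close>. Since \<open>\<partial>F/\<partial>t\<close> and the zero arrow have the same value at \<open>(a, t)\<close>,
  so do their integrals: \<open>F(a, t) - F(a, 0) = 0\<close>.
\<close>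

lemma constant_if_deriv_zero:
  assumes F: "F \<in> arr S" "src S F = X + Ev" "tgt S F = srt p" and a: "a \<in> ob A X"
    and z: "act B (even_deriv X p F) (point X a) = szero S B p"
  obtains c where "c \<in> ob A (srt p)" "act B F (point X a) = j (srt p) c"
proof -
  let ?z = "zero (X + Ev) p"
  have "increment X p (primitive X p (cmp S (cmp S (even_deriv X p F) (pr1 (X + Ev) Od)) (at_\<theta>_zero X))) a =
      increment X p (primitive X p (cmp S (cmp S ?z (pr1 (X + Ev) Od)) (at_\<theta>_zero X))) a"
  proof (rule invariant[where \<Psi> = "\<lambda>X f a. increment X p (primitive X p (cmp S f (at_\<theta>_zero X))) a"])
    show "act B (cmp S (even_deriv X p F) (pr1 (X + Ev) Od)) (pair B (X + Ev) Od (point X a) \<theta>) =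
        act B (cmp S ?z (pr1 (X + Ev) Od)) (pair B (X + Ev) Od (point X a) \<theta>)"
      using F a z by (simp del: zero_cmp)
    fix \<phi> X Y a f
    assume \<phi>: "\<phi> \<in> arr S" "src S \<phi> = X" "tgt S \<phi> = Y" and a: "a \<in> ob A X"
      and f: "f \<in> arr S" "src S f = Y + Ev + Od" "tgt S f = srt p"
    let ?f = "cmp S f (at_\<theta>_zero Y)" and ?g = "cmp S (cmp S f (base_change Od (base_change Ev \<phi>))) (at_\<theta>_zero X)"
    have f': "?f \<in> arr S" "src S ?f = Y + Ev" "tgt S ?f = srt p"
      and g: "?g \<in> arr S" "src S ?g = X + Ev" "tgt S ?g = srt p"
      using f \<phi> by simp_all
    have gf: "?g = cmp S ?f (base_change Ev \<phi>)"
      using f \<phi> by (simp add: at_\<theta>_zero_natural)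
    note P = primitive[OF f'] and P' = primitive[OF g]
    have "increment X p (primitive X p ?g) a =
        increment X p (cmp S (primitive Y p ?f) (base_change Ev \<phi>)) a"
    proof (rule increment_unique)
      show "even_deriv X p (primitive X p ?g) = even_deriv X p (cmp S (primitive Y p ?f) (base_change Ev \<phi>))"
        unfolding even_deriv_natural[OF P(1-3) \<phi>] P(4) P'(4) by (rule gf)
    qed (use P P' a \<phi> in simp_all)
    also have "\<dots> = increment Y p (primitive Y p ?f) (act A \<phi> a)"
      using P \<phi> a by (simp add: increment_def origin_def)
    finally show "increment X p (primitive X p ?g) a = increment Y p (primitive Y p ?f) (act A \<phi> a)" .
  qed (use F a in simp_all)
  moreover have "cmp S (cmp S f (pr1 (X + Ev) Od)) (at_\<theta>_zero X) = f" if "f \<in> arr S" "src S f = X + Ev" for f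
    using that by (simp add: at_\<theta>_zero_def)
  ultimately have "increment X p (primitive X p (even_deriv X p F)) a = increment X p (primitive X p ?z) a"
    using F by (simp del: cmp_cmp zero_cmp)
  moreover have "increment X p (primitive X p (even_deriv X p F)) a = increment X p F a"
    by (rule increment_unique) (use F a primitive[of "even_deriv X p F" X p] in simp_all)
  moreover have "increment X p (primitive X p ?z) a = increment X p ?z a"
    by (rule increment_unique) (use a primitive[of ?z X p] even_deriv_zero in simp_all)
  moreover have "increment X p ?z a = szero S B p"
    unfolding increment_def using a by simp
  ultimately have *: "increment X p F a = szero S B p"
    by simp
  have "act B F (point X a) = sadd S B p (increment X p F a) (act B F (origin X a))"
    unfolding increment_def using F a by simp
  also have "\<dots> = act B F (origin X a)"
    unfolding * using F a by simp
  also have "\<dots> = j (srt p) (act A F (pair A X Ev a (szero S A False)))"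
  proof -
    have "origin X a = j (X + Ev) (pair A X Ev a (szero S A False))"
    proof (rule D.pair_eqI)
      let ?u = "pair A X Ev a (szero S A False)"
      have u: "?u \<in> ob A (X + Ev)"
        using a by simp
      show "act B (pr1 X Ev) (origin X a) = act B (pr1 X Ev) (j (X + Ev) ?u)"
        using j_act[of "pr1 X Ev" ?u X] u a by (simp add: origin_def del: j_act)
      show "act B (pr2 X Ev) (origin X a) = act B (pr2 X Ev) (j (X + Ev) ?u)"
        using j_act[of "pr2 X Ev" ?u Ev] u a hom_szero[OF S_algebra_axioms D.S_algebra_axioms hom_j, of False]
        by (simp add: origin_def del: j_act)
    qed (use a in simp_all)
    then show ?thesis
      using F a by simp
  qed
  finally show ?thesis
    using that[of "act A F (pair A X Ev a (szero S A False))"] F a by simp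
qed

text \<open>
  The endomorphism of \<open>B\<close> that sets \<open>\<theta>\<close> to \<open>0\<close> and fixes \<open>t\<close> and the image of \<open>A\<close>. Its fixed elements
  are those of \<open>A{t}\<close>.
\<close>

definition restr :: "obj \<Rightarrow> 'b \<Rightarrow> 'b" where
  "restr = (SOME h. alg_hom S B B h \<and> (\<forall>X. \<forall>a \<in> ob A X. h X (j X a) = j X a) \<and>
    h (Ev + Od) w = pair B Ev Od t (szero S B True))"

lemma restr: "alg_hom S B B restr" "a \<in> ob A X \<Longrightarrow> restr X (j X a) = j X a"
    "restr (Ev + Od) w = pair B Ev Od t (szero S B True)"
proof -
  obtain h where "alg_hom S B B h" "\<And>X a. a \<in> ob A X \<Longrightarrow> h X (j X a) = j X a"
      "h (Ev + Od) w = pair B Ev Od t (szero S B True)"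
    by (rule extension[OF D.S_algebra_axioms hom_j, of "pair B Ev Od t (szero S B True)"])
      (simp, rule that)
  then have "\<exists>h. alg_hom S B B h \<and> (\<forall>X. \<forall>a \<in> ob A X. h X (j X a) = j X a) \<and>
      h (Ev + Od) w = pair B Ev Od t (szero S B True)"
    by blast
  from someI_ex[OF this] show "alg_hom S B B restr" "a \<in> ob A X \<Longrightarrow> restr X (j X a) = j X a"
    "restr (Ev + Od) w = pair B Ev Od t (szero S B True)"
    unfolding restr_def by simp_all
qed

lemma restr_in_ob [simp]: "b \<in> ob B X \<Longrightarrow> restr X b \<in> ob B X"
  by (rule alg_homD[OF restr(1)])

lemma restr_act: "f \<in> arr S \<Longrightarrow> tgt S f = Y \<Longrightarrow> b \<in> ob B (src S f) \<Longrightarrow> restr Y (act B f b) = act B f (restr (src S f) b)"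
  by (rule alg_homD(2)[OF restr(1)]) (simp_all add: hom_def)

lemma restr_t: "restr Ev t = t" and restr_\<theta>: "restr Od \<theta> = szero S B True"
  unfolding t_def \<theta>_def by (simp_all add: restr_act restr(3)) (simp_all add: t_def)

lemma restr_point: "a \<in> ob A X \<Longrightarrow> restr (X + Ev) (point X a) = point X a"
  unfolding point_def
  by (simp add: hom_pair[OF D.S_algebra_axioms D.S_algebra_axioms restr(1)] restr(2) restr_t)

lemma restr_fixes: "a \<in> ob A X \<Longrightarrow> f \<in> arr S \<Longrightarrow> src S f = X + Ev \<Longrightarrow> tgt S f = Z \<Longrightarrow>
    restr Z (act B f (point X a)) = act B f (point X a)"
  by (simp add: restr_act restr_point)

lemma restr_value: "a \<in> ob A X \<Longrightarrow> f \<in> arr S \<Longrightarrow> src S f = X + Ev + Od \<Longrightarrow> tgt S f = Z \<Longrightarrow>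
    restr Z (act B f (pair B (X + Ev) Od (point X a) \<theta>)) = act B f (pair B (X + Ev) Od (point X a) (szero S B True))"
  by (simp add: restr_act restr_point hom_pair[OF D.S_algebra_axioms D.S_algebra_axioms restr(1)] restr_\<theta>)

text \<open>
  This is the odd Fermat property \<open>f(\<theta>) - f(0) = (\<theta> - 0) h\<close>.
\<close>

lemma \<theta>_decomposition:
  assumes "b \<in> ob B (srt p)"
  obtains X h a where "h \<in> arr S" "src S h = X + Ev" "tgt S h = srt (\<not> p)" "a \<in> ob A X"
    "b = sadd S B p (restr (srt p) b) (smul S B True (\<not> p) \<theta> (act B h (point X a)))"
  using assms
proof (rule in_ob_obtain)
  fix X f a
  assume f: "f \<in> arr S" "src S f = X + Ev + Od" "tgt S f = srt p" and a: "a \<in> ob A X"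
    and b: "b = act B f (pair B (X + Ev) Od (point X a) \<theta>)"
  let ?h = "odd_deriv (X + Ev) p f"
  have o: "restr (srt p) b \<in> ob B (srt p)" "smul S B True (\<not> p) \<theta> (act B ?h (point X a)) \<in> ob B (srt p)"
    using f a assms by simp_all
  have "ssub S B p b (restr (srt p) b) = smul S B True (\<not> p) \<theta> (act B ?h (point X a))"
    using D.odd_quotient_value[OF odd_deriv_quotient[OF f] f, of "point X a" \<theta> "szero S B True"] a f
    by (simp add: b restr_value)
  then have "b = sadd S B p (smul S B True (\<not> p) \<theta> (act B ?h (point X a))) (restr (srt p) b)"
    using D.ssub_sadd[OF assms o(1)] by simp
  then have "b = sadd S B p (restr (srt p) b) (smul S B True (\<not> p) \<theta> (act B ?h (point X a)))"
    using D.sadd_commute[OF o] by simp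
  then show ?thesis
    using that[of ?h X a] f a by simp
qed

lemma restr_fixed_obtain:
  assumes "b \<in> ob B Z" "restr Z b = b"
  obtains X f a where "f \<in> arr S" "src S f = X + Ev" "tgt S f = Z" "a \<in> ob A X" "b = act B f (point X a)"
  using assms(1)
proof (rule in_ob_obtain)
  fix X f a
  assume f: "f \<in> arr S" "src S f = X + Ev + Od" "tgt S f = Z" and a: "a \<in> ob A X"
    and b: "b = act B f (pair B (X + Ev) Od (point X a) \<theta>)"
  have "b = act B f (pair B (X + Ev) Od (point X a) (szero S B True))"
    using assms(2) restr_value[OF a f] b by simp
  also have "\<dots> = act B (cmp S f (at_\<theta>_zero X)) (point X a)"
    using f a by (simp add: at_\<theta>_zero_def)
  finally show ?thesis
    using that[of "cmp S f (at_\<theta>_zero X)" X a] f a by simp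
qed

lemma gen_point:
  assumes "n < cnt s X" "a \<in> ob A X"
  shows "act B (gen S s (X + Ev) n) (point X a) = j (srt s) (act A (gen S s X n) a)"
proof -
  have "act B (gen S s (X + Ev) n) (point X a) = act B (cmp S (gen S s X n) (pr1 X Ev)) (point X a)"
    using assms by (simp only: gen_pr1)
  also have "\<dots> = j (srt s) (act A (gen S s X n) a)"
    using assms by (simp add: point_def)
  finally show ?thesis .
qed

lemma gen_point_last: "a \<in> ob A X \<Longrightarrow> act B (gen S False (X + Ev) (cnt False X)) (point X a) = t"
  by (simp add: point_def flip: pr2_srt)

text \<open>
  In the derivation rule for \<open>F(a, t)\<close>, the summands for the components of \<open>a\<close> are products of elements
  of \<open>A{t}\<close>, since \<open>d\<close> preserves the image of \<open>A\<close>. The remaining summand is \<open>d t = \<theta>\<close> times \<open>\<partial>F/\<partial>t\<close>.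
\<close>

lemma d_point:
  assumes F: "F \<in> arr S" "src S F = X + Ev" "tgt S F = srt p" and a: "a \<in> ob A X"
  shows "dB p (act B F (point X a)) = sadd S B (\<not> p) (restr (srt (\<not> p)) (dB p (act B F (point X a))))
    (smul S B True p \<theta> (act B (even_deriv X p F) (point X a)))"
proof -
  let ?Y = "X + Ev"
  let ?P = "\<lambda>i. smul S B True p (dB False (act B (gen S False ?Y i) (point X a))) (act B (pdE S ?Y p i F) (point X a))"
  let ?Q = "\<lambda>i. smul S B False (\<not> p) (dB True (act B (gen S True ?Y i) (point X a))) (act B (pdO S ?Y p i F) (point X a))"
  let ?y = "smul S B True p \<theta> (act B (even_deriv X p F) (point X a))"
  let ?U = "ssum S B (\<not> p) (map ?P [0..<cnt False X])" and ?V = "ssum S B (\<not> p) (map ?Q [0..<cnt True X])"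
  have xo: "point X a \<in> ob B ?Y"
    using a by simp
  note homs = D.S_algebra_axioms D.S_algebra_axioms restr(1)
  have dg: "dB s (act B (gen S s ?Y i) (point X a)) = j (srt (\<not> s)) (dA s (act A (gen S s X i) a))"
    if "i < cnt s X" for s i
    using that a by (simp add: gen_point dj del: j_act)
  have Po: "?P i \<in> ob B (srt (\<not> p))" and rP: "restr (srt (\<not> p)) (?P i) = ?P i" if i: "i < cnt False X" for i
  proof -
    have k: "pdE S ?Y p i F \<in> hom S ?Y (srt p)"
      using pdE_typed[OF F] i by simp
    then show "?P i \<in> ob B (srt (\<not> p))"
      using i a by (simp add: hom_def)
    show "restr (srt (\<not> p)) (?P i) = ?P i"
      unfolding dg[OF i]
      using hom_smul[OF homs, of "j Od (dA False (act A (gen S False X i) a))" True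
          "act B (pdE S ?Y p i F) (point X a)" p "\<not> p"] k i a
      by (simp add: hom_def restr_fixes restr(2))
  qed
  have Qo: "?Q i \<in> ob B (srt (\<not> p))" and rQ: "restr (srt (\<not> p)) (?Q i) = ?Q i" if i: "i < cnt True X" for i
  proof -
    have k: "pdO S ?Y p i F \<in> hom S ?Y (srt (\<not> p))"
      using pdO_typed[OF F] i by simp
    then show "?Q i \<in> ob B (srt (\<not> p))"
      using i a by (simp add: hom_def)
    show "restr (srt (\<not> p)) (?Q i) = ?Q i"
      unfolding dg[OF i]
      using hom_smul[OF homs, of "j Ev (dA True (act A (gen S True X i) a))" False
          "act B (pdO S ?Y p i F) (point X a)" "\<not> p" "\<not> p"] k i a
      by (simp add: hom_def restr_fixes restr(2))
  qed
  have lP: "set (map ?P [0..<cnt False X]) \<subseteq> ob B (srt (\<not> p))"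
    and lQ: "set (map ?Q [0..<cnt True X]) \<subseteq> ob B (srt (\<not> p))"
    using Po Qo by auto
  have y: "?y \<in> ob B (srt (\<not> p))"
    using F a by simp
  have mP: "map (restr (srt (\<not> p))) (map ?P [0..<cnt False X]) = map ?P [0..<cnt False X]"
    unfolding map_map o_def by (rule map_cong[OF HOL.refl]) (rule rP, simp)
  have mQ: "map (restr (srt (\<not> p))) (map ?Q [0..<cnt True X]) = map ?Q [0..<cnt True X]"
    unfolding map_map o_def by (rule map_cong[OF HOL.refl]) (rule rQ, simp)
  have rU: "restr (srt (\<not> p)) ?U = ?U" and rV: "restr (srt (\<not> p)) ?V = ?V"
    unfolding hom_ssum[OF homs lP] hom_ssum[OF homs lQ] mP mQ by (rule HOL.refl)+
  have ry: "restr (srt (\<not> p)) ?y = szero S B (\<not> p)"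
    using hom_smul[OF homs, of \<theta> True "act B (even_deriv X p F) (point X a)" p "\<not> p"] F a by (simp add: restr_\<theta>)
  have last: "?P (cnt False X) = ?y"
    using gen_point_last[OF a] by (simp add: d_t even_deriv_def cnt_def)
  have Uo: "?U \<in> ob B (srt (\<not> p))" and Vo: "?V \<in> ob B (srt (\<not> p))"
    by (rule D.ssum_in_ob[OF lP], rule D.ssum_in_ob[OF lQ])
  have "dB p (act B F (point X a)) = sadd S B (\<not> p)
      (ssum S B (\<not> p) (map ?P [0..<cnt False ?Y])) (ssum S B (\<not> p) (map ?Q [0..<cnt True ?Y]))"
    by (rule d_formula[OF D.super_diff_algebra_axioms xo F])
  also have "map ?P [0..<cnt False ?Y] = map ?P [0..<cnt False X] @ [?y]"
    unfolding last[symmetric] by simp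
  also have "ssum S B (\<not> p) \<dots> = sadd S B (\<not> p) ?U ?y"
    by (rule D.ssum_snoc[OF lP y])
  also have "map ?Q [0..<cnt True ?Y] = map ?Q [0..<cnt True X]"
    by simp
  also have "sadd S B (\<not> p) (sadd S B (\<not> p) ?U ?y) ?V = sadd S B (\<not> p) (sadd S B (\<not> p) ?U ?V) ?y"
    using Uo Vo y D.sadd_commute[OF y Vo] by (simp add: D.sadd_assoc)
  finally have d: "dB p (act B F (point X a)) = sadd S B (\<not> p) (sadd S B (\<not> p) ?U ?V) ?y" .
  have "restr (srt (\<not> p)) (dB p (act B F (point X a))) = sadd S B (\<not> p) ?U ?V"
    unfolding d using Uo Vo y by (simp add: hom_sadd[OF homs] rU rV ry)
  then show ?thesis
    using d by simp
qed

text \<open>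
  Evaluation at \<open>t = \<theta> = 0\<close>. It commutes with the differentials because \<open>d t = \<theta>\<close> and \<open>d \<theta> = 0\<close> are
  sent to \<open>0 = d 0\<close>.
\<close>

lemma ev0_ex:
  obtains e where "alg_hom S B A e" "\<And>X a. a \<in> ob A X \<Longrightarrow> e X (j X a) = a"
    "\<And>p b. b \<in> ob B (srt p) \<Longrightarrow> e (srt (\<not> p)) (dB p b) = dA p (e (srt p) b)"
proof -
  have id: "alg_hom S A A (\<lambda>X a. a)"
    unfolding alg_hom_def by (simp add: hom_def)
  let ?w = "pair A Ev Od (szero S A False) (szero S A True)"
  obtain e where e: "alg_hom S B A e" "\<And>X a. a \<in> ob A X \<Longrightarrow> e X (j X a) = a" "e (Ev + Od) w = ?w"
    by (rule extension[OF S_algebra_axioms id, of ?w]) (simp, rule that)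
  have et: "e Ev t = szero S A False" and e\<theta>: "e Od \<theta> = szero S A True"
    using alg_homD(2)[OF e(1), of "pr1 Ev Od" "Ev + Od" Ev w] alg_homD(2)[OF e(1), of "pr2 Ev Od" "Ev + Od" Od w] e(3)
    by (simp_all add: t_def \<theta>_def hom_def)
  have "e (srt (\<not> p)) (dB p b) = dA p (e (srt p) b)" if "b \<in> ob B (srt p)" for p b
    using that
  proof (rule in_ob_obtain)
    fix X f a
    assume f: "f \<in> arr S" "src S f = X + Ev + Od" "tgt S f = srt p" and a: "a \<in> ob A X"
      and b: "b = act B f (pair B (X + Ev) Od (point X a) \<theta>)"
    let ?u = "pair B (X + Ev) Od (point X a) \<theta>"
    have u: "?u \<in> ob B (X + Ev + Od)"
      using a by simp
    show ?thesis
      unfolding b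
    proof (rule hom_d[OF D.super_diff_algebra_axioms super_diff_algebra_axioms e(1) u f])
      fix s i assume i: "i < cnt s (X + Ev + Od)"
      show "e (srt (\<not> s)) (dB s (act B (gen S s (X + Ev + Od) i) ?u)) =
          dA s (e (srt s) (act B (gen S s (X + Ev + Od) i) ?u))"
      proof (cases "i < cnt s (X + Ev)")
        case True
        then have "act B (gen S s (X + Ev + Od) i) ?u =
            act B (cmp S (gen S s (X + Ev) i) (pr1 (X + Ev) Od)) ?u"
          by (simp only: gen_pr1)
        also have "\<dots> = act B (gen S s (X + Ev) i) (point X a)"
          using True a by simp
        finally have 1: "act B (gen S s (X + Ev + Od) i) ?u = act B (gen S s (X + Ev) i) (point X a)" .
        show ?thesis
        proof (cases "i < cnt s X")
          case True
          then show ?thesis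
            unfolding 1 using a by (simp add: gen_point dj e(2) del: j_act)
        next
          case False
          then have "s = False" "i = cnt False X"
            using \<open>i < cnt s (X + Ev)\<close> by (auto split: if_splits)
          then show ?thesis
            unfolding 1 using gen_point_last[OF a] by (simp add: d_t et e\<theta>)
        qed
      next
        case False
        then have s: "s = True" "i = cnt True (X + Ev)"
          using i by (auto split: if_splits)
        then have "act B (gen S s (X + Ev + Od) i) ?u = act B (pr2 (X + Ev) Od) ?u"
          by (simp only: pr2_srt)
        then have "act B (gen S s (X + Ev + Od) i) ?u = \<theta>"
          using a by simp
        then show ?thesis
          using s hom_szero[OF D.S_algebra_axioms S_algebra_axioms e(1), of False] by (simp add: d_\<theta> e\<theta>)
      qed
    qed
  qed
  then show ?thesis
    using that e by blast
qed

text \<open>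
  The class of the cycle \<open>b\<close> contains an element \<open>u\<close> of \<open>A{t}\<close>, obtained by subtracting the boundary of
  a primitive of the coefficient of \<open>\<theta>\<close>. Being a cycle, \<open>u\<close> has derivative zero.
\<close>

lemma cycle_representative:
  assumes b: "b \<in> cycles S B dB p"
  obtains c e where "c \<in> cycles S A dA p" "e \<in> ob B (srt (\<not> p))"
    "b = sadd S B p (j (srt p) c) (dB (\<not> p) e)"
proof -
  have bo: "b \<in> ob B (srt p)" and db: "dB p b = szero S B (\<not> p)"
    using b by (simp_all add: cycles_def)
  obtain X h a where h: "h \<in> arr S" "src S h = X + Ev" "tgt S h = srt (\<not> p)" and a: "a \<in> ob A X"
    and bh: "b = sadd S B p (restr (srt p) b) (smul S B True (\<not> p) \<theta> (act B h (point X a)))"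
    using bo by (rule \<theta>_decomposition)
  obtain F where F: "F \<in> arr S" "src S F = X + Ev" "tgt S F = srt (\<not> p)" and Fh: "even_deriv X (\<not> p) F = h"
    using integral_ex[OF integration h] by blast
  define e where "e = act B F (point X a)"
  have e: "e \<in> ob B (srt (\<not> p))"
    using F a by (simp add: e_def)
  define y where "y = smul S B True (\<not> p) \<theta> (act B h (point X a))"
  have y: "y \<in> ob B (srt p)"
    using h a by (simp add: y_def)
  have de: "dB (\<not> p) e = sadd S B p (restr (srt p) (dB (\<not> p) e)) y"
    using d_point[OF F a] by (simp add: e_def y_def Fh)
  \<comment> \<open>The terms \<open>y\<close> of \<open>b\<close> and of \<open>d e\<close> cancel in \<open>u = b - d e\<close>.\<close>
  define u where "u = ssub S B p (restr (srt p) b) (restr (srt p) (dB (\<not> p) e))"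
  have ro: "restr (srt p) b \<in> ob B (srt p)" "restr (srt p) (dB (\<not> p) e) \<in> ob B (srt p)" "dB (\<not> p) e \<in> ob B (srt p)"
    using bo e by simp_all
  have u: "u \<in> ob B (srt p)"
    using ro by (simp add: u_def)
  have "sadd S B p u (dB (\<not> p) e) = sadd S B p u (sadd S B p (restr (srt p) (dB (\<not> p) e)) y)"
    by (subst de) (rule HOL.refl)
  also have "\<dots> = sadd S B p (sadd S B p u (restr (srt p) (dB (\<not> p) e))) y"
    using u ro y by (simp add: D.sadd_assoc)
  also have "sadd S B p u (restr (srt p) (dB (\<not> p) e)) = restr (srt p) b"
    unfolding u_def using ro by simp
  finally have bu: "b = sadd S B p u (dB (\<not> p) e)"
    using bh by (simp add: y_def)
  have dde: "dB p (dB (\<not> p) e) = szero S B (\<not> p)"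
    using D.d_d[OF e] by simp
  have "szero S B (\<not> p) = dB p b"
    by (rule db[symmetric])
  also have "\<dots> = sadd S B (\<not> p) (dB p u) (dB p (dB (\<not> p) e))"
    by (subst bu) (rule D.d_add[OF u ro(3)])
  also have "\<dots> = dB p u"
    unfolding dde by (rule D.sadd_zero[OF D.d_in_ob[OF u HOL.refl]])
  finally have du: "dB p u = szero S B (\<not> p)" ..
  have rr: "restr Z (restr Z k) = restr Z k" if k: "k \<in> ob B Z" for Z k
    using k
  proof (rule in_ob_obtain)
    fix X f a
    assume f: "f \<in> arr S" "src S f = X + Ev + Od" "tgt S f = Z" and a: "a \<in> ob A X"
      and kf: "k = act B f (pair B (X + Ev) Od (point X a) \<theta>)"
    have "restr Z k = act B (cmp S f (at_\<theta>_zero X)) (point X a)"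
      using f a by (simp add: kf restr_value at_\<theta>_zero_def)
    then show ?thesis
      using restr_fixes[OF a, of "cmp S f (at_\<theta>_zero X)" Z] f by simp
  qed
  have "restr (srt p) u = u"
    unfolding u_def using hom_ssub[OF D.S_algebra_axioms D.S_algebra_axioms restr(1) ro(1,2)] rr[OF bo] rr[OF ro(3)]
    by simp
  with u obtain Y G c where G: "G \<in> arr S" "src S G = Y + Ev" "tgt S G = srt p" and c: "c \<in> ob A Y"
    and uG: "u = act B G (point Y c)"
    by (rule restr_fixed_obtain)
  \<comment> \<open>The coefficient of \<open>\<theta>\<close> in \<open>d u = 0\<close> vanishes.\<close>
  let ?v = "smul S B True p \<theta> (act B (even_deriv Y p G) (point Y c))"
  have "restr (srt (\<not> p)) (szero S B (\<not> p)) = szero S B (\<not> p)"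
    by (rule hom_szero[OF D.S_algebra_axioms D.S_algebra_axioms restr(1)])
  then have "sadd S B (\<not> p) (szero S B (\<not> p)) ?v = szero S B (\<not> p)"
    using d_point[OF G c, folded uG, unfolded du] by simp
  moreover have "?v \<in> ob B (srt (\<not> p))"
    using G c by simp
  ultimately have "?v = szero S B (\<not> p)"
    by simp
  also have "\<dots> = smul S B True p \<theta> (act B (zero (Y + Ev) p) (point Y c))"
    using c by simp
  finally have "?v = smul S B True p \<theta> (act B (zero (Y + Ev) p) (point Y c))" .
  then have "act B (even_deriv Y p G) (point Y c) = act B (zero (Y + Ev) p) (point Y c)"
    by (rule \<theta>_cancel[rotated -1]) (use G c in simp_all)
  then have "act B (even_deriv Y p G) (point Y c) = szero S B p"
    using c by simp
  then obtain k where k: "k \<in> ob A (srt p)" "act B G (point Y c) = j (srt p) k"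
    by (rule constant_if_deriv_zero[OF G c])
  have uk: "u = j (srt p) k"
    using uG k(2) by (rule trans)
  have "dA p k = szero S A (\<not> p)"
  proof -
    obtain ev where "alg_hom S B A ev" and ev: "\<And>X a. a \<in> ob A X \<Longrightarrow> ev X (j X a) = a"
      and "\<And>p b. b \<in> ob B (srt p) \<Longrightarrow> ev (srt (\<not> p)) (dB p b) = dA p (ev (srt p) b)"
      by (rule ev0_ex) (rule that)
    have "j (srt (\<not> p)) (dA p k) = dB p u"
      unfolding uk by (rule dj[OF k(1) HOL.refl, symmetric])
    also have "\<dots> = j (srt (\<not> p)) (szero S A (\<not> p))"
      unfolding du by (rule hom_szero[OF S_algebra_axioms D.S_algebra_axioms hom_j, symmetric])
    finally have "ev (srt (\<not> p)) (j (srt (\<not> p)) (dA p k)) =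
        ev (srt (\<not> p)) (j (srt (\<not> p)) (szero S A (\<not> p)))"
      by (rule arg_cong)
    then show ?thesis
      unfolding ev[OF d_in_ob[OF k(1) HOL.refl]] ev[OF szero_in_ob] .
  qed
  then have "k \<in> cycles S A dA p"
    using k(1) by (simp add: cycles_def)
  then show ?thesis
    using e bu[unfolded uk] by (rule that)
qed

lemma homology_map_hclass:
  assumes z: "z \<in> ob A (srt p)"
  shows "homology_map S B dB j p (hclass S A dA p z) = hclass S B dB p (j (srt p) z)"
proof -
  have "hclass S B dB p (j (srt p) y) = hclass S B dB p (j (srt p) z)" if "y \<in> hclass S A dA p z" for y
  proof -
    obtain c where c: "c \<in> ob A (srt (\<not> p))" "y = sadd S A p z (dA (\<not> p) c)"
      using \<open>y \<in> _\<close> unfolding hclass_def by blast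
    have "j (srt p) y = sadd S B p (j (srt p) z) (dB (\<not> p) (j (srt (\<not> p)) c))"
      using c z dj[OF c(1), of p] hom_sadd[OF S_algebra_axioms D.S_algebra_axioms hom_j z, of "dA (\<not> p) c"]
      by simp
    then show ?thesis
      using D.hclass_eq[of "j (srt p) z" p "j (srt (\<not> p)) c"] z c by simp
  qed
  then show ?thesis
    unfolding homology_map_def using hclass_self[OF z] by blast
qed

theorem homology_isomorphism: "homology_isomorphism S A dA B dB j"
  unfolding homology_isomorphism_def
proof (intro conjI allI)
  show "diff_hom S A dA B dB j"
    by (rule diff_j)
  fix p
  obtain ev where ev: "alg_hom S B A ev" "\<And>X a. a \<in> ob A X \<Longrightarrow> ev X (j X a) = a"
    "\<And>p b. b \<in> ob B (srt p) \<Longrightarrow> ev (srt (\<not> p)) (dB p b) = dA p (ev (srt p) b)"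
    by (rule ev0_ex) (rule that)
  show "bij_betw (homology_map S B dB j p) (homology S A dA p) (homology S B dB p)"
  proof (rule bij_betw_imageI)
    show "inj_on (homology_map S B dB j p) (homology S A dA p)"
    proof (rule inj_onI)
      fix K L assume "K \<in> homology S A dA p" "L \<in> homology S A dA p"
        and eq: "homology_map S B dB j p K = homology_map S B dB j p L"
      then obtain z y where z: "z \<in> ob A (srt p)" "K = hclass S A dA p z" and y: "y \<in> ob A (srt p)" "L = hclass S A dA p y"
        unfolding homology_def cycles_def by blast
      have "j (srt p) z \<in> hclass S B dB p (j (srt p) y)"
        using eq D.hclass_self[of "j (srt p) z" p] z y by (simp add: homology_map_hclass)
      then obtain c where c: "c \<in> ob B (srt (\<not> p))" "j (srt p) z = sadd S B p (j (srt p) y) (dB (\<not> p) c)"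
        unfolding hclass_def by blast
      have "z = ev (srt p) (sadd S B p (j (srt p) y) (dB (\<not> p) c))"
        using ev(2)[OF z(1)] c(2) by simp
      also have "\<dots> = sadd S A p y (dA (\<not> p) (ev (srt (\<not> p)) c))"
        using hom_sadd[OF D.S_algebra_axioms S_algebra_axioms ev(1), of "j (srt p) y" p "dB (\<not> p) c"]
          ev(2)[OF y(1)] ev(3)[OF c(1)] c y by simp
      finally have "z = sadd S A p y (dA (\<not> p) (ev (srt (\<not> p)) c))" .
      then show "K = L"
        unfolding z(2) y(2) using hclass_eq[OF y(1) alg_homD(1)[OF ev(1) c(1)]] by simp
    qed
    show "homology_map S B dB j p ` homology S A dA p = homology S B dB p"
    proof (intro equalityI subsetI)
      fix K assume "K \<in> homology_map S B dB j p ` homology S A dA p"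
      then obtain z where z: "z \<in> ob A (srt p)" "dA p z = szero S A (\<not> p)"
          "K = homology_map S B dB j p (hclass S A dA p z)"
        unfolding homology_def cycles_def by blast
      have "j (srt p) z \<in> cycles S B dB p"
        using z dj[OF z(1), of "\<not> p"] hom_szero[OF S_algebra_axioms D.S_algebra_axioms hom_j]
        by (simp add: cycles_def)
      then show "K \<in> homology S B dB p"
        using z by (simp add: homology_def homology_map_hclass)
    next
      fix K assume "K \<in> homology S B dB p"
      then obtain b where b: "b \<in> cycles S B dB p" "K = hclass S B dB p b"
        unfolding homology_def by blast
      obtain c e where c: "c \<in> cycles S A dA p" and e: "e \<in> ob B (srt (\<not> p))"
          "b = sadd S B p (j (srt p) c) (dB (\<not> p) e)"
        using b(1) by (rule cycle_representative)
      have co: "c \<in> ob A (srt p)"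
        using c by (simp add: cycles_def)
      have "K = homology_map S B dB j p (hclass S A dA p c)"
        using b(2) e co D.hclass_eq[of "j (srt p) c" p e] by (simp add: homology_map_hclass)
      then show "K \<in> homology_map S B dB j p ` homology S A dA p"
        unfolding homology_def using c by blast
    qed
  qed
qed

end

theorem corollary5p20:
  fixes S :: "'f super_theory"
    and A :: "('f, 'a) alg" and dA :: "bool \<Rightarrow> 'a \<Rightarrow> 'a"
    and d\<Omega> :: "bool \<Rightarrow> 'f \<Rightarrow> 'f"
    and B :: "('f, 'b) alg" and dB :: "bool \<Rightarrow> 'b \<Rightarrow> 'b"
    and j :: "obj \<Rightarrow> 'a \<Rightarrow> 'b" and i :: "obj \<Rightarrow> 'f \<Rightarrow> 'b"
  assumes "super_fermat_theory S"
    and "admits_integration S"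
    and "diff_algebra S A dA"
    and "is_Omega_diff S d\<Omega>"
    and "is_diff_coproduct S A dA (Free S (1, 1)) d\<Omega> B dB j i"
  shows "homology_isomorphism S A dA B dB j"
proof -
  note coprod = assms(5)[unfolded is_diff_coproduct_def Omega_obj]
  have A: "super_diff_algebra S A dA" and B: "super_diff_algebra S B dB"
    using assms(1,3) coprod by (simp_all add: super_diff_algebra_def)
  have "theory_algebra S A"
    using assms(1,3)
    by (simp add: theory_algebra_def super_fermat_theory_def diff_algebra_def)
  then have "free_extension S A (srt False + srt True) B j i"
    using coprod by (simp add: free_extension_def free_extension_axioms_def)
  then have "cylinder S A dA B dB j i d\<Omega>"
    using A B assms(2,4) coprod by (simp add: cylinder_def cylinder_axioms_def)
  then show ?thesis
    by (rule cylinder.homology_isomorphism)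
qed

end
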